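(* Let $\ell\in\mathbb{Z}_{>0}$ and $d\in\mathbb{Z}_{\geq 0}$. (i) For every $\boldsymbol{\lambda}\in\Lambda(\ell,d)$ and every $\mathbf{p}\in\mathbf{T}_{\boldsymbol{\lambda}}$, the functor $\mathrm{L}_{\mathbf{p}}$ defined in the context is a simple $\mathbb{C}\mathcal{G}_{(\ell,d)}$-module. (ii) The set $$\coprod_{\boldsymbol{\lambda}\in\Lambda(\ell,d)}\{\mathrm{L}_{\mathbf{p}}\mid \mathbf{p}\in\mathbf{T}_{\boldsymbol{\lambda}}\}$$ is a cross-section of the isomorphism classes of simple $\mathbb{C}\mathcal{G}_{(\ell,d)}$-modules (i.e. it contains exactly one representative of each isomorphism class).
   Context: Write $\underline{n}=\{1,\dots,n\}$. The groupoid $\mathcal{G}_{(\ell,d)}$: objects are all maps $f:\underline{d}\to\underline{\ell}$; morphisms from $f$ to $g$ are all bijections $\sigma:\underline{d}\to\underline{d}$ with $g\circ\sigma=f$; composition is composition of maps. $\mathbb{C}\mathcal{G}_{(\ell,d)}$ is its $\mathbb{C}$-linearization: same objects, morphism spaces $\mathbb{C}[\mathcal{G}_{(\ell,d)}(f,g)]$, bilinearly extended composition. A $\mathbb{C}\mathcal{G}_{(\ell,d)}$-module is a $\mathbb{C}$-linear functor from $\mathbb{C}\mathcal{G}_{(\ell,d)}$ to finite dimensional complex vector spaces; morphisms of modules are natural transformations. $\Lambda(\ell,d)$ is the set of all $(\lambda_1,\dots,\lambda_\ell)\in\mathbb{Z}_{\geq 0}^\ell$ with $\sum\lambda_i=d$.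 The type of an object $f$ is $\boldsymbol{\lambda}_f=(\lambda_1,\dots,\lambda_\ell)\in\Lambda(\ell,d)$ with $\lambda_i=|f^{-1}(i)|$. $\mathbf{T}_{\boldsymbol{\lambda}}$ is the set of $\ell$-tuples of partitions $\mathbf{p}=(p_1,\dots,p_\ell)$ with $p_i\vdash\lambda_i$. For $\mathbf{p}\in\mathbf{T}_{\boldsymbol{\lambda}}$, $\mathscr{S}_{\mathbf{p}}=\mathscr{S}_{p_1}\otimes\dots\otimes\mathscr{S}_{p_\ell}$ is the module over $S_{\boldsymbol{\lambda}}=S_{\lambda_1}\times\dots\times S_{\lambda_\ell}$ that is the external tensor product of the Specht modules $\mathscr{S}_{p_i}$ (the irreducible complex $S_{\lambda_i}$-modules attached to $p_i$). For $f,g$ of the same type, $\sigma_{f,g}\in\mathcal{G}_{(\ell,d)}(f,g)$ is the unique morphism such that $i<j$ and $f(i)=f(j)$ imply $\sigma_{f,g}(i)<\sigma_{f,g}(j)$. $f_{\boldsymbol{\lambda}}$ is the unique weakly increasing object of type $\boldsymbol{\lambda}$ (value $1$ on the first $\lambda_1$ integers, $2$ on the next $\lambda_2$, etc.), and $\mathcal{G}_{(\ell,d)}(f_{\boldsymbol{\lambda}},f_{\boldsymbol{\lambda}})$ is identified with $S_{\boldsymbol{\lambda}}$ in the evident way. For $\mathbf{p}\in\mathbf{T}_{\boldsymbol{\lambda}}$ define $\mathrm{L}_{\mathbf{p}}$ by: $\mathrm{L}_{\mathbf{p}}(f)=\mathscr{S}_{\mathbf{p}}$ if $f$ has type $\boldsymbol{\lambda}$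 and $\mathrm{L}_{\mathbf{p}}(f)=0$ otherwise; for $f,g$ of type $\boldsymbol{\lambda}$, $\pi\in\mathcal{G}_{(\ell,d)}(f,g)$ and $v\in\mathscr{S}_{\mathbf{p}}$, $\mathrm{L}_{\mathbf{p}}(\pi)v=(\sigma_{g,f_{\boldsymbol{\lambda}}}\,\pi\,\sigma_{f_{\boldsymbol{\lambda}},f})(v)$, where $\sigma_{g,f_{\boldsymbol{\lambda}}}\pi\sigma_{f_{\boldsymbol{\lambda}},f}\in\mathcal{G}_{(\ell,d)}(f_{\boldsymbol{\lambda}},f_{\boldsymbol{\lambda}})=S_{\boldsymbol{\lambda}}$; extend linearly. *)

theory Defs
  imports
    Complex_Main
    "HOL-Library.FuncSet"
    "HOL-Library.Function_Algebras"
    "HOL-Combinatorics.Permutations"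
    "HOL-Algebra.Module"
    "HOL-Algebra.Algebraic_Closure_Type"
begin

section \<open>Finite dimensional complex vector spaces\<close>

text \<open>
  A complex vector space is a module over the field of complex numbers in the sense of HOL-Algebra;
  it has its own carrier and operations. (The fields for multiplication and one, which the record
  inherits from rings, play no role.) Maps between such spaces only matter on the carriers.
\<close>

type_synonym 'v vspace = "(complex, 'v) module"

abbreviation complex_field :: "complex ring" where
  "complex_field \<equiv> ring_of_type_algebra"

definition fd_vspace :: "'v vspace \<Rightarrow> bool" where
  "fd_vspace V \<longleftrightarrow> Module.module complex_field V \<and>
     (\<exists>B. finite B \<and> B \<subseteq> carrier V \<and>
        carrier V = {(\<Oplus>\<^bsub>V\<^esub>b\<in>B. c b \<odot>\<^bsub>V\<^esub> b) | c. True})"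

definition lin_maps :: "'v vspace \<Rightarrow> 'w vspace \<Rightarrow> ('v \<Rightarrow> 'w) set" where
  "lin_maps V W = {h \<in> carrier V \<rightarrow> carrier W.
     (\<forall>x\<in>carrier V. \<forall>y\<in>carrier V. h (x \<oplus>\<^bsub>V\<^esub> y) = h x \<oplus>\<^bsub>W\<^esub> h y) \<and>
     (\<forall>c. \<forall>x\<in>carrier V. h (c \<odot>\<^bsub>V\<^esub> x) = c \<odot>\<^bsub>W\<^esub> h x)}"

text \<open>Spaces of complex functions, with pointwise operations.\<close>

interpretation cfun: vector_space "\<lambda>(c::complex) (v::'x \<Rightarrow> complex) x. c * v x"
  by unfold_locales (auto simp: fun_eq_iff algebra_simps)

definition fun_space :: "('x \<Rightarrow> complex) set \<Rightarrow> ('x \<Rightarrow> complex) vspace" where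
  "fun_space W = \<lparr>carrier = W, monoid.mult = undefined, one = undefined, zero = 0, add = (+),
     module.smult = (\<lambda>c v x. c * v x)\<rparr>"


section \<open>The groupoid and its linearization\<close>

text \<open>
  Maps from \<open>{1..d}\<close> to \<open>{1..l}\<close> are extensional functions; bijections of \<open>{1..d}\<close> are functions
  permuting that set and fixing everything else, so that their composition is \<open>(\<circ>)\<close>.
\<close>

definition objs :: "nat \<Rightarrow> nat \<Rightarrow> (nat \<Rightarrow> nat) set" where
  "objs l d = ({1..d} \<rightarrow>\<^sub>E {1..l})"

definition morphs :: "nat \<Rightarrow> (nat \<Rightarrow> nat) \<Rightarrow> (nat \<Rightarrow> nat) \<Rightarrow> (nat \<Rightarrow> nat) set" where
  "morphs d f g = {\<sigma>. \<sigma> permutes {1..d} \<and> (\<forall>k\<in>{1..d}. g (\<sigma> k) = f k)}"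

definition lin_morphs ::
    "nat \<Rightarrow> (nat \<Rightarrow> nat) \<Rightarrow> (nat \<Rightarrow> nat) \<Rightarrow> ((nat \<Rightarrow> nat) \<Rightarrow> complex) set" where
  "lin_morphs d f g = {a. \<forall>\<sigma>. \<sigma> \<notin> morphs d f g \<longrightarrow> a \<sigma> = 0}"

definition basis_morph :: "(nat \<Rightarrow> nat) \<Rightarrow> (nat \<Rightarrow> nat) \<Rightarrow> complex" where
  "basis_morph \<sigma> = (\<lambda>\<tau>. if \<tau> = \<sigma> then 1 else 0)"

text \<open>Composition of \<open>b\<close> from \<open>g\<close> to \<open>h\<close> after \<open>a\<close> from \<open>f\<close> to \<open>g\<close>.\<close>

definition lin_comp ::
    "nat \<Rightarrow> (nat \<Rightarrow> nat) \<Rightarrow> (nat \<Rightarrow> nat) \<Rightarrow> (nat \<Rightarrow> nat) \<Rightarrow>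
     ((nat \<Rightarrow> nat) \<Rightarrow> complex) \<Rightarrow> ((nat \<Rightarrow> nat) \<Rightarrow> complex) \<Rightarrow> (nat \<Rightarrow> nat) \<Rightarrow> complex" where
  "lin_comp d f g h b a =
     (\<Sum>\<rho>\<in>morphs d g h. \<Sum>\<sigma>\<in>morphs d f g. (\<lambda>\<tau>. b \<rho> * a \<sigma> * basis_morph (\<rho> \<circ> \<sigma>) \<tau>))"


section \<open>Modules over the linearized groupoid\<close>

text \<open>
  The action of a morphism takes its source and target as further arguments, since an element of
  \<open>lin_morphs d f g\<close> does not determine \<open>f\<close> and \<open>g\<close>.
\<close>

record 'v cg_module =
  space_at :: "(nat \<Rightarrow> nat) \<Rightarrow> 'v vspace"
  map_at :: "(nat \<Rightarrow> nat) \<Rightarrow> (nat \<Rightarrow> nat) \<Rightarrow> ((nat \<Rightarrow> nat) \<Rightarrow> complex) \<Rightarrow> 'v \<Rightarrow> 'v"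

definition is_cg_module :: "nat \<Rightarrow> nat \<Rightarrow> 'v cg_module \<Rightarrow> bool" where
  "is_cg_module l d M \<longleftrightarrow>
     (\<forall>f\<in>objs l d. fd_vspace (space_at M f)) \<and>
     (\<forall>f\<in>objs l d. \<forall>g\<in>objs l d. \<forall>a\<in>lin_morphs d f g.
        map_at M f g a \<in> lin_maps (space_at M f) (space_at M g)) \<and>
     (\<forall>f\<in>objs l d. \<forall>v\<in>carrier (space_at M f). map_at M f f (basis_morph id) v = v) \<and>
     (\<forall>f\<in>objs l d. \<forall>g\<in>objs l d. \<forall>h\<in>objs l d.
        \<forall>a\<in>lin_morphs d f g. \<forall>b\<in>lin_morphs d g h. \<forall>v\<in>carrier (space_at M f).
          map_at M f h (lin_comp d f g h b a) v = map_at M g h b (map_at M f g a v)) \<and>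
     (\<forall>f\<in>objs l d. \<forall>g\<in>objs l d.
        \<forall>a\<in>lin_morphs d f g. \<forall>b\<in>lin_morphs d f g. \<forall>v\<in>carrier (space_at M f).
          map_at M f g (a + b) v = map_at M f g a v \<oplus>\<^bsub>space_at M g\<^esub> map_at M f g b v) \<and>
     (\<forall>f\<in>objs l d. \<forall>g\<in>objs l d. \<forall>c.
        \<forall>a\<in>lin_morphs d f g. \<forall>v\<in>carrier (space_at M f).
          map_at M f g (\<lambda>\<sigma>. c * a \<sigma>) v = c \<odot>\<^bsub>space_at M g\<^esub> map_at M f g a v)"

definition cg_hom ::
    "nat \<Rightarrow> nat \<Rightarrow> 'v cg_module \<Rightarrow> 'w cg_module \<Rightarrow> ((nat \<Rightarrow> nat) \<Rightarrow> 'v \<Rightarrow> 'w) set" where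
  "cg_hom l d M N = {\<eta>.
     (\<forall>f\<in>objs l d. \<eta> f \<in> lin_maps (space_at M f) (space_at N f)) \<and>
     (\<forall>f\<in>objs l d. \<forall>g\<in>objs l d. \<forall>a\<in>lin_morphs d f g. \<forall>v\<in>carrier (space_at M f).
        \<eta> g (map_at M f g a v) = map_at N f g a (\<eta> f v))}"

definition cg_isomorphic :: "nat \<Rightarrow> nat \<Rightarrow> 'v cg_module \<Rightarrow> 'w cg_module \<Rightarrow> bool" where
  "cg_isomorphic l d M N \<longleftrightarrow> (\<exists>\<eta>\<in>cg_hom l d M N. \<exists>\<theta>\<in>cg_hom l d N M.
     (\<forall>f\<in>objs l d. (\<forall>v\<in>carrier (space_at M f). \<theta> f (\<eta> f v) = v) \<and>
                   (\<forall>w\<in>carrier (space_at N f). \<eta> f (\<theta> f w) = w)))"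

definition cg_submodule ::
    "nat \<Rightarrow> nat \<Rightarrow> ((nat \<Rightarrow> nat) \<Rightarrow> 'v set) \<Rightarrow> 'v cg_module \<Rightarrow> bool" where
  "cg_submodule l d N M \<longleftrightarrow>
     (\<forall>f\<in>objs l d. submodule (N f) complex_field (space_at M f)) \<and>
     (\<forall>f\<in>objs l d. \<forall>g\<in>objs l d. \<forall>a\<in>lin_morphs d f g. map_at M f g a ` N f \<subseteq> N g)"

definition simple_cg_module :: "nat \<Rightarrow> nat \<Rightarrow> 'v cg_module \<Rightarrow> bool" where
  "simple_cg_module l d M \<longleftrightarrow> is_cg_module l d M \<and>
     (\<exists>f\<in>objs l d. carrier (space_at M f) \<noteq> {\<zero>\<^bsub>space_at M f\<^esub>}) \<and>
     (\<forall>N. cg_submodule l d N M \<longrightarrow>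
        (\<forall>f\<in>objs l d. N f = {\<zero>\<^bsub>space_at M f\<^esub>}) \<or>
        (\<forall>f\<in>objs l d. N f = carrier (space_at M f)))"


section \<open>Specht modules\<close>

text \<open>A partition is the weakly decreasing list of its positive parts.\<close>

definition partitions_of :: "nat \<Rightarrow> nat list set" where
  "partitions_of n = {p. sorted_wrt (\<ge>) p \<and> 0 \<notin> set p \<and> sum_list p = n}"

definition diagram :: "nat list \<Rightarrow> (nat \<times> nat) set" where
  "diagram p = {(i, j). i < length p \<and> j < p ! i}"

definition tableaux :: "nat list \<Rightarrow> (nat \<times> nat \<Rightarrow> nat) set" where
  "tableaux p = {t. bij_betw t (diagram p) {1..sum_list p}}"

text \<open>
  The tabloid of a tableau (its class under permutations of entries within rows) is encoded by the
  function assigning to each row index the set of entries of that row. A permutation \<open>\<pi>\<close> acts on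
  tableaux by \<open>t \<mapsto> \<pi> \<circ> t\<close> and on tabloids by taking images of all rows.
\<close>

definition tabloid :: "nat list \<Rightarrow> (nat \<times> nat \<Rightarrow> nat) \<Rightarrow> nat \<Rightarrow> nat set" where
  "tabloid p t = (\<lambda>i. t ` {(i', j) \<in> diagram p. i' = i})"

definition column_stabilizer :: "nat list \<Rightarrow> (nat \<times> nat \<Rightarrow> nat) \<Rightarrow> (nat \<Rightarrow> nat) set" where
  "column_stabilizer p t = {\<pi>. \<pi> permutes {1..sum_list p} \<and>
     (\<forall>j. \<pi> ` t ` {(i, j') \<in> diagram p. j' = j} = t ` {(i, j') \<in> diagram p. j' = j})}"

text \<open>
  Elements of the permutation module on tabloids are complex functions of tabloids. The Specht
  module is the span of the polytabloids.
\<close>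

definition polytabloid :: "nat list \<Rightarrow> (nat \<times> nat \<Rightarrow> nat) \<Rightarrow> (nat \<Rightarrow> nat set) \<Rightarrow> complex" where
  "polytabloid p t = (\<Sum>\<pi>\<in>column_stabilizer p t.
     (\<lambda>T. of_int (sign \<pi>) * (if T = tabloid p (\<pi> \<circ> t) then 1 else 0)))"

definition specht :: "nat list \<Rightarrow> ((nat \<Rightarrow> nat set) \<Rightarrow> complex) set" where
  "specht p = cfun.span (polytabloid p ` tableaux p)"

text \<open>
  The action \<open>(\<sigma> v)(T) = v(\<sigma>\<^sup>-\<^sup>1 T)\<close>; for a permutation \<open>\<sigma>\<close>, \<open>\<sigma> -` A\<close> is the image of \<open>A\<close> under the
  inverse of \<open>\<sigma>\<close>.
\<close>

definition tabloid_inv_act :: "(nat \<Rightarrow> nat) \<Rightarrow> (nat \<Rightarrow> nat set) \<Rightarrow> nat \<Rightarrow> nat set" where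
  "tabloid_inv_act \<sigma> T = (\<lambda>i. \<sigma> -` T i)"

definition specht_act ::
    "(nat \<Rightarrow> nat) \<Rightarrow> ((nat \<Rightarrow> nat set) \<Rightarrow> complex) \<Rightarrow> (nat \<Rightarrow> nat set) \<Rightarrow> complex" where
  "specht_act \<sigma> v = (\<lambda>T. v (tabloid_inv_act \<sigma> T))"


section \<open>External tensor products\<close>

text \<open>
  The tensor product of spaces \<open>V 1, \<dots>, V l\<close> of functions on a set is realized as a space of
  functions of \<open>l\<close> variables: \<open>v\<^sub>1 \<otimes> \<dots> \<otimes> v\<^sub>l\<close> is the function \<open>x \<mapsto> v\<^sub>1 x\<^sub>1 \<cdots> v\<^sub>l x\<^sub>l\<close>. This is the
  tensor product because the canonical map from the latter to functions of \<open>l\<close> variables is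
  injective over a field. The elements do not depend on \<open>x i\<close> for \<open>i\<close> outside \<open>{1..l}\<close>.
\<close>

definition pure_tensor :: "nat \<Rightarrow> (nat \<Rightarrow> 'x \<Rightarrow> complex) \<Rightarrow> (nat \<Rightarrow> 'x) \<Rightarrow> complex" where
  "pure_tensor l v = (\<lambda>x. \<Prod>i\<in>{1..l}. v i (x i))"

definition tensor_space :: "nat \<Rightarrow> (nat \<Rightarrow> ('x \<Rightarrow> complex) set) \<Rightarrow> ((nat \<Rightarrow> 'x) \<Rightarrow> complex) set" where
  "tensor_space l V = cfun.span (pure_tensor l ` {v. \<forall>i\<in>{1..l}. v i \<in> V i})"

definition specht_tensor :: "nat \<Rightarrow> (nat \<Rightarrow> nat list) \<Rightarrow> ((nat \<Rightarrow> nat \<Rightarrow> nat set) \<Rightarrow> complex) set" where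
  "specht_tensor l p = tensor_space l (\<lambda>i. specht (p i))"

text \<open>The linear extension of the componentwise action on pure tensors.\<close>

definition specht_tensor_act ::
    "(nat \<Rightarrow> nat \<Rightarrow> nat) \<Rightarrow> ((nat \<Rightarrow> nat \<Rightarrow> nat set) \<Rightarrow> complex) \<Rightarrow>
     (nat \<Rightarrow> nat \<Rightarrow> nat set) \<Rightarrow> complex" where
  "specht_tensor_act s w = (\<lambda>x. w (\<lambda>i. tabloid_inv_act (s i) (x i)))"

lemma specht_tensor_act_pure:
  "specht_tensor_act s (pure_tensor l v) = pure_tensor l (\<lambda>i. specht_act (s i) (v i))"
  by (simp add: specht_tensor_act_def pure_tensor_def specht_act_def)


section \<open>The modules attached to tuples of partitions\<close>

definition weights :: "nat \<Rightarrow> nat \<Rightarrow> (nat \<Rightarrow> nat) set" where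
  "weights l d = {\<mu> \<in> {1..l} \<rightarrow>\<^sub>E UNIV. (\<Sum>i\<in>{1..l}. \<mu> i) = d}"

definition multipartitions :: "nat \<Rightarrow> (nat \<Rightarrow> nat) \<Rightarrow> (nat \<Rightarrow> nat list) set" where
  "multipartitions l \<mu> = (\<Pi>\<^sub>E i\<in>{1..l}. partitions_of (\<mu> i))"

definition type_of_obj :: "nat \<Rightarrow> nat \<Rightarrow> (nat \<Rightarrow> nat) \<Rightarrow> nat \<Rightarrow> nat" where
  "type_of_obj l d f = (\<lambda>i\<in>{1..l}. card {k \<in> {1..d}. f k = i})"

definition sigma_morph :: "nat \<Rightarrow> (nat \<Rightarrow> nat) \<Rightarrow> (nat \<Rightarrow> nat) \<Rightarrow> nat \<Rightarrow> nat" where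
  "sigma_morph d f g = (THE \<sigma>. \<sigma> \<in> morphs d f g \<and>
     (\<forall>i\<in>{1..d}. \<forall>j\<in>{1..d}. i < j \<and> f i = f j \<longrightarrow> \<sigma> i < \<sigma> j))"

definition std_obj :: "nat \<Rightarrow> nat \<Rightarrow> (nat \<Rightarrow> nat) \<Rightarrow> nat \<Rightarrow> nat" where
  "std_obj l d \<mu> = (THE f. f \<in> objs l d \<and> type_of_obj l d f = \<mu> \<and> mono_on {1..d} f)"

text \<open>
  The identification of the automorphism group of \<open>std_obj l d \<mu>\<close> with the product of the symmetric
  groups on \<open>{1..\<mu> i}\<close>: the \<open>i\<close>-th component of \<open>\<sigma>\<close> is its restriction to the \<open>i\<close>-th block of
  consecutive integers, shifted to \<open>{1..\<mu> i}\<close>.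
\<close>

definition block_component :: "(nat \<Rightarrow> nat) \<Rightarrow> (nat \<Rightarrow> nat) \<Rightarrow> nat \<Rightarrow> nat \<Rightarrow> nat" where
  "block_component \<mu> \<sigma> i = (\<lambda>k. if k \<in> {1..\<mu> i}
     then \<sigma> ((\<Sum>j\<in>{1..<i}. \<mu> j) + k) - (\<Sum>j\<in>{1..<i}. \<mu> j) else k)"

definition L_space ::
    "nat \<Rightarrow> nat \<Rightarrow> (nat \<Rightarrow> nat) \<Rightarrow> (nat \<Rightarrow> nat list) \<Rightarrow> (nat \<Rightarrow> nat) \<Rightarrow>
     ((nat \<Rightarrow> nat \<Rightarrow> nat set) \<Rightarrow> complex) vspace" where
  "L_space l d \<mu> p f = fun_space (if type_of_obj l d f = \<mu> then specht_tensor l p else {0})"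

definition L_morph ::
    "nat \<Rightarrow> nat \<Rightarrow> (nat \<Rightarrow> nat) \<Rightarrow> (nat \<Rightarrow> nat) \<Rightarrow> (nat \<Rightarrow> nat) \<Rightarrow> (nat \<Rightarrow> nat) \<Rightarrow>
     ((nat \<Rightarrow> nat \<Rightarrow> nat set) \<Rightarrow> complex) \<Rightarrow> (nat \<Rightarrow> nat \<Rightarrow> nat set) \<Rightarrow> complex" where
  "L_morph l d \<mu> f g \<pi> v = specht_tensor_act
     (block_component \<mu> (sigma_morph d g (std_obj l d \<mu>) \<circ> \<pi> \<circ> sigma_morph d (std_obj l d \<mu>) f)) v"

definition L_module ::
    "nat \<Rightarrow> nat \<Rightarrow> (nat \<Rightarrow> nat) \<Rightarrow> (nat \<Rightarrow> nat list) \<Rightarrow>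
     ((nat \<Rightarrow> nat \<Rightarrow> nat set) \<Rightarrow> complex) cg_module" where
  "L_module l d \<mu> p = \<lparr>space_at = L_space l d \<mu> p,
     map_at = (\<lambda>f g a v. if type_of_obj l d f = \<mu> \<and> type_of_obj l d g = \<mu>
       then (\<Sum>\<pi>\<in>morphs d f g. (\<lambda>x. a \<pi> * L_morph l d \<mu> f g \<pi> v x)) else 0)\<rparr>"

end

theory Submission
  imports Defs "HOL-Combinatorics.Orbits"
begin

text \<open>
  Simplicity and distinctness are James' argument. The antisymmetrizer of the column stabilizer of a
  tableau \<open>t\<close> of shape \<open>p\<close> maps every vector of the permutation module on tabloids of shape \<open>p\<close> to its
  pairing with the polytabloid of \<open>t\<close> times that polytabloid. It kills the permutation module of every
  other shape \<open>q\<close> whose sum of row indices, taken over all boxes, does not exceed that of \<open>p\<close>; this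
  numerical comparison replaces the dominance order.

  For completeness, class functions built from the coefficients \<open>\<langle>x e, e\<rangle>\<close> of polytabloids \<open>e\<close> are
  pairwise orthogonal for distinct partitions of \<open>n\<close>, and there are as many of them as cycle types.
  Hence the indicator function of the identity is a linear combination of them. Multiplying over the
  blocks gives the same for the automorphism group of the standard object. So for a nonzero vector \<open>v\<close>
  of a module \<open>M\<close> at the standard object, some average \<open>\<Sum> \<langle>\<kappa>\<^sup>-\<^sup>1 e, e\<rangle> \<kappa> v\<close> is nonzero, which yields a
  nonzero homomorphism from some \<open>L\<^sub>p\<close> to \<open>M\<close>; Schur's lemma concludes.
\<close>

unbundle no m_inv_syntax

text \<open>The numerical comparison works because a nonzero antisymmetrized value puts the entries
  of each column of \<open>t\<close> in different rows of the other tableau. Sliding them up their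
  columns can only lower the sum of row indices, and keeps it only if nothing moves, which forces
  equal shapes. The comparison is total, so for two distinct shapes at least one direction is
  killed; that suffices, since isomorphism and the orthogonality sum are symmetric. Completeness
  uses neither semisimplicity of the group algebra nor traces. Polytabloids have integer values, so
  a form without conjugation is positive on them, and orthogonality yields independence. Of the
  number of conjugacy classes only an upper bound enters: every permutation is conjugate to a
  representative attached to a partition. The indicator of the identity matters because the identity
  morphism fixes \<open>v\<close>: written as a combination of averages, it shows that not all
  averages annihilate \<open>v\<close>. On tensors, realized as functions of several variables,
  forms, antisymmetrizers and coefficients factor over the blocks, so multiplying out products of
  sums reduces everything to one symmetric group.\<close>

lemma sum_fun_apply: "(\<Sum>a\<in>A. f a) x = (\<Sum>a\<in>A. f a x)"
  by (induction A rule: infinite_finite_induct) auto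

section \<open>Tableaux and tabloids\<close>

lemma finite_diagram: "finite (diagram p)"
  and card_diagram: "card (diagram p) = sum_list p"
proof -
  have eq: "diagram p = (SIGMA i:{..<length p}. {..<p ! i})"
    by (auto simp: diagram_def)
  show "finite (diagram p)" unfolding eq by auto
  show "card (diagram p) = sum_list p"
    unfolding eq by (simp add: sum_list_sum_nth lessThan_atLeast0)
qed

text \<open>Row coordinate of the box that holds \<open>x\<close>; meaningful only for entries in
  \<open>{1..sum_list p}\<close>.\<close>

definition tableau_row :: "nat list \<Rightarrow> (nat \<times> nat \<Rightarrow> nat) \<Rightarrow> nat \<Rightarrow> nat" where
  "tableau_row p t x = fst (inv_into (diagram p) t x)"

definition tableau_col :: "nat list \<Rightarrow> (nat \<times> nat \<Rightarrow> nat) \<Rightarrow> nat \<Rightarrow> nat" where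
  "tableau_col p t x = snd (inv_into (diagram p) t x)"

lemma tableau_pos:
  assumes "t \<in> tableaux p" "x \<in> {1..sum_list p}"
  shows "(tableau_row p t x, tableau_col p t x) \<in> diagram p"
    and "t (tableau_row p t x, tableau_col p t x) = x"
proof -
  have "x \<in> t ` diagram p" using assms by (auto simp: tableaux_def bij_betw_def)
  then show "(tableau_row p t x, tableau_col p t x) \<in> diagram p"
    and "t (tableau_row p t x, tableau_col p t x) = x"
    by (simp_all add: tableau_row_def tableau_col_def inv_into_into f_inv_into_f)
qed

lemma tableau_entry:
  assumes "t \<in> tableaux p" "(i, j) \<in> diagram p"
  shows "t (i, j) \<in> {1..sum_list p}" "tableau_row p t (t (i, j)) = i" "tableau_col p t (t (i, j)) =
      j"
proof -
  have "inj_on t (diagram p)" "t ` diagram p = {1..sum_list p}"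
    using assms by (auto simp: tableaux_def bij_betw_def)
  then show "t (i, j) \<in> {1..sum_list p}" "tableau_row p t (t (i, j)) = i"
      "tableau_col p t (t (i, j)) = j"
    using assms by (auto simp: tableau_row_def tableau_col_def)
qed

lemma tabloid_eq_rows:
  assumes "t \<in> tableaux p"
  shows "tabloid p t i = {x \<in> {1..sum_list p}. tableau_row p t x = i}"
proof (intro Set.set_eqI iffI)
  fix x assume "x \<in> tabloid p t i"
  then obtain j where "(i, j) \<in> diagram p" "x = t (i, j)"
    by (auto simp: tabloid_def)
  then show "x \<in> {x \<in> {1..sum_list p}. tableau_row p t x = i}"
    using tableau_entry[OF assms] by auto
next
  fix x assume x: "x \<in> {x \<in> {1..sum_list p}. tableau_row p t x = i}"
  have "(i, tableau_col p t x) \<in> diagram p" "t (i, tableau_col p t x) = x"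
    using tableau_pos[OF assms, of x] x by auto
  then show "x \<in> tabloid p t i"
    unfolding tabloid_def by (auto intro!: image_eqI[of x t "(i, tableau_col p t x)"])
qed

lemma column_eq:
  assumes "t \<in> tableaux p"
  shows "t ` {(i, j') \<in> diagram p. j' = j} = {x \<in> {1..sum_list p}. tableau_col p t x = j}"
proof (intro Set.set_eqI iffI)
  fix x assume "x \<in> t ` {(i, j') \<in> diagram p. j' = j}"
  then obtain i where "(i, j) \<in> diagram p" "x = t (i, j)" by auto
  then show "x \<in> {x \<in> {1..sum_list p}. tableau_col p t x = j}"
    using tableau_entry[OF assms] by auto
next
  fix x assume x: "x \<in> {x \<in> {1..sum_list p}. tableau_col p t x = j}"
  have "(tableau_row p t x, j) \<in> diagram p" "t (tableau_row p t x, j) = x"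
    using tableau_pos[OF assms, of x] x by auto
  then show "x \<in> t ` {(i, j') \<in> diagram p. j' = j}"
    by (auto intro!: image_eqI[of x t "(tableau_row p t x, j)"])
qed

text \<open>Preserving column indices only sends each column into itself; columns are finite and
  permutations injective, so each column is sent onto itself. The pointwise form is the one that
  constructed permutations can be checked against.\<close>

lemma column_stabilizer_iff:
  assumes "t \<in> tableaux p"
  shows "\<pi> \<in> column_stabilizer p t \<longleftrightarrow> \<pi> permutes {1..sum_list p} \<and>
    (\<forall>x\<in>{1..sum_list p}. tableau_col p t (\<pi> x) = tableau_col p t x)"
proof -
  let ?N = "{1..sum_list p}"
  have "(\<forall>j. \<pi> ` {x \<in> ?N. tableau_col p t x = j} = {x \<in> ?N. tableau_col p t x = j}) \<longleftrightarrow>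
      (\<forall>x\<in>?N. tableau_col p t (\<pi> x) = tableau_col p t x)"
    if \<pi>: "\<pi> permutes ?N"
  proof
    assume *: "\<forall>j. \<pi> ` {x \<in> ?N. tableau_col p t x = j} = {x \<in> ?N. tableau_col p t x = j}"
    show "\<forall>x\<in>?N. tableau_col p t (\<pi> x) = tableau_col p t x"
    proof
      fix x assume "x \<in> ?N"
      then have "\<pi> x \<in> \<pi> ` {y \<in> ?N. tableau_col p t y = tableau_col p t x}" by blast
      then show "tableau_col p t (\<pi> x) = tableau_col p t x" by (subst (asm) *[rule_format]) auto
    qed
  next
    assume *: "\<forall>x\<in>?N. tableau_col p t (\<pi> x) = tableau_col p t x"
    show "\<forall>j. \<pi> ` {x \<in> ?N. tableau_col p t x = j} = {x \<in> ?N. tableau_col p t x = j}"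
    proof
      fix j
      have "\<pi> x \<in> ?N" if "x \<in> ?N" for x using permutes_in_image[OF \<pi>] that by blast
      then have "\<pi> ` {x \<in> ?N. tableau_col p t x = j} \<subseteq> {x \<in> ?N. tableau_col p t x = j}"
        using * by blast
      moreover have "inj_on \<pi> {x \<in> ?N. tableau_col p t x = j}"
        using permutes_inj[OF \<pi>] by (rule inj_on_subset) auto
      ultimately show "\<pi> ` {x \<in> ?N. tableau_col p t x = j} = {x \<in> ?N. tableau_col p t x = j}"
        by (intro endo_inj_surj) auto
    qed
  qed
  then show ?thesis
    by (auto simp: column_stabilizer_def column_eq[OF assms])
qed

lemma finite_column_stabilizer: "finite (column_stabilizer p t)"
  by (rule finite_subset[OF _ finite_permutations[of "{1..sum_list p}"]])
    (auto simp: column_stabilizer_def)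

lemma column_stabilizer_permutes:
  "\<pi> \<in> column_stabilizer p t \<Longrightarrow> \<pi> permutes {1..sum_list p}"
  by (simp add: column_stabilizer_def)

lemma id_in_column_stabilizer: "id \<in> column_stabilizer p t"
  by (simp add: column_stabilizer_def permutes_id)

lemma column_stabilizer_comp:
  assumes "\<pi> \<in> column_stabilizer p t" "\<rho> \<in> column_stabilizer p t"
  shows "\<pi> \<circ> \<rho> \<in> column_stabilizer p t"
  using assms by (simp add: column_stabilizer_def permutes_compose image_comp [symmetric] del:
      o_apply)

lemma column_stabilizer_inv:
  assumes "\<pi> \<in> column_stabilizer p t"
  shows "inv \<pi> \<in> column_stabilizer p t"
proof -
  have \<pi>: "\<pi> permutes {1..sum_list p}" using assms by (rule column_stabilizer_permutes)
  have "inv \<pi> ` A = A" if "\<pi> ` A = A" for A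
    by (metis \<pi> image_inv_f_f permutes_inj that)
  then show ?thesis
    using assms by (auto simp: column_stabilizer_def permutes_inv)
qed

text \<open>The columns of \<open>\<sigma> \<circ> t\<close> are the images under
  \<open>\<sigma>\<close> of the columns of \<open>t\<close>, so the stabilizers are
  conjugate.\<close>

lemma column_stabilizer_image:
  assumes \<sigma>: "\<sigma> permutes {1..sum_list p}"
  shows "column_stabilizer p (\<sigma> \<circ> t) = (\<lambda>\<pi>. \<sigma> \<circ> \<pi> \<circ> inv \<sigma>) ` column_stabilizer p t"
proof (intro equalityI subsetI)
  note inj = permutes_inj[OF \<sigma>]
  note surj = permutes_surj[OF \<sigma>]
  fix \<rho> assume \<rho>: "\<rho> \<in> column_stabilizer p (\<sigma> \<circ> t)"
  then have \<rho>p: "\<rho> permutes {1..sum_list p}" by (rule column_stabilizer_permutes)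
  let ?\<pi> = "inv \<sigma> \<circ> \<rho> \<circ> \<sigma>"
  have "?\<pi> ` t ` {(i, j') \<in> diagram p. j' = j} = t ` {(i, j') \<in> diagram p. j' = j}" for j
  proof -
    have "\<rho> ` \<sigma> ` t ` {(i, j') \<in> diagram p. j' = j} = \<sigma> ` t ` {(i, j') \<in> diagram p. j' = j}"
      using \<rho> by (simp add: column_stabilizer_def image_comp [symmetric] del: o_apply)
    moreover have "?\<pi> ` B = inv \<sigma> ` \<rho> ` \<sigma> ` B" for B by (simp add: image_comp o_assoc)
    ultimately show ?thesis by (simp add: image_inv_f_f[OF inj])
  qed
  then have "?\<pi> \<in> column_stabilizer p t"
    using \<sigma> \<rho>p by (auto simp: column_stabilizer_def permutes_compose permutes_inv)
  moreover have "\<rho> = \<sigma> \<circ> ?\<pi> \<circ> inv \<sigma>"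
    using surj by (simp add: fun_eq_iff surj_f_inv_f)
  ultimately show "\<rho> \<in> (\<lambda>\<pi>. \<sigma> \<circ> \<pi> \<circ> inv \<sigma>) ` column_stabilizer p t" by blast
next
  note inj = permutes_inj[OF \<sigma>]
  fix \<rho> assume "\<rho> \<in> (\<lambda>\<pi>. \<sigma> \<circ> \<pi> \<circ> inv \<sigma>) ` column_stabilizer p t"
  then obtain \<pi> where \<pi>: "\<pi> \<in> column_stabilizer p t" and \<rho>: "\<rho> = \<sigma> \<circ> \<pi> \<circ> inv \<sigma>" by blast
  have "\<rho> ` (\<sigma> \<circ> t) ` A = \<sigma> ` \<pi> ` t ` A" for A
    unfolding \<rho> by (simp add: image_comp o_def inv_f_f[OF inj])
  moreover have "\<pi> ` t ` {(i, j') \<in> diagram p. j' = j} = t ` {(i, j') \<in> diagram p. j' = j}" for j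
    using \<pi> by (simp add: column_stabilizer_def)
  ultimately have "\<rho> ` (\<sigma> \<circ> t) ` {(i, j') \<in> diagram p. j' = j} =
      (\<sigma> \<circ> t) ` {(i, j') \<in> diagram p. j' = j}" for j
    by (metis (lifting) image_comp)
  then show "\<rho> \<in> column_stabilizer p (\<sigma> \<circ> t)"
    using \<sigma> column_stabilizer_permutes[OF \<pi>]
    by (auto simp: column_stabilizer_def \<rho> permutes_compose permutes_inv)
qed

lemma tableaux_image:
  assumes "\<sigma> permutes {1..sum_list p}" "t \<in> tableaux p"
  shows "\<sigma> \<circ> t \<in> tableaux p"
  using assms by (auto simp: tableaux_def intro: bij_betw_trans permutes_imp_bij)

lemma tabloid_inv_act_id: "tabloid_inv_act id T = T"
  by (simp add: tabloid_inv_act_def)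

text \<open>Preimages reverse composition. Precomposing functions of tabloids with this map, as
  \<open>specht_act\<close> does, reverses the order once more and gives a left action.\<close>

lemma tabloid_inv_act_comp:
  "tabloid_inv_act (\<sigma> \<circ> \<tau>) T = tabloid_inv_act \<tau> (tabloid_inv_act \<sigma> T)"
  by (auto simp: tabloid_inv_act_def)

lemma tabloid_inv_act_tabloid:
  assumes "bij \<sigma>"
  shows "tabloid_inv_act \<sigma> (tabloid p t) = tabloid p (inv \<sigma> \<circ> t)"
  using assms by (simp add: tabloid_inv_act_def tabloid_def bij_vimage_eq_inv_image image_comp)

lemma tabloid_inv_act_eq_iff:
  assumes "bij \<sigma>"
  shows "tabloid_inv_act \<sigma> T = T' \<longleftrightarrow> T = tabloid_inv_act (inv \<sigma>) T'"
proof -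
  have "tabloid_inv_act (inv \<sigma>) (tabloid_inv_act \<sigma> S) = S"
       "tabloid_inv_act \<sigma> (tabloid_inv_act (inv \<sigma>) S) = S" for S
    using assms by (simp_all add: tabloid_inv_act_comp[symmetric] tabloid_inv_act_id
        bij_is_inj bij_is_surj surj_iff[THEN iffD1] inj_iff[THEN iffD1])
  then show ?thesis by metis
qed

lemma specht_act_id: "specht_act id v = v"
  by (simp add: specht_act_def tabloid_inv_act_id)

lemma specht_act_comp: "specht_act (\<sigma> \<circ> \<tau>) v = specht_act \<sigma> (specht_act \<tau> v)"
  by (simp add: specht_act_def tabloid_inv_act_comp)

definition tabloids :: "nat list \<Rightarrow> (nat \<Rightarrow> nat set) set" where
  "tabloids p = tabloid p ` tableaux p"

lemma finite_tabloids: "finite (tabloids p)"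
proof (rule finite_subset)
  let ?F = "{T. \<forall>i. (i \<in> {..<length p} \<longrightarrow> T i \<in> Pow {1..sum_list p}) \<and> (i \<notin> {..<length p} \<longrightarrow> T i =
      {})}"
  show "finite ?F"
    by (rule finite_set_of_finite_funs) auto
  have "tabloid p t \<in> ?F" if "t \<in> tableaux p" for t
  proof -
    have "tabloid p t i \<subseteq> {1..sum_list p}" for i
      using tabloid_eq_rows[OF that] by auto
    moreover have "tabloid p t i = {}" if "i \<notin> {..<length p}" for i
      using that by (auto simp: tabloid_def diagram_def)
    ultimately show ?thesis by blast
  qed
  then show "tabloids p \<subseteq> ?F" by (auto simp: tabloids_def)
qed

lemma tabloid_inv_act_in_tabloids:
  assumes "\<sigma> permutes {1..sum_list p}"
  shows "tabloid_inv_act \<sigma> T \<in> tabloids p \<longleftrightarrow> T \<in> tabloids p"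
proof -
  have *: "tabloid_inv_act \<tau> T \<in> tabloids p" if T: "T \<in> tabloids p"
      and \<tau>: "\<tau> permutes {1..sum_list p}" for T \<tau>
  proof -
    obtain t where "t \<in> tableaux p" "T = tabloid p t" using T by (auto simp: tabloids_def)
    then show ?thesis
      using tabloid_inv_act_tabloid[OF permutes_bij[OF \<tau>], of p t]
        tableaux_image[OF permutes_inv[OF \<tau>], of t] by (auto simp: tabloids_def)
  qed
  show ?thesis
    using *[of T \<sigma>] *[of "tabloid_inv_act \<sigma> T" "inv \<sigma>"] assms permutes_inv[OF assms]
      tabloid_inv_act_eq_iff[OF permutes_bij[OF assms]] by metis
qed

lemma ex_tableau: "\<exists>t. t \<in> tableaux p"
proof -
  have "card (diagram p) = card {1..sum_list p}" by (simp add: card_diagram)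
  then show ?thesis
    using finite_same_card_bij[OF finite_diagram, of "{1..sum_list p}" p]
    by (auto simp: tableaux_def)
qed

text \<open>A tableau is unconstrained outside the diagram, so two tableaux can be matched on the
  diagram only. The permutation is \<open>s\<close> after the inverse of \<open>t\<close>, extended
  by the identity.\<close>

lemma tableau_transitive:
  assumes "t \<in> tableaux p" "s \<in> tableaux p"
  obtains \<sigma> where "\<sigma> permutes {1..sum_list p}" "\<And>x. x \<in> diagram p \<Longrightarrow> s x = \<sigma> (t x)"
proof
  let ?N = "{1..sum_list p}"
  let ?\<sigma> = "\<lambda>x. if x \<in> ?N then s (inv_into (diagram p) t x) else x"
  have "bij_betw (s \<circ> inv_into (diagram p) t) ?N ?N"
    using assms bij_betw_inv_into bij_betw_trans unfolding tableaux_def by blast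
  then have "bij_betw ?\<sigma> ?N ?N"
    by (rule iffD1[OF bij_betw_cong, rotated]) auto
  then show "?\<sigma> permutes ?N"
    by (rule bij_imp_permutes) auto
  fix x assume x: "x \<in> diagram p"
  have "inj_on t (diagram p)" "t x \<in> ?N"
    using assms(1) x by (auto simp: tableaux_def bij_betw_def)
  then show "s x = ?\<sigma> (t x)" using x by simp
qed

section \<open>Column antisymmetrization\<close>

text \<open>Young's signed column sum of \<open>t\<close> applied to \<open>u\<close>, since
  \<open>u (tabloid_inv_act \<pi> T)\<close> is the value of \<open>specht_act \<pi> u\<close> at
  \<open>T\<close>. It is defined for arbitrary functions, so that it also acts on the permutation
  module of another shape.\<close>

definition column_antisym ::
    "nat list \<Rightarrow> (nat \<times> nat \<Rightarrow> nat) \<Rightarrow> ((nat \<Rightarrow> nat set) \<Rightarrow> complex) \<Rightarrow> (nat \<Rightarrow> nat set) \<Rightarrow> complex"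
  where "column_antisym p t u T =
    (\<Sum>\<pi>\<in>column_stabilizer p t. of_int (sign \<pi>) * u (tabloid_inv_act \<pi> T))"

lemma sum_column_stabilizer_comp:
  assumes "\<rho> \<in> column_stabilizer p t"
  shows "(\<Sum>\<pi>\<in>column_stabilizer p t. F (\<rho> \<circ> \<pi>)) = (\<Sum>\<pi>\<in>column_stabilizer p t. F \<pi>)"
proof (rule sum.reindex_bij_witness[of _ "\<lambda>\<pi>. inv \<rho> \<circ> \<pi>" "\<lambda>\<pi>. \<rho> \<circ> \<pi>"])
  have bij: "bij \<rho>" using column_stabilizer_permutes[OF assms] by (rule permutes_bij)
  fix \<pi> assume "\<pi> \<in> column_stabilizer p t"
  then show "\<rho> \<circ> \<pi> \<in> column_stabilizer p t" "inv \<rho> \<circ> \<pi> \<in> column_stabilizer p t"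
    using assms column_stabilizer_comp column_stabilizer_inv by blast+
  show "inv \<rho> \<circ> (\<rho> \<circ> \<pi>) = \<pi>" "\<rho> \<circ> (inv \<rho> \<circ> \<pi>) = \<pi>"
    using bij by (simp_all add: fun_eq_iff bij_is_inj bij_is_surj surj_f_inv_f)
qed auto

lemma sum_column_stabilizer_inv:
  "(\<Sum>\<pi>\<in>column_stabilizer p t. F (inv \<pi>)) = (\<Sum>\<pi>\<in>column_stabilizer p t. F \<pi>)"
proof (rule sum.reindex_bij_witness[of _ inv inv])
  fix \<pi> assume "\<pi> \<in> column_stabilizer p t"
  then show "inv (inv \<pi>) = \<pi>" "inv (inv \<pi>) = \<pi>" "inv \<pi> \<in> column_stabilizer p t"
      "inv \<pi> \<in> column_stabilizer p t" "F (inv \<pi>) = F (inv \<pi>)"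
    using column_stabilizer_inv permutes_inv_inv[OF column_stabilizer_permutes] by blast+
qed

lemma sign_column_stabilizer_comp:
  assumes "\<rho> \<in> column_stabilizer p t" "\<pi> \<in> column_stabilizer p t"
  shows "sign (\<rho> \<circ> \<pi>) = sign \<rho> * sign \<pi>"
  by (rule sign_compose[OF permutes_imp_permutation permutes_imp_permutation,
        OF _ column_stabilizer_permutes[OF assms(1)] _ column_stabilizer_permutes[OF assms(2)]])
            auto

lemma sign_column_stabilizer_inv:
  assumes "\<pi> \<in> column_stabilizer p t"
  shows "sign (inv \<pi>) = sign \<pi>"
  by (rule sign_inverse[OF permutes_imp_permutation, OF _ column_stabilizer_permutes[OF assms]])
      auto

text \<open>Reindexing the group sum by left multiplication with \<open>\<rho>\<close> costs a
  factor \<open>sign \<rho>\<close>, which is its own inverse.\<close>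

lemma column_antisym_act_column:
  assumes "\<rho> \<in> column_stabilizer p t"
  shows "column_antisym p t u (tabloid_inv_act \<rho> T) = of_int (sign \<rho>) * column_antisym p t u T"
proof -
  have "column_antisym p t u (tabloid_inv_act \<rho> T) =
      (\<Sum>\<pi>\<in>column_stabilizer p t. of_int (sign \<rho> * sign (\<rho> \<circ> \<pi>)) * u (tabloid_inv_act (\<rho> \<circ> \<pi>) T))"
    unfolding column_antisym_def
    by (intro sum.cong)
      (auto simp: sign_column_stabilizer_comp[OF assms] tabloid_inv_act_comp mult.assoc[symmetric]
          sign_idempotent
        simp flip: of_int_mult)
  also have "\<dots> = (\<Sum>\<pi>\<in>column_stabilizer p t. of_int (sign \<rho> * sign \<pi>) * u (tabloid_inv_act \<pi> T))"
    by (rule sum_column_stabilizer_comp[OF assms])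
  finally show ?thesis by (simp add: column_antisym_def sum_distrib_left mult.assoc)
qed

text \<open>The transposition of \<open>x\<close> and \<open>y\<close> is an odd element of the
  column group that fixes \<open>T\<close>, so the value equals its own negative.\<close>

lemma column_antisym_eq_0_transpose:
  assumes t: "t \<in> tableaux p" and x: "x \<in> {1..sum_list p}" and y: "y \<in> {1..sum_list p}"
    and "x \<noteq> y" and col: "tableau_col p t x = tableau_col p t y"
    and row: "\<And>i. x \<in> T i \<longleftrightarrow> y \<in> T i"
  shows "column_antisym p t u T = 0"
proof -
  let ?\<tau> = "transpose x y"
  have "?\<tau> permutes {1..sum_list p}" using x y by (rule permutes_swap_id)
  then have mem: "?\<tau> \<in> column_stabilizer p t"
    using col by (auto simp: column_stabilizer_iff[OF t] transpose_def)
  have "?\<tau> -` T i = T i" for i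
    using row[of i] by (auto simp: transpose_def split: if_splits)
  then have "tabloid_inv_act ?\<tau> T = T" by (simp add: tabloid_inv_act_def)
  then have "column_antisym p t u T = - column_antisym p t u T"
    using column_antisym_act_column[OF mem, of u T] \<open>x \<noteq> y\<close> by (simp add: sign_swap_id)
  then show ?thesis by simp
qed

section \<open>Comparing shapes by the sum of row indices\<close>

text \<open>The statistic usually written n(p), with rows numbered from 0.\<close>

definition row_weight :: "nat list \<Rightarrow> nat" where
  "row_weight p = (\<Sum>x\<in>diagram p. fst x)"

text \<open>With \<open>m = card A\<close>, as many elements of \<open>A\<close> lie outside
  \<open>{..<m}\<close> as are missing from it; the former are at least \<open>m\<close>, the latter
  at most \<open>m - 1\<close>.\<close>

lemma sum_ge_initial_segment:
  fixes A :: "nat set"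
  assumes "finite A"
  shows "\<Sum>{..<card A} \<le> \<Sum>A" and "\<Sum>A \<le> \<Sum>{..<card A} \<Longrightarrow> A = {..<card A}"
proof -
  let ?m = "card A"
  let ?U = "A - {..<?m}" and ?L = "{..<?m} - A"
  have cardeq: "card ?U = card ?L"
    using card_Diff_subset_Int[of A "{..<?m}"] card_Diff_subset_Int[of "{..<?m}" A] assms
    by (simp add: Int_commute)
  have s1: "\<Sum>A = \<Sum>(A \<inter> {..<?m}) + \<Sum>?U" using assms by (rule sum.Int_Diff)
  have s2: "\<Sum>{..<?m} = \<Sum>(A \<inter> {..<?m}) + \<Sum>?L"
    using sum.Int_Diff[of "{..<?m}" "\<lambda>x. x" A] by (simp add: Int_commute)
  have u: "card ?U * ?m \<le> \<Sum>?U"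
    using sum_bounded_below[of ?U ?m "\<lambda>x. x"] by auto
  have l: "\<Sum>?L \<le> card ?L * (?m - 1)"
    using sum_bounded_above[of ?L "\<lambda>x. x" "?m - 1"] by fastforce
  have lu: "card ?L * (?m - 1) \<le> card ?U * ?m" using cardeq by simp
  show "\<Sum>{..<?m} \<le> \<Sum>A" using s1 s2 u l lu by linarith
  assume "\<Sum>A \<le> \<Sum>{..<?m}"
  then have "\<Sum>?U \<le> \<Sum>?L" using s1 s2 by linarith
  then have "card ?U * ?m \<le> card ?U * (?m - 1)"
    using order_trans[OF u order_trans[OF _ l]] by (simp only: cardeq)
  moreover have "?U = {}" if "card ?U = 0" using that assms by simp
  \<comment> \<open>Truncated subtraction gives \<open>?m - 1 = ?m\<close> when
    \<open>?m = 0\<close>, so the strict comparison needs \<open>A\<close> to be nonempty.\<close>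
  moreover have "?m > 0" if "?U \<noteq> {}" using that assms by (auto simp: card_gt_0_iff)
  ultimately have "?U = {}" by (cases "?U = {}") auto
  moreover from this have "?L = {}" using cardeq
      by (metis card.empty card_0_eq finite_Diff finite_lessThan)
  ultimately show "A = {..<?m}" by blast
qed

text \<open>Column by column, an initial segment has the least sum among all sets of its size and is
  the only one attaining it. \<open>D\<close> will be a Young diagram and \<open>D'\<close> a set of
  boxes with the same column lengths.\<close>

lemma column_rearrangement:
  fixes D D' :: "(nat \<times> nat) set"
  assumes fin: "finite D" "finite D'"
    and top: "\<And>j. {i. (i, j) \<in> D} = {..<card {i. (i, j) \<in> D}}"
    and card: "\<And>j. card {i. (i, j) \<in> D'} = card {i. (i, j) \<in> D}"
  shows "(\<Sum>x\<in>D. fst x) \<le> (\<Sum>x\<in>D'. fst x)"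
    and "(\<Sum>x\<in>D'. fst x) \<le> (\<Sum>x\<in>D. fst x) \<Longrightarrow> D' = D"
proof -
  define J where "J = snd ` (D \<union> D')"
  have J: "finite J" using fin by (simp add: J_def)
  have col: "finite {i. (i, j) \<in> E}" if "finite E" for E :: "(nat \<times> nat) set" and j
    by (rule finite_subset[of _ "fst ` E"]) (use that in force)+
  have split: "(\<Sum>x\<in>E. fst x) = (\<Sum>j\<in>J. \<Sum>{i. (i, j) \<in> E})" if "E \<subseteq> D \<union> D'" for E
  proof -
    have E: "finite E" using that fin finite_subset by blast
    have "(\<Sum>j\<in>J. \<Sum>{i. (i, j) \<in> E}) = (\<Sum>(j, i)\<in>(SIGMA j:J. {i. (i, j) \<in> E}). i)"
      using J col[OF E] by (intro sum.Sigma) auto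
    also have "\<dots> = (\<Sum>x\<in>E. fst x)"
      by (rule sum.reindex_bij_witness[of _ "\<lambda>(i, j). (j, i)" "\<lambda>(j, i). (i, j)"])
        (use that in \<open>force simp: J_def\<close>)+
    finally show ?thesis by simp
  qed
  have le: "\<Sum>{i. (i, j) \<in> D} \<le> \<Sum>{i. (i, j) \<in> D'}" for j
    using sum_ge_initial_segment(1)[OF col[OF fin(2)], of j] by (simp add: card top[symmetric])
  show "(\<Sum>x\<in>D. fst x) \<le> (\<Sum>x\<in>D'. fst x)"
    using le by (simp add: split sum_mono)
  assume "(\<Sum>x\<in>D'. fst x) \<le> (\<Sum>x\<in>D. fst x)"
  then have "(\<Sum>j\<in>J. \<Sum>{i. (i, j) \<in> D}) = (\<Sum>j\<in>J. \<Sum>{i. (i, j) \<in> D'})"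
    by (intro order.antisym[OF sum_mono[OF le]]) (simp add: split)
  then have "\<Sum>{i. (i, j) \<in> D} = \<Sum>{i. (i, j) \<in> D'}" if "j \<in> J" for j
    using sum_mono_inv[of "\<lambda>j. \<Sum>{i. (i, j) \<in> D}" J "\<lambda>j. \<Sum>{i. (i, j) \<in> D'}" j] le that J
    by blast
  then have "{i. (i, j) \<in> D'} = {i. (i, j) \<in> D}" if "j \<in> J" for j
    using sum_ge_initial_segment(2)[OF col[OF fin(2)], of j] that by (simp add: card top[symmetric])
  moreover have "{i. (i, j) \<in> D'} = {i. (i, j) \<in> D}" if "j \<notin> J" for j
    using that by (force simp: J_def)
  ultimately have "{i. (i, j) \<in> D'} = {i. (i, j) \<in> D}" for j by blast
  then show "D' = D" by (auto simp: set_eq_iff)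
qed

lemma diagram_row: "{j. (i, j) \<in> diagram p} = {..<if i < length p then p ! i else 0}"
  by (auto simp: diagram_def)

text \<open>Row lengths decrease weakly, so a column that meets a row meets all rows above it; a
  finite downward closed set of naturals is an initial segment.\<close>

lemma diagram_column:
  assumes "p \<in> partitions_of n"
  shows "{i. (i, j) \<in> diagram p} = {..<card {i. (i, j) \<in> diagram p}}"
proof -
  let ?A = "{i. (i, j) \<in> diagram p}"
  have "finite ?A" by (rule finite_subset[of _ "{..<length p}"]) (auto simp: diagram_def)
  have down: "i' \<in> ?A" if "i \<in> ?A" "i' \<le> i" for i i'
  proof (cases "i' = i")
    case False
    then have "p ! i' \<ge> p ! i"
      using assms that by (auto simp: partitions_of_def diagram_def sorted_wrt_iff_nth_less)
    then show ?thesis using that by (auto simp: diagram_def)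
  qed (use that in simp)
  have "\<exists>m. ?A = {..<m}"
  proof (cases "?A = {}")
    case False
    then have "?A = {..Max ?A}"
      using down[of "Max ?A"] Max_in[OF \<open>finite ?A\<close>] Max_ge[OF \<open>finite ?A\<close>] by blast
    then show ?thesis by (metis lessThan_Suc_atMost)
  qed (auto intro: exI[of _ 0])
  then show ?thesis by (metis card_lessThan)
qed

text \<open>Parts are positive, so the length of the list can be read off from the nonempty
  rows.\<close>

lemma partition_eq_of_row_cards:
  assumes "p \<in> partitions_of n" "q \<in> partitions_of m"
    and card: "\<And>i. card {j. (i, j) \<in> diagram p} = card {j. (i, j) \<in> diagram q}"
  shows "p = q"
proof -
  have pos: "r ! i > 0" if "r \<in> partitions_of k" "i < length r" for r k i
    using that nth_mem[of i r] by (cases "r ! i = 0") (auto simp: partitions_of_def)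
  have eq: "(if i < length p then p ! i else 0) = (if i < length q then q ! i else 0)" for i
    using card[of i] by (simp add: diagram_row)
  have iff: "i < length p \<longleftrightarrow> i < length q" for i
    using eq[of i] pos[OF assms(1), of i] pos[OF assms(2), of i] by (auto split: if_splits)
  have "{..<length p} = {..<length q}" by (intro Set.set_eqI) (simp only: lessThan_iff iff)
  then have len: "length p = length q" by simp
  show ?thesis
  proof (rule nth_equalityI[OF len])
    fix i assume "i < length p"
    then show "p ! i = q ! i" using eq[of i] len by simp
  qed
qed

lemma sum_row_weight:
  assumes "t \<in> tableaux p"
  shows "(\<Sum>x\<in>{1..sum_list p}. tableau_row p t x) = row_weight p"
proof -
  have "bij_betw t (diagram p) {1..sum_list p}" using assms by (simp add: tableaux_def)
  then have "(\<Sum>x\<in>{1..sum_list p}. tableau_row p t x) = (\<Sum>y\<in>diagram p. tableau_row p t (t y))"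
    by (rule sum.reindex_bij_betw[symmetric])
  also have "\<dots> = row_weight p"
    unfolding row_weight_def using tableau_entry(2)[OF assms] by (intro sum.cong) auto
  finally show ?thesis .
qed

text \<open>Place each entry in the box given by its row in \<open>s\<close> and its column in
  \<open>t\<close>. By injectivity these boxes form a set with the column lengths of
  \<open>p\<close>, the row lengths of \<open>q\<close> and row index sum
  \<open>row_weight q\<close>. The extremal case of \<open>column_rearrangement\<close> identifies
  this set with the diagram of \<open>p\<close>, so the two shapes have the same row
  lengths.\<close>

lemma tabloid_eq_column_permuted:
  assumes p: "p \<in> partitions_of n" and q: "q \<in> partitions_of n"
    and t: "t \<in> tableaux p" and s: "s \<in> tableaux q"
    and inj: "inj_on (\<lambda>x. (tableau_row q s x, tableau_col p t x)) {1..n}"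
    and le: "row_weight q \<le> row_weight p"
  shows "p = q" and "\<exists>\<pi>\<in>column_stabilizer p t. tabloid q s = tabloid p (\<pi> \<circ> t)"
proof -
  have [simp]: "sum_list p = n" "sum_list q = n" using p q by (auto simp: partitions_of_def)
  let ?N = "{1..n}" and ?pos = "\<lambda>x. (tableau_row q s x, tableau_col p t x)"
  let ?D' = "?pos ` ?N"
  have colcard: "card {i. (i, j) \<in> diagram p} = card {x \<in> ?N. tableau_col p t x = j}" for j
  proof (rule bij_betw_same_card[of "\<lambda>i. t (i, j)"], rule bij_betwI[where g = "tableau_row p t"])
    show "(\<lambda>i. t (i, j)) \<in> {i. (i, j) \<in> diagram p} \<rightarrow> {x \<in> ?N. tableau_col p t x = j}"
      using tableau_entry[OF t] by auto
    show "tableau_row p t \<in> {x \<in> ?N. tableau_col p t x = j} \<rightarrow> {i. (i, j) \<in> diagram p}"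
      using tableau_pos(1)[OF t] by auto
  qed (use tableau_entry[OF t] tableau_pos(2)[OF t] in auto)
  have rowcard: "card {j. (i, j) \<in> diagram q} = card {x \<in> ?N. tableau_row q s x = i}" for i
  proof (rule bij_betw_same_card[of "\<lambda>j. s (i, j)"], rule bij_betwI[where g = "tableau_col q s"])
    show "(\<lambda>j. s (i, j)) \<in> {j. (i, j) \<in> diagram q} \<rightarrow> {x \<in> ?N. tableau_row q s x = i}"
      using tableau_entry[OF s] by auto
    show "tableau_col q s \<in> {x \<in> ?N. tableau_row q s x = i} \<rightarrow> {j. (i, j) \<in> diagram q}"
      using tableau_pos(1)[OF s] by auto
  qed (use tableau_entry[OF s] tableau_pos(2)[OF s] in auto)
  have pos_eqD: "x = y" if "x \<in> ?N" "y \<in> ?N" "tableau_row q s x = tableau_row q s y"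
      "tableau_col p t x = tableau_col p t y" for x y
    using inj_onD[OF inj, of x y] that by simp
  have colcard': "card {i. (i, j) \<in> ?D'} = card {x \<in> ?N. tableau_col p t x = j}" for j
  proof -
    have "{i. (i, j) \<in> ?D'} = tableau_row q s ` {x \<in> ?N. tableau_col p t x = j}" by blast
    moreover have "inj_on (tableau_row q s) {x \<in> ?N. tableau_col p t x = j}"
      by (rule inj_onI, rule pos_eqD) auto
    ultimately show ?thesis by (simp only: card_image)
  qed
  have rowcard': "card {j. (i, j) \<in> ?D'} = card {x \<in> ?N. tableau_row q s x = i}" for i
  proof -
    have "{j. (i, j) \<in> ?D'} = tableau_col p t ` {x \<in> ?N. tableau_row q s x = i}" by blast
    moreover have "inj_on (tableau_col p t) {x \<in> ?N. tableau_row q s x = i}"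
      by (rule inj_onI, rule pos_eqD) auto
    ultimately show ?thesis by (simp only: card_image)
  qed
  have "(\<Sum>x\<in>?D'. fst x) = (\<Sum>x\<in>?N. tableau_row q s x)"
    using sum.reindex[OF inj, of fst] by (simp add: o_def)
  also have "\<dots> = row_weight q" using sum_row_weight[OF s] by simp
  finally have "(\<Sum>x\<in>?D'. fst x) \<le> (\<Sum>x\<in>diagram p. fst x)"
    using le by (simp add: row_weight_def)
  then have D': "?D' = diagram p"
    using colcard colcard' by (intro column_rearrangement(2) finite_diagram diagram_column[OF p])
        auto
  show pq: "p = q"
    by (rule partition_eq_of_row_cards[OF p q]) (metis D' rowcard rowcard')
  \<comment> \<open>\<open>g\<close> sends \<open>x\<close> to the entry of \<open>t\<close> in the
    box assigned to \<open>x\<close>: it moves \<open>x\<close> inside its column of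
    \<open>t\<close>, to the row whose index is that of the row of \<open>x\<close> in
    \<open>s\<close>.\<close>
  define g where "g x = (if x \<in> ?N then t (?pos x) else x)" for x
  have posD: "?pos x \<in> diagram p" if "x \<in> ?N" for x using that D' by blast
  have gcol: "tableau_col p t (g x) = tableau_col p t x"
    and grow: "tableau_row p t (g x) = tableau_row q s x" and gN: "g x \<in> ?N" if "x \<in> ?N" for x
    using tableau_entry[OF t posD[OF that]] that by (auto simp: g_def)
  have "inj_on g ?N"
  proof (rule inj_onI)
    fix x y assume xy: "x \<in> ?N" "y \<in> ?N" and eq: "g x = g y"
    show "x = y"
      using gcol[OF xy(1)] gcol[OF xy(2)] grow[OF xy(1)] grow[OF xy(2)]
      by (intro pos_eqD[OF xy]) (simp_all only: eq)
  qed
  then have "bij_betw g ?N ?N"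
    using gN by (intro bij_betw_imageI endo_inj_surj) auto
  then have gp: "g permutes ?N" by (rule bij_imp_permutes) (auto simp: g_def)
  then have gC: "g \<in> column_stabilizer p t"
    using gcol by (simp add: column_stabilizer_iff[OF t])
  have "tabloid q s i = g -` tabloid p t i" for i
  proof -
    have "x \<in> ?N \<longleftrightarrow> g x \<in> ?N" for x using permutes_in_image[OF gp] by blast
    then show ?thesis
      using grow by (auto simp: tabloid_eq_rows[OF s] tabloid_eq_rows[OF t] simp del:
          atLeastAtMost_iff)
  qed
  then have "tabloid q s = tabloid_inv_act g (tabloid p t)" by (auto simp: tabloid_inv_act_def)
  also have "\<dots> = tabloid p (inv g \<circ> t)" by (rule tabloid_inv_act_tabloid[OF permutes_bij[OF gp]])
  finally show "\<exists>\<pi>\<in>column_stabilizer p t. tabloid q s = tabloid p (\<pi> \<circ> t)"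
    using column_stabilizer_inv[OF gC] by blast
qed

text \<open>Two entries sharing a row of \<open>s\<close> and a column of \<open>t\<close> would
  make the value vanish through their transposition; a nonzero value thus supplies the injectivity
  hypothesis of \<open>tabloid_eq_column_permuted\<close>.\<close>

lemma column_antisym_nonzero_tabloid:
  assumes p: "p \<in> partitions_of n" and q: "q \<in> partitions_of n"
    and t: "t \<in> tableaux p" and T: "T \<in> tabloids q"
    and le: "row_weight q \<le> row_weight p" and nz: "column_antisym p t u T \<noteq> 0"
  shows "p = q" and "\<exists>\<pi>\<in>column_stabilizer p t. T = tabloid p (\<pi> \<circ> t)"
proof -
  have [simp]: "sum_list p = n" "sum_list q = n" using p q by (auto simp: partitions_of_def)
  obtain s where s: "s \<in> tableaux q" "T = tabloid q s" using T by (auto simp: tabloids_def)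
  have inj: "inj_on (\<lambda>x. (tableau_row q s x, tableau_col p t x)) {1..n}"
  proof (rule inj_onI, rule ccontr)
    fix x y assume xy: "x \<in> {1..n}" "y \<in> {1..n}" "x \<noteq> y"
      "(tableau_row q s x, tableau_col p t x) = (tableau_row q s y, tableau_col p t y)"
    then have "column_antisym p t u T = 0"
      by (intro column_antisym_eq_0_transpose[OF t, of x y]) (auto simp: s(2) tabloid_eq_rows[OF
          s(1)])
    with nz show False by simp
  qed
  show "p = q" by (rule tabloid_eq_column_permuted(1)[OF p q t s(1) inj le])
  show "\<exists>\<pi>\<in>column_stabilizer p t. T = tabloid p (\<pi> \<circ> t)"
    unfolding s(2) by (rule tabloid_eq_column_permuted(2)[OF p q t s(1) inj le])
qed

section \<open>Polytabloids and the image of the antisymmetrizer\<close>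

text \<open>Functions of tabloids are total functions on \<open>nat \<Rightarrow> nat set\<close>;
  \<open>supported (tabloids p)\<close> cuts out the permutation module of shape
  \<open>p\<close>.\<close>

definition supported :: "'a set \<Rightarrow> ('a \<Rightarrow> complex) \<Rightarrow> bool" where
  "supported A u \<longleftrightarrow> (\<forall>x. x \<notin> A \<longrightarrow> u x = 0)"

lemma column_antisym_supported:
  assumes "sum_list p = sum_list q" "supported (tabloids q) u"
  shows "supported (tabloids q) (column_antisym p t u)"
  unfolding supported_def column_antisym_def
proof (intro allI impI sum.neutral ballI)
  fix T \<pi> assume T: "T \<notin> tabloids q" and \<pi>: "\<pi> \<in> column_stabilizer p t"
  have "\<pi> permutes {1..sum_list q}" using column_stabilizer_permutes[OF \<pi>] assms(1) by simp
  then have "tabloid_inv_act \<pi> T \<notin> tabloids q" using T by (simp add: tabloid_inv_act_in_tabloids)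
  then show "of_int (sign \<pi>) * u (tabloid_inv_act \<pi> T) = 0"
    using assms(2) by (simp add: supported_def)
qed

lemma column_antisym_eq_0:
  assumes "p \<in> partitions_of n" "q \<in> partitions_of n" "t \<in> tableaux p"
    and "row_weight q \<le> row_weight p" "p \<noteq> q" "supported (tabloids q) u"
  shows "column_antisym p t u = (\<lambda>_. 0)"
proof
  fix T
  have "sum_list p = sum_list q" using assms(1,2) by (simp add: partitions_of_def)
  then have "column_antisym p t u T = 0" if "T \<notin> tabloids q"
    using that column_antisym_supported[of p q u t] assms(6) by (simp add: supported_def)
  then show "column_antisym p t u T = 0"
      using column_antisym_nonzero_tabloid(1)[OF assms(1-3) _ assms(4)] assms(5)
    by blast
qed

lemma polytabloid_apply:
  "polytabloid p t T = (\<Sum>\<pi>\<in>column_stabilizer p t. of_int (sign \<pi>) * (if T =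
      tabloid p (\<pi> \<circ> t) then 1 else 0))"
  by (simp add: polytabloid_def sum_fun_apply)

lemma tabloid_comp_column:
  assumes "\<pi> \<in> column_stabilizer p t"
  shows "tabloid p (\<pi> \<circ> t) = tabloid_inv_act (inv \<pi>) (tabloid p t)"
    and "tabloid_inv_act \<pi> (tabloid p t) = tabloid p (inv \<pi> \<circ> t)"
proof -
  have bij: "bij \<pi>" using column_stabilizer_permutes[OF assms] by (rule permutes_bij)
  show "tabloid p (\<pi> \<circ> t) = tabloid_inv_act (inv \<pi>) (tabloid p t)"
    using tabloid_inv_act_tabloid[OF bij_imp_bij_inv[OF bij], of p t]
        by (simp only: inv_inv_eq[OF bij])
  show "tabloid_inv_act \<pi> (tabloid p t) = tabloid p (inv \<pi> \<circ> t)"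
    by (rule tabloid_inv_act_tabloid[OF bij])
qed

text \<open>Makes the sign rule, the vanishing criterion and the support of antisymmetrized
  functions available for polytabloids.\<close>

lemma polytabloid_eq_column_antisym:
  "polytabloid p t = column_antisym p t (\<lambda>T. if T = tabloid p t then 1 else 0)"
proof
  fix T
  show "polytabloid p t T = column_antisym p t (\<lambda>T. if T = tabloid p t then 1 else 0) T"
    unfolding polytabloid_apply column_antisym_def
  proof (rule sum.cong[OF refl])
    fix \<pi> assume \<pi>: "\<pi> \<in> column_stabilizer p t"
    then have "bij \<pi>" using column_stabilizer_permutes permutes_bij by blast
    then have "tabloid_inv_act \<pi> T = tabloid p t \<longleftrightarrow> T = tabloid p (\<pi> \<circ> t)"
      using tabloid_inv_act_eq_iff tabloid_comp_column(1)[OF \<pi>] by metis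
    then show "of_int (sign \<pi>) * (if T = tabloid p (\<pi> \<circ> t) then 1 else 0) =
        of_int (sign \<pi>) * (if tabloid_inv_act \<pi> T = tabloid p t then 1 else (0::complex))" by simp
  qed
qed

text \<open>A column permutation that fixes the tabloid preserves both the row and the column of
  every entry, so only the identity contributes to the sum.\<close>

lemma polytabloid_tabloid_self:
  assumes t: "t \<in> tableaux p"
  shows "polytabloid p t (tabloid p t) = 1"
proof -
  have "\<pi> = id" if \<pi>: "\<pi> \<in> column_stabilizer p t" and eq: "tabloid p t = tabloid p (\<pi> \<circ> t)" for \<pi>
  proof -
    note perm = column_stabilizer_permutes[OF \<pi>]
    have "\<pi> x = x" if x: "x \<in> {1..sum_list p}" for x
    proof -
      have col: "tableau_col p t (\<pi> x) = tableau_col p t x"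
        using \<pi> x unfolding column_stabilizer_iff[OF t] by blast
      have \<pi>x: "\<pi> x \<in> {1..sum_list p}" using permutes_in_image[OF perm] x by blast
      have "\<pi> x = (\<pi> \<circ> t) (tableau_row p t x, tableau_col p t x)"
        using tableau_pos(2)[OF t x] by simp
      then have "\<pi> x \<in> tabloid p (\<pi> \<circ> t) (tableau_row p t x)"
        unfolding tabloid_def by (rule image_eqI) (use tableau_pos(1)[OF t x] in simp)
      then have "\<pi> x \<in> tabloid p t (tableau_row p t x)" using eq by metis
      then have "tableau_row p t (\<pi> x) = tableau_row p t x"
        by (simp add: tabloid_eq_rows[OF t])
      then show "\<pi> x = x"
        using col tableau_pos(2)[OF t x] tableau_pos(2)[OF t \<pi>x] by simp
    qed
    then show ?thesis using perm by (metis eq_id_iff permutes_not_in)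
  qed
  then have "polytabloid p t (tabloid p t) = (\<Sum>\<pi>\<in>{id}. of_int (sign \<pi>) * (if tabloid p t =
      tabloid p (\<pi> \<circ> t) then 1 else 0))"
    unfolding polytabloid_apply
    by (intro sum.mono_neutral_right finite_column_stabilizer) (use id_in_column_stabilizer in auto)
  then show ?thesis by simp
qed

lemma polytabloid_supported:
  assumes "t \<in> tableaux p"
  shows "supported (tabloids p) (polytabloid p t)"
  unfolding polytabloid_eq_column_antisym
  by (rule column_antisym_supported) (use assms in \<open>auto simp: supported_def tabloids_def\<close>)

text \<open>Both sides change by the sign under the column group and vanish off the orbit of the
  tabloid of \<open>t\<close>. They are therefore determined by the value at that tabloid, where the
  polytabloid is 1.\<close>

lemma column_antisym_eq_scaled_polytabloid:
  assumes p: "p \<in> partitions_of n" and t: "t \<in> tableaux p" and u: "supported (tabloids p) u"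
  shows "column_antisym p t u = (\<lambda>T. column_antisym p t u (tabloid p t) * polytabloid p t T)"
proof
  fix T
  \<comment> \<open>Used for two functions \<open>w\<close>: the given \<open>u\<close>, and the
    indicator whose antisymmetrization is the polytabloid.\<close>
  have *: "column_antisym p t w (tabloid p (\<pi> \<circ> t)) =
      of_int (sign \<pi>) * column_antisym p t w (tabloid p t)"
    if "\<pi> \<in> column_stabilizer p t" for \<pi> w
    using column_antisym_act_column[OF column_stabilizer_inv[OF that]]
    by (simp add: tabloid_comp_column(1)[OF that] sign_column_stabilizer_inv[OF that])
  show "column_antisym p t u T = column_antisym p t u (tabloid p t) * polytabloid p t T"
  proof (cases "\<exists>\<pi>\<in>column_stabilizer p t. T = tabloid p (\<pi> \<circ> t)")
    case True
    then obtain \<pi> where \<pi>: "\<pi> \<in> column_stabilizer p t" "T = tabloid p (\<pi> \<circ> t)" by blast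
    have "polytabloid p t T = of_int (sign \<pi>)"
      using *[OF \<pi>(1)] polytabloid_tabloid_self[OF t] \<pi>(2)
          by (simp add: polytabloid_eq_column_antisym)
    then show ?thesis using *[OF \<pi>(1), of u] \<pi>(2) by simp
  next
    case False
    have "column_antisym p t w T = 0" if "supported (tabloids p) w" for w
    proof (cases "T \<in> tabloids p")
      case True
      then show ?thesis using column_antisym_nonzero_tabloid(2)[OF p p t True order_refl] False
          by blast
    next
      case False
      then show ?thesis using column_antisym_supported[OF refl that] by (simp add: supported_def)
    qed
    from this[OF u] show ?thesis using False by (simp add: polytabloid_apply)
  qed
qed

text \<open>Antisymmetrization is self-adjoint for the pairing, because inversion preserves the
  column group and the sign. This identifies the scalar in
  \<open>column_antisym_eq_scaled_polytabloid\<close>.\<close>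

lemma column_antisym_tabloid_self:
  assumes t: "t \<in> tableaux p"
  shows "column_antisym p t u (tabloid p t) = (\<Sum>T\<in>tabloids p. u T * polytabloid p t T)"
proof -
  have mem: "tabloid p (\<pi> \<circ> t) \<in> tabloids p" if "\<pi> \<in> column_stabilizer p t" for \<pi>
    using tableaux_image[OF column_stabilizer_permutes[OF that] t] by (simp add: tabloids_def)
  have "(\<Sum>T\<in>tabloids p. u T * polytabloid p t T) =
    (\<Sum>\<pi>\<in>column_stabilizer p t. \<Sum>T\<in>tabloids p.
        if T = tabloid p (\<pi> \<circ> t) then of_int (sign \<pi>) * u T else 0)"
    unfolding polytabloid_apply sum_distrib_left
    by (subst sum.swap) (auto intro!: sum.cong)
  also have "\<dots> = (\<Sum>\<pi>\<in>column_stabilizer p t. of_int (sign \<pi>) * u (tabloid p (\<pi> \<circ> t)))"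
    using mem by (intro sum.cong) (auto simp: sum.delta finite_tabloids)
  also have "\<dots> = (\<Sum>\<pi>\<in>column_stabilizer p t. of_int (sign (inv \<pi>)) * u (tabloid p (inv \<pi> \<circ> t)))"
    by (rule sum_column_stabilizer_inv[symmetric])
  also have "\<dots> = column_antisym p t u (tabloid p t)"
    unfolding column_antisym_def
    by (intro sum.cong) (auto simp: sign_column_stabilizer_inv tabloid_comp_column(2))
  finally show ?thesis by simp
qed

text \<open>Only reality of the values is used later: it makes sums of squares positive, and complex
  conjugation then affects only the coefficients of a combination of polytabloids.\<close>

lemma polytabloid_Ints: "polytabloid p t T \<in> \<int>"
  unfolding polytabloid_apply by (intro Ints_sum) auto

section \<open>Matrix coefficients of Specht modules\<close>

text \<open>Bilinear, without complex conjugation; positivity is recovered from the fact that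
  polytabloids are real.\<close>

definition tabloid_form ::
    "nat list \<Rightarrow> ((nat \<Rightarrow> nat set) \<Rightarrow> complex) \<Rightarrow> ((nat \<Rightarrow> nat set) \<Rightarrow> complex) \<Rightarrow> complex" where
  "tabloid_form p u v = (\<Sum>T\<in>tabloids p. u T * v T)"

lemma tabloid_form_act:
  assumes \<sigma>: "\<sigma> permutes {1..sum_list p}"
  shows "tabloid_form p (specht_act \<sigma> u) (specht_act \<sigma> v) = tabloid_form p u v"
proof -
  have bij: "bij \<sigma>" using \<sigma> by (rule permutes_bij)
  show ?thesis
    unfolding tabloid_form_def specht_act_def
  proof (rule sum.reindex_bij_witness[of _ "tabloid_inv_act (inv \<sigma>)" "tabloid_inv_act \<sigma>"])
    fix T assume T: "T \<in> tabloids p"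
    show "tabloid_inv_act (inv \<sigma>) (tabloid_inv_act \<sigma> T) = T"
      by (metis bij tabloid_inv_act_eq_iff)
    show "tabloid_inv_act \<sigma> T \<in> tabloids p"
      using T tabloid_inv_act_in_tabloids[OF \<sigma>] by blast
    show "tabloid_inv_act \<sigma> (tabloid_inv_act (inv \<sigma>) T) = T"
      by (metis bij tabloid_inv_act_eq_iff)
    show "tabloid_inv_act (inv \<sigma>) T \<in> tabloids p"
      using T tabloid_inv_act_in_tabloids[OF permutes_inv[OF \<sigma>]] by blast
  qed auto
qed

text \<open>Conjugation by \<open>\<sigma>\<close> carries one column group to the other and
  preserves signs.\<close>

lemma polytabloid_image:
  assumes \<sigma>: "\<sigma> permutes {1..sum_list p}"
  shows "polytabloid p (\<sigma> \<circ> t) = specht_act \<sigma> (polytabloid p t)"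
proof
  fix T
  have bij: "bij \<sigma>" using \<sigma> by (rule permutes_bij)
  have inj: "inj_on (\<lambda>\<pi>. \<sigma> \<circ> \<pi> \<circ> inv \<sigma>) (column_stabilizer p t)"
  proof (rule inj_onI)
    fix \<pi> \<rho> assume "\<sigma> \<circ> \<pi> \<circ> inv \<sigma> = \<sigma> \<circ> \<rho> \<circ> inv \<sigma>"
    then have "\<sigma> (\<pi> (inv \<sigma> (\<sigma> x))) = \<sigma> (\<rho> (inv \<sigma> (\<sigma> x)))" for x by (metis o_apply)
    then show "\<pi> = \<rho>" using bij_is_inj[OF bij] by (auto simp: fun_eq_iff dest: injD)
  qed
  have "polytabloid p (\<sigma> \<circ> t) T = (\<Sum>\<pi>\<in>column_stabilizer p t.
      of_int (sign (\<sigma> \<circ> \<pi> \<circ> inv \<sigma>)) * (if T = tabloid p (\<sigma> \<circ> \<pi> \<circ> inv \<sigma> \<circ> (\<sigma> \<circ> t)) then 1 else 0))"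
    unfolding polytabloid_apply column_stabilizer_image[OF \<sigma>] by (simp add: sum.reindex[OF inj])
  also have "\<dots> = (\<Sum>\<pi>\<in>column_stabilizer p t.
      of_int (sign \<pi>) * (if tabloid_inv_act \<sigma> T = tabloid p (\<pi> \<circ> t) then 1 else 0))"
  proof (rule sum.cong[OF refl])
    fix \<pi> assume \<pi>: "\<pi> \<in> column_stabilizer p t"
    have perm: "permutation \<sigma>" "permutation \<pi>"
      using \<sigma> column_stabilizer_permutes[OF \<pi>]
          by (meson finite_atLeastAtMost permutes_imp_permutation)+
    then have "sign (\<sigma> \<circ> \<pi> \<circ> inv \<sigma>) = sign \<pi> * (sign \<sigma> * sign \<sigma>)"
      by (simp add: sign_compose sign_inverse permutation_compose permutation_inverse)
    then have sgn: "sign (\<sigma> \<circ> \<pi> \<circ> inv \<sigma>) = sign \<pi>" by (simp add: sign_idempotent)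
    have eq: "\<sigma> \<circ> \<pi> \<circ> inv \<sigma> \<circ> (\<sigma> \<circ> t) = \<sigma> \<circ> (\<pi> \<circ> t)"
      using bij by (simp add: fun_eq_iff bij_is_inj)
    have "tabloid_inv_act (inv \<sigma>) (tabloid p (\<pi> \<circ> t)) = tabloid p (\<sigma> \<circ> (\<pi> \<circ> t))"
      using tabloid_inv_act_tabloid[OF bij_imp_bij_inv[OF bij], of p "\<pi> \<circ> t"]
          by (simp only: inv_inv_eq[OF bij])
    then have "tabloid_inv_act \<sigma> T = tabloid p (\<pi> \<circ> t) \<longleftrightarrow> T = tabloid p (\<sigma> \<circ> (\<pi> \<circ> t))"
      using tabloid_inv_act_eq_iff[OF bij] by metis
    then show "of_int (sign (\<sigma> \<circ> \<pi> \<circ> inv \<sigma>)) * (if T =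
        tabloid p (\<sigma> \<circ> \<pi> \<circ> inv \<sigma> \<circ> (\<sigma> \<circ> t)) then 1 else 0) =
      of_int (sign \<pi>) * (if tabloid_inv_act \<sigma> T = tabloid p (\<pi> \<circ> t) then 1 else (0::complex))"
      by (simp add: sgn eq)
  qed
  also have "\<dots> = specht_act \<sigma> (polytabloid p t) T"
    by (simp add: polytabloid_apply specht_act_def)
  finally show "polytabloid p (\<sigma> \<circ> t) T = specht_act \<sigma> (polytabloid p t) T" .
qed

lemma sum_square_Reals_eq_0:
  fixes f :: "'a \<Rightarrow> complex"
  assumes "finite A" "\<And>a. a \<in> A \<Longrightarrow> f a \<in> \<real>" "(\<Sum>a\<in>A. f a * f a) = 0" "a \<in> A"
  shows "f a = 0"
proof -
  have "f a * f a = of_real ((Re (f a))\<^sup>2)" if "a \<in> A" for a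
    using assms(2)[OF that] by (metis of_real_Re of_real_mult power2_eq_square)
  then have "of_real (\<Sum>a\<in>A. (Re (f a))\<^sup>2) = (0::complex)"
    using assms(3) by simp
  then have "(\<Sum>a\<in>A. (Re (f a))\<^sup>2) = 0" by (simp only: of_real_eq_0_iff)
  then have "(Re (f a))\<^sup>2 = 0"
    using sum_nonneg_eq_0_iff[of A "\<lambda>a. (Re (f a))\<^sup>2"] assms(1,4) by simp
  then show ?thesis using assms(2)[OF assms(4)] by (metis of_real_0 of_real_Re power_eq_0_iff)
qed

lemma Ints_imp_Reals: "x \<in> \<int> \<Longrightarrow> (x::complex) \<in> \<real>"
  by (auto elim: Ints_cases)

lemma tabloid_form_polytabloid_nonzero:
  assumes "t \<in> tableaux p"
  shows "tabloid_form p (polytabloid p t) (polytabloid p t) \<noteq> 0"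
proof
  assume "tabloid_form p (polytabloid p t) (polytabloid p t) = 0"
  then have "polytabloid p t (tabloid p t) = 0"
    unfolding tabloid_form_def
    by (rule sum_square_Reals_eq_0[OF finite_tabloids, rotated])
      (use assms in \<open>auto simp: tabloids_def polytabloid_Ints Ints_imp_Reals\<close>)
  then show False using polytabloid_tabloid_self[OF assms] by simp
qed

text \<open>The scalar is nonzero by \<open>tabloid_form_polytabloid_nonzero\<close>, so a signed
  column sum can be inserted in front of a polytabloid at the cost of a division.\<close>

lemma column_antisym_polytabloid:
  assumes "p \<in> partitions_of n" "t \<in> tableaux p"
  shows "column_antisym p t (polytabloid p t) =
    (\<lambda>T. tabloid_form p (polytabloid p t) (polytabloid p t) * polytabloid p t T)"
  using column_antisym_eq_scaled_polytabloid[OF assms polytabloid_supported[OF assms(2)]]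
  by (simp add: column_antisym_tabloid_self[OF assms(2)] tabloid_form_def)

definition specht_coeff :: "nat list \<Rightarrow> (nat \<times> nat \<Rightarrow> nat) \<Rightarrow> (nat \<Rightarrow> nat) \<Rightarrow> complex" where
  "specht_coeff p t \<sigma> = tabloid_form p (specht_act \<sigma> (polytabloid p t)) (polytabloid p t)"

lemma specht_coeff_Reals: "specht_coeff p t \<sigma> \<in> \<real>"
  unfolding specht_coeff_def tabloid_form_def specht_act_def
  by (intro sum_in_Reals Reals_mult Ints_imp_Reals polytabloid_Ints)

lemma tabloid_form_sum_left:
  "tabloid_form p (\<lambda>T. \<Sum>a\<in>A. c a * u a T) v = (\<Sum>a\<in>A. c a * tabloid_form p (u a) v)"
proof -
  have "tabloid_form p (\<lambda>T. \<Sum>a\<in>A. c a * u a T) v = (\<Sum>T\<in>tabloids p. \<Sum>a\<in>A. c a * u a T * v T)"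
    by (simp add: tabloid_form_def sum_distrib_right)
  also have "\<dots> = (\<Sum>a\<in>A. \<Sum>T\<in>tabloids p. c a * u a T * v T)" by (rule sum.swap)
  finally show ?thesis by (simp add: tabloid_form_def sum_distrib_left mult.assoc)
qed

lemma sum_permutes_comp_right:
  assumes "\<rho> permutes S"
  shows "(\<Sum>\<sigma> | \<sigma> permutes S. F (\<sigma> \<circ> \<rho>)) = (\<Sum>\<sigma> | \<sigma> permutes S. F \<sigma>)"
proof (rule sum.reindex_bij_witness[of _ "\<lambda>\<sigma>. \<sigma> \<circ> inv \<rho>" "\<lambda>\<sigma>. \<sigma> \<circ> \<rho>"])
  note bij = permutes_bij[OF assms]
  fix \<sigma>
  show "\<sigma> \<circ> \<rho> \<circ> inv \<rho> = \<sigma>" "\<sigma> \<circ> inv \<rho> \<circ> \<rho> = \<sigma>"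
    using bij by (simp_all add: fun_eq_iff bij_is_inj bij_is_surj surj_f_inv_f)
qed (use assms in \<open>auto intro: permutes_compose permutes_inv\<close>)

lemma sum_permutes_comp_left:
  assumes "\<rho> permutes S"
  shows "(\<Sum>\<sigma> | \<sigma> permutes S. F (\<rho> \<circ> \<sigma>)) = (\<Sum>\<sigma> | \<sigma> permutes S. F \<sigma>)"
proof (rule sum.reindex_bij_witness[of _ "\<lambda>\<sigma>. inv \<rho> \<circ> \<sigma>" "\<lambda>\<sigma>. \<rho> \<circ> \<sigma>"])
  note bij = permutes_bij[OF assms]
  fix \<sigma>
  show "inv \<rho> \<circ> (\<rho> \<circ> \<sigma>) = \<sigma>" "\<rho> \<circ> (inv \<rho> \<circ> \<sigma>) = \<sigma>"
    using bij by (simp_all add: fun_eq_iff bij_is_inj bij_is_surj surj_f_inv_f)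
qed (use assms in \<open>auto intro: permutes_compose permutes_inv\<close>)

text \<open>Up to the nonzero scalar \<open>c\<close>, the first polytabloid is its own signed
  column sum. A change of the summation variable moves the column permutations to the second
  polytabloid, whose signed column sum for \<open>t\<close> vanishes. Both factors are taken at the
  same \<open>x\<close>, which later permits a sum of squares.\<close>

lemma specht_coeff_orthogonal_aux:
  assumes p: "p \<in> partitions_of n" and q: "q \<in> partitions_of n" and "p \<noteq> q"
    and le: "row_weight q \<le> row_weight p" and t: "t \<in> tableaux p" and s: "s \<in> tableaux q"
  shows "(\<Sum>x | x permutes {1..n}. specht_coeff p t x * specht_coeff q s x) = 0"
proof -
  let ?e = "polytabloid p t" and ?f = "polytabloid q s" and ?C = "column_stabilizer p t"
  have sp: "sum_list p = n" using p by (simp add: partitions_of_def)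
  have C: "\<kappa> permutes {1..n}" if "\<kappa> \<in> ?C" for \<kappa>
    using column_stabilizer_permutes[OF that] sp by simp
  define c where "c = tabloid_form p ?e ?e"
  have e: "(\<lambda>T. \<Sum>\<kappa>\<in>?C. of_int (sign \<kappa>) * specht_act (x \<circ> \<kappa>) ?e T) = (\<lambda>T. c * specht_act x ?e T)"
      for x
    using column_antisym_polytabloid[OF p t]
    by (simp add: column_antisym_def c_def fun_eq_iff specht_act_comp) (simp add: specht_act_def)
  have f: "(\<lambda>T. \<Sum>\<kappa>\<in>?C. of_int (sign \<kappa>) * specht_act (y \<circ> \<kappa>) ?f T) = (\<lambda>T. 0)" for y
    using column_antisym_eq_0[OF p q t le \<open>p \<noteq> q\<close> polytabloid_supported[OF s]]
    by (simp add: column_antisym_def fun_eq_iff specht_act_comp) (simp add: specht_act_def)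
  have "c * specht_coeff p t x = (\<Sum>\<kappa>\<in>?C. of_int (sign \<kappa>) * specht_coeff p t (x \<circ> \<kappa>))" for x
    using arg_cong[OF e[of x], of "\<lambda>u. tabloid_form p u ?e"]
    by (simp add: specht_coeff_def tabloid_form_sum_left tabloid_form_def sum_distrib_left
        mult.assoc)
  then have "c * (\<Sum>x | x permutes {1..n}. specht_coeff p t x * specht_coeff q s x) =
      (\<Sum>x | x permutes {1..n}. \<Sum>\<kappa>\<in>?C. of_int (sign \<kappa>) * (specht_coeff p t (x \<circ> \<kappa>) * specht_coeff q
          s x))"
    by (simp add: sum_distrib_left sum_distrib_right mult.assoc[symmetric])
  also have "\<dots> = (\<Sum>\<kappa>\<in>?C. \<Sum>x | x permutes {1..n}. of_int (sign \<kappa>) * (specht_coeff p t (x \<circ> \<kappa>) *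
      specht_coeff q s x))"
    by (rule sum.swap)
  \<comment> \<open>Substitution \<open>y = x \<circ> \<kappa>\<close>.\<close>
  also have "\<dots> = (\<Sum>\<kappa>\<in>?C. \<Sum>y | y permutes {1..n}. of_int (sign \<kappa>) * (specht_coeff p t y *
      specht_coeff q s (y \<circ> inv \<kappa>)))"
  proof (rule sum.cong[OF refl])
    fix \<kappa> assume \<kappa>: "\<kappa> \<in> ?C"
    have cancel: "x \<circ> \<kappa> \<circ> inv \<kappa> = x" for x
      using permutes_bij[OF C[OF \<kappa>]] by (simp add: fun_eq_iff bij_is_surj surj_f_inv_f)
    show "(\<Sum>x | x permutes {1..n}. of_int (sign \<kappa>) * (specht_coeff p t (x \<circ> \<kappa>) * specht_coeff q s
        x)) =
        (\<Sum>y | y permutes {1..n}. of_int (sign \<kappa>) * (specht_coeff p t y * specht_coeff q s (y \<circ> inv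
            \<kappa>)))"
      using sum_permutes_comp_right[OF C[OF \<kappa>], of "\<lambda>y. of_int (sign \<kappa>) * (specht_coeff p t y *
          specht_coeff q s (y \<circ> inv \<kappa>))"]
      by (simp only: cancel)
  qed
  also have "\<dots> = (\<Sum>y | y permutes {1..n}. specht_coeff p t y * (\<Sum>\<kappa>\<in>?C. of_int (sign \<kappa>) *
      specht_coeff q s (y \<circ> inv \<kappa>)))"
    by (subst sum.swap) (simp add: sum_distrib_left mult_ac)
  also have "\<dots> = 0"
  proof (intro sum.neutral ballI)
    fix y
    \<comment> \<open>The inverse left over from the substitution is harmless: the column group and
      the sign are invariant under inversion.\<close>
    have "(\<Sum>\<kappa>\<in>?C. of_int (sign \<kappa>) * specht_coeff q s (y \<circ> inv \<kappa>)) =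
        (\<Sum>\<kappa>\<in>?C. of_int (sign (inv \<kappa>)) * specht_coeff q s (y \<circ> inv \<kappa>))"
      by (intro sum.cong) (auto simp: sign_column_stabilizer_inv)
    also have "\<dots> = (\<Sum>\<kappa>\<in>?C. of_int (sign \<kappa>) * specht_coeff q s (y \<circ> \<kappa>))"
      by (rule sum_column_stabilizer_inv)
    also have "\<dots> = 0"
      using arg_cong[OF f[of y], of "\<lambda>u. tabloid_form q u ?f"]
      by (simp add: specht_coeff_def tabloid_form_sum_left) (simp add: tabloid_form_def)
    finally show "specht_coeff p t y * (\<Sum>\<kappa>\<in>?C. of_int (sign \<kappa>) * specht_coeff q s (y \<circ> inv \<kappa>)) =
        0" by simp
  qed
  finally show ?thesis
    using tabloid_form_polytabloid_nonzero[OF t] by (simp add: c_def)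
qed

lemma specht_coeff_orthogonal:
  assumes "p \<in> partitions_of n" "q \<in> partitions_of n" "p \<noteq> q" "t \<in> tableaux p" "s \<in> tableaux q"
  shows "(\<Sum>x | x permutes {1..n}. specht_coeff p t x * specht_coeff q s x) = 0"
proof (cases "row_weight q \<le> row_weight p")
  case False
  then show ?thesis
    using specht_coeff_orthogonal_aux[OF assms(2,1) _ _ assms(5,4)] assms(3)
        by (simp add: mult.commute)
qed (use specht_coeff_orthogonal_aux assms in blast)

section \<open>Class functions built from matrix coefficients\<close>

definition base_tableau :: "nat list \<Rightarrow> nat \<times> nat \<Rightarrow> nat" where
  "base_tableau p = (SOME t. t \<in> tableaux p)"

lemma base_tableau: "base_tableau p \<in> tableaux p"
  unfolding base_tableau_def using ex_tableau by (rule someI_ex)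

text \<open>By Schur's lemma, this is a nonzero multiple of the character of the Specht module.\<close>

definition specht_char :: "nat list \<Rightarrow> (nat \<Rightarrow> nat) \<Rightarrow> complex" where
  "specht_char p x = (\<Sum>\<sigma> | \<sigma> permutes {1..sum_list p}. specht_coeff p (\<sigma> \<circ> base_tableau p) x)"

lemma specht_char_orthogonal:
  assumes "p \<in> partitions_of n" "q \<in> partitions_of n" "p \<noteq> q"
  shows "(\<Sum>x | x permutes {1..n}. specht_char p x * specht_char q x) = 0"
proof -
  have sl: "sum_list p = n" "sum_list q = n" using assms by (auto simp: partitions_of_def)
  have "(\<Sum>x | x permutes {1..n}. specht_char p x * specht_char q x) =
    (\<Sum>\<sigma> | \<sigma> permutes {1..n}. \<Sum>\<tau> | \<tau> permutes {1..n}. \<Sum>x | x permutes {1..n}.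
      specht_coeff p (\<sigma> \<circ> base_tableau p) x * specht_coeff q (\<tau> \<circ> base_tableau q) x)"
    unfolding specht_char_def sl sum_product
    by (subst sum.swap, rule sum.cong[OF refl], rule sum.swap)
  also have "\<dots> = 0"
    using tableaux_image[OF _ base_tableau, of _ p] tableaux_image[OF _ base_tableau, of _ q] sl
    by (intro sum.neutral ballI specht_coeff_orthogonal[OF assms]) auto
  finally show ?thesis .
qed

lemma specht_char_Reals: "specht_char p x \<in> \<real>"
  unfolding specht_char_def by (intro sum_in_Reals specht_coeff_Reals)

text \<open>Conjugating the argument amounts to translating the tableau, and the sum runs over all
  translates; this is why \<open>specht_char\<close> sums over \<open>\<sigma>\<close>.\<close>

lemma specht_char_conj:
  assumes g: "g permutes {1..sum_list p}"
  shows "specht_char p (g \<circ> x \<circ> inv g) = specht_char p x"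
proof -
  let ?t = "base_tableau p"
  have bij: "bij g" and g': "inv g permutes {1..sum_list p}"
    using g by (auto simp: permutes_bij permutes_inv)
  have "specht_coeff p (\<sigma> \<circ> ?t) (g \<circ> x \<circ> inv g) = specht_coeff p (inv g \<circ> \<sigma> \<circ> ?t) x"
    if \<sigma>: "\<sigma> permutes {1..sum_list p}" for \<sigma>
  proof -
    have "specht_coeff p (inv g \<circ> (\<sigma> \<circ> ?t)) x = tabloid_form p
        (specht_act (x \<circ> inv g) (polytabloid p (\<sigma> \<circ> ?t))) (specht_act (inv g) (polytabloid p (\<sigma> \<circ>
            ?t)))"
      unfolding specht_coeff_def by (simp only: polytabloid_image[OF g'] specht_act_comp)
    also have "\<dots> = tabloid_form p
        (specht_act g (specht_act (x \<circ> inv g) (polytabloid p (\<sigma> \<circ> ?t))))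
        (specht_act g (specht_act (inv g) (polytabloid p (\<sigma> \<circ> ?t))))"
      by (rule tabloid_form_act[OF g, symmetric])
    also have "\<dots> = specht_coeff p (\<sigma> \<circ> ?t) (g \<circ> x \<circ> inv g)"
    proof -
      have "g \<circ> inv g = id" using bij by (simp add: bij_is_surj surj_iff[THEN iffD1])
      then show ?thesis
        unfolding specht_coeff_def by (simp only: specht_act_comp[symmetric] specht_act_id o_assoc)
    qed
    finally show ?thesis by (simp only: o_assoc)
  qed
  then have "specht_char p (g \<circ> x \<circ> inv g) =
      (\<Sum>\<sigma> | \<sigma> permutes {1..sum_list p}. specht_coeff p (inv g \<circ> \<sigma> \<circ> ?t) x)"
    unfolding specht_char_def by (intro sum.cong) auto
  also have "\<dots> = specht_char p x"
    unfolding specht_char_def by (rule sum_permutes_comp_left[OF g'])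
  finally show ?thesis .
qed

text \<open>By invariance of the form, every summand at the identity equals the pairing of the base
  polytabloid with itself.\<close>

lemma specht_char_id_nonzero: "specht_char p id \<noteq> 0"
proof -
  let ?S = "{1..sum_list p}"
  have eq: "specht_coeff p (\<sigma> \<circ> base_tableau p) id = specht_coeff p (base_tableau p) id"
    if \<sigma>: "\<sigma> permutes ?S" for \<sigma>
    unfolding specht_coeff_def specht_act_id polytabloid_image[OF \<sigma>]
        by (rule tabloid_form_act[OF \<sigma>])
  have "specht_char p id = (\<Sum>\<sigma> | \<sigma> permutes ?S. specht_coeff p (base_tableau p) id)"
    unfolding specht_char_def by (rule sum.cong[OF refl]) (rule eq, simp)
  also have "\<dots> = of_nat (card {\<sigma>. \<sigma> permutes ?S}) * specht_coeff p (base_tableau p) id" by simp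
  finally show ?thesis
    using tabloid_form_polytabloid_nonzero[OF base_tableau, of p]
    by (simp add: specht_coeff_def specht_act_id card_permutations[OF refl])
qed

text \<open>Pairing the relation with \<open>specht_char q\<close> leaves only the term of
  \<open>q\<close>, multiplied by a sum of real squares that is nonzero because of its term at
  \<open>id\<close>.\<close>

lemma specht_char_independent:
  assumes fin: "finite (partitions_of n)"
    and 0: "\<And>x. x permutes {1..n} \<Longrightarrow> (\<Sum>p\<in>partitions_of n. \<alpha> p * specht_char p x) = 0"
    and q: "q \<in> partitions_of n"
  shows "\<alpha> q = 0"
proof -
  let ?S = "{x. x permutes {1..n}}"
  have "0 = (\<Sum>x\<in>?S. (\<Sum>p\<in>partitions_of n. \<alpha> p * specht_char p x) * specht_char q x)"
    using 0 by simp
  also have "\<dots> = (\<Sum>p\<in>partitions_of n. \<Sum>x\<in>?S. \<alpha> p * (specht_char p x * specht_char q x))"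
    unfolding sum_distrib_right mult.assoc by (rule sum.swap)
  also have "\<dots> = (\<Sum>p\<in>partitions_of n.
      if p = q then \<alpha> q * (\<Sum>x\<in>?S. specht_char q x * specht_char q x) else 0)"
    using specht_char_orthogonal[OF _ q] by (intro sum.cong) (auto simp flip: sum_distrib_left)
  also have "\<dots> = \<alpha> q * (\<Sum>x\<in>?S. specht_char q x * specht_char q x)"
    using fin q by simp
  finally have "\<alpha> q = 0 \<or> (\<Sum>x\<in>?S. specht_char q x * specht_char q x) = 0" by simp
  moreover have "(\<Sum>x\<in>?S. specht_char q x * specht_char q x) \<noteq> 0"
    using sum_square_Reals_eq_0[of ?S "specht_char q" id] specht_char_id_nonzero[of q]
    by (auto simp: specht_char_Reals finite_permutations permutes_id)
  ultimately show ?thesis by blast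
qed

text \<open>A dimension count: \<open>card P\<close> independent columns in a space spanned by
  \<open>card P\<close> vectors span everything.\<close>

lemma square_system_solvable:
  fixes v :: "'p \<Rightarrow> 'p \<Rightarrow> complex"
  assumes fin: "finite P"
    and inj: "\<And>\<alpha>. (\<And>q. q \<in> P \<Longrightarrow> (\<Sum>p\<in>P. \<alpha> p * v p q) = 0) \<Longrightarrow> \<forall>p\<in>P. \<alpha> p = 0"
  shows "\<exists>\<alpha>. \<forall>q\<in>P. (\<Sum>p\<in>P. \<alpha> p * v p q) = w q"
proof -
  \<comment> \<open>Extension by zero puts the columns \<open>V p\<close> and the right-hand side
    \<open>W\<close> into the span of the unit functions \<open>D r\<close> with
    \<open>r \<in> P\<close>.\<close>
  define V where "V p q = (if q \<in> P then v p q else 0)" for p q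
  define W where "W q = (if q \<in> P then w q else 0)" for q
  define D where "D r q = (if q = r then 1 else 0 :: complex)" for r q :: 'p
  have spanD: "f \<in> cfun.span (D ` P)" if "\<And>q. q \<notin> P \<Longrightarrow> f q = 0" for f
  proof -
    have "(\<Sum>r\<in>P. (\<lambda>q. f r * D r q)) \<in> cfun.span (D ` P)"
      by (intro cfun.span_sum cfun.span_scale cfun.span_base) auto
    moreover have "(\<Sum>r\<in>P. (\<lambda>q. f r * D r q)) = f"
      using that fin by (auto simp: fun_eq_iff sum_fun_apply D_def if_distrib cong: if_cong)
    ultimately show ?thesis by simp
  qed
  \<comment> \<open>Independence is a property of sets, so repeated columns must be excluded first;
    two equal columns would give a nontrivial solution with coefficients 1 and -1.\<close>
  have injV: "inj_on V P"
  proof (rule inj_onI, rule ccontr)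
    fix a b assume ab: "a \<in> P" "b \<in> P" "V a = V b" "a \<noteq> b"
    have "\<forall>p\<in>P. (if p = a then 1 else if p = b then -1 else 0 :: complex) = 0"
    proof (rule inj)
      fix q assume "q \<in> P"
      then have vab: "v a q = v b q" using fun_cong[OF ab(3), of q] by (simp add: V_def)
      have "(\<Sum>p\<in>P. (if p = a then 1 else if p = b then -1 else 0) * v p q) =
        (\<Sum>p\<in>P. (if p = a then v p q else 0) + (if p = b then - v p q else 0))"
        using ab(4) by (intro sum.cong) auto
      also have "\<dots> = 0" using ab fin vab by (simp add: sum.distrib)
      finally show "(\<Sum>p\<in>P. (if p = a then 1 else if p = b then -1 else 0) * v p q) = 0" .
    qed
    then show False using ab(1) by auto
  qed
  have indep: "cfun.independent (V ` P)"
  proof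
    assume "cfun.dependent (V ` P)"
    then obtain u a where a: "a \<in> P" "u (V a) \<noteq> 0" and 0: "(\<Sum>f\<in>V ` P. (\<lambda>q. u f * f q)) = 0"
      using cfun.dependent_finite[of "V ` P"] fin by auto
    have "\<forall>p\<in>P. u (V p) = 0"
    proof (rule inj)
      fix q assume q: "q \<in> P"
      have "(\<Sum>p\<in>P. u (V p) * V p q) = (\<Sum>f\<in>V ` P. (\<lambda>q. u f * f q)) q"
        by (simp add: sum.reindex[OF injV] sum_fun_apply)
      then show "(\<Sum>p\<in>P. u (V p) * v p q) = 0" using 0 q by (simp add: V_def)
    qed
    with a show False by blast
  qed
  have "W \<in> cfun.span (V ` P)"
  proof (rule ccontr)
    assume W: "W \<notin> cfun.span (V ` P)"
    \<comment> \<open>If \<open>W\<close> were outside the span, adjoining it would give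
      \<open>card P + 1\<close> independent vectors in a space spanned by at most
      \<open>card P\<close>.\<close>
    have "card (insert W (V ` P)) \<le> card (D ` P)"
    proof (rule conjunct2[OF cfun.independent_span_bound])
      show "cfun.independent (insert W (V ` P))" by (rule cfun.independent_insertI[OF W indep])
      show "insert W (V ` P) \<subseteq> cfun.span (D ` P)"
        by (auto intro!: spanD simp: V_def W_def)
    qed (use fin in auto)
    also have "\<dots> \<le> card P" using fin by (rule card_image_le)
    finally have "card (insert W (V ` P)) \<le> card (V ` P)" by (simp add: card_image[OF injV])
    moreover have "W \<notin> V ` P" using W cfun.span_base by blast
    ultimately show False using fin by simp
  qed
  then obtain u where "W = (\<Sum>f\<in>V ` P. (\<lambda>q. u f * f q))"
    using cfun.span_finite[of "V ` P"] fin by auto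
  then have "W q = (\<Sum>p\<in>P. u (V p) * V p q)" for q
    by (simp add: sum.reindex[OF injV] sum_fun_apply)
  note W_eq = this
  have "\<forall>q\<in>P. (\<Sum>p\<in>P. u (V p) * v p q) = w q"
  proof
    fix q assume "q \<in> P"
    then show "(\<Sum>p\<in>P. u (V p) * v p q) = w q" using W_eq[of q] by (simp add: V_def W_def)
  qed
  then show ?thesis by (rule exI[of _ "\<lambda>p. u (V p)"])
qed

lemma finite_partitions_of: "finite (partitions_of n)"
proof (rule finite_subset)
  show "finite {p. set p \<subseteq> {0..n} \<and> length p \<le> n}"
    by (rule finite_lists_length_le) simp
  have "length p \<le> sum_list p" if "0 \<notin> set p" for p :: "nat list"
    using that by (induction p) auto
  then show "partitions_of n \<subseteq> {p. set p \<subseteq> {0..n} \<and> length p \<le> n}"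
    by (auto simp: partitions_of_def dest: member_le_sum_list)
qed

section \<open>Cycle types\<close>

lemma cyclic_on_enum:
  assumes "cyclic_on f c"
  shows "\<exists>b. bij_betw (\<lambda>n. (f ^^ n) b) {..<card c} c \<and> (f ^^ card c) b = b"
proof -
  obtain b where b: "b \<in> c" "c = orbit f b" "b \<in> orbit f b"
    using assms unfolding cyclic_on_def by auto
  \<comment> \<open>The time of first return to \<open>b\<close>, which is the length of the
    cycle.\<close>
  let ?k = "funpow_dist1 f b b"
  have bij: "bij_betw (\<lambda>n. (f ^^ n) b) {0..<?k} c"
    using inj_on_funpow_dist1[OF b(3)] orbit_conv_funpow_dist1[OF b(3)] b(2)
        by (simp add: bij_betw_def)
  then have "card c = ?k" using bij_betw_same_card by fastforce
  then show ?thesis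
    using bij funpow_dist1_prop[OF b(3)] by (intro exI[of _ b]) (simp add: lessThan_atLeast0)
qed

text \<open>Write the cycles of \<open>\<sigma>\<close> as rows, longest first, each row listing the
  successive images of one element of the cycle.\<close>

lemma permutation_cycle_tableau:
  assumes \<sigma>: "\<sigma> permutes {1..n}"
  shows "\<exists>p\<in>partitions_of n. \<exists>t\<in>tableaux p. \<forall>(i, j)\<in>diagram p. \<sigma> (t (i, j)) =
      t (i, Suc j mod p ! i)"
proof -
  obtain C where C: "\<And>c. c \<in> C \<Longrightarrow> cyclic_on \<sigma> c" "\<Union>C = {1..n}"
      "\<And>c d. c \<in> C \<Longrightarrow> d \<in> C \<Longrightarrow> c \<noteq> d \<Longrightarrow> c \<inter> d = {}"
    using permutes_decompose[OF \<sigma> finite_atLeastAtMost] by meson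
  have finC: "finite C" by (rule finite_UnionD) (simp add: C(2))
  then obtain cs0 where cs0: "set cs0 = C" "distinct cs0" using finite_distinct_list by blast
  \<comment> \<open>The cycle lengths must decrease to form a partition, while
    \<open>sort_key\<close> sorts increasingly.\<close>
  define cs where "cs = rev (sort_key card cs0)"
  have cs: "set cs = C" "distinct cs" "sorted_wrt (\<ge>) (map card cs)"
    using cs0 sorted_sort_key[of card cs0] by (auto simp: cs_def rev_map[symmetric] sorted_wrt_rev)
  have csC: "cs ! i \<in> C" if "i < length cs" for i using cs(1) that nth_mem by blast
  define p where "p = map card cs"
  have nonempty: "card c \<noteq> 0" "finite c" if "c \<in> C" for c
  proof -
    show "finite c" using that C(2) by (metis Sup_upper finite_atLeastAtMost finite_subset)
    then show "card c \<noteq> 0" using C(1)[OF that] by (auto simp: cyclic_on_def)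
  qed
  have "sum_list p = (\<Sum>c\<in>C. card c)"
    using cs by (simp add: p_def sum_list_distinct_conv_sum_set)
  also have "\<dots> = card (\<Union>C)"
    using C(3) nonempty by (intro card_Union_disjoint[symmetric]) (auto simp: pairwise_def
        disjnt_def)
  finally have sl: "sum_list p = n" using C(2) by simp
  then have p: "p \<in> partitions_of n"
    using cs nonempty by (auto simp: partitions_of_def p_def)
  obtain b where b: "\<And>c. c \<in> C \<Longrightarrow> bij_betw (\<lambda>n. (\<sigma> ^^ n) (b c)) {..<card c} c \<and> (\<sigma> ^^ card c) (b c) =
      b c"
    using cyclic_on_enum[OF C(1)] by metis
  define t where "t = (\<lambda>(i, j). (\<sigma> ^^ j) (b (cs ! i)))"
  have diag: "(i, j) \<in> diagram p \<longleftrightarrow> i < length cs \<and> j < card (cs ! i)" for i j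
    by (auto simp: diagram_def p_def)
  have tin: "t (i, j) \<in> cs ! i" if "(i, j) \<in> diagram p" for i j
    using b[OF csC] that by (auto simp: diag t_def bij_betw_def)
  have "inj_on t (diagram p)"
  proof (rule inj_onI, clarify)
    fix i j i' j' assume a: "(i, j) \<in> diagram p" "(i', j') \<in> diagram p"
        and eq: "t (i, j) = t (i', j')"
    have ii: "i < length cs" "i' < length cs" using a by (auto simp: diag)
    have "cs ! i = cs ! i'"
      using tin[OF a(1)] tin[OF a(2)] eq C(3)[OF csC csC, OF ii] by auto
    then have "i = i'" using ii cs(2) nth_eq_iff_index_eq by blast
    moreover have "inj_on (\<lambda>n. (\<sigma> ^^ n) (b (cs ! i))) {..<card (cs ! i)}"
      using b[OF csC[OF ii(1)]] by (simp add: bij_betw_def)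
    ultimately show "i = i' \<and> j = j'"
      using eq a by (auto simp: diag t_def dest: inj_onD)
  qed
  moreover have "t ` diagram p = {1..n}"
  proof (intro equalityI subsetI)
    fix x assume "x \<in> t ` diagram p"
    then show "x \<in> {1..n}" using tin csC C(2) diag by fastforce
  next
    fix x assume "x \<in> {1..n}"
    then obtain c where c: "c \<in> C" "x \<in> c" using C(2) by blast
    then obtain i where i: "i < length cs" "cs ! i = c" using cs(1) by (metis in_set_conv_nth)
    obtain j where "j < card c" "x = (\<sigma> ^^ j) (b c)"
      using b[OF c(1)] c(2) by (auto simp: bij_betw_def)
    then have "(i, j) \<in> diagram p" "x = t (i, j)" using i by (auto simp: diag t_def)
    then show "x \<in> t ` diagram p" by blast
  qed
  ultimately have t: "t \<in> tableaux p" by (simp add: tableaux_def bij_betw_def sl)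
  have "\<sigma> (t (i, j)) = t (i, Suc j mod p ! i)" if ij: "(i, j) \<in> diagram p" for i j
  proof -
    have i: "i < length cs" and j: "j < card (cs ! i)" using ij by (simp_all add: diag)
    then have pi: "p ! i = card (cs ! i)" by (simp add: p_def)
    show ?thesis
    proof (cases "Suc j = card (cs ! i)")
      case True
      \<comment> \<open>In the last box of a row the index wraps to 0, matching the return of the
        cycle to its start.\<close>
      then show ?thesis using b[OF csC[OF i]] pi by (simp add: t_def flip: True)
    next
      case False
      then show ?thesis using j pi by (simp add: t_def)
    qed
  qed
  then show ?thesis using p t by blast
qed

text \<open>The permutation whose cycles are the rows of the base tableau, hence of cycle type
  \<open>p\<close>.\<close>

definition cycle_rep :: "nat list \<Rightarrow> nat \<Rightarrow> nat" where
  "cycle_rep p x = (if x \<in> {1..sum_list p}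
     then base_tableau p (tableau_row p (base_tableau p) x,
            Suc (tableau_col p (base_tableau p) x) mod p ! tableau_row p (base_tableau p) x)
     else x)"

text \<open>The permutation \<open>g\<close> that matches the base tableau with the tableau of
  cycles intertwines the two row shifts. Class functions are thus determined by their values at
  representatives indexed by partitions, which makes the linear system for the identity indicator
  square.\<close>

lemma conj_cycle_rep:
  assumes \<sigma>: "\<sigma> permutes {1..n}"
  shows "\<exists>p\<in>partitions_of n. \<exists>g. g permutes {1..n} \<and> \<sigma> = g \<circ> cycle_rep p \<circ> inv g"
proof -
  obtain p t where p: "p \<in> partitions_of n" and t: "t \<in> tableaux p"
    and cyc: "\<And>i j. (i, j) \<in> diagram p \<Longrightarrow> \<sigma> (t (i, j)) = t (i, Suc j mod p ! i)"
    using permutation_cycle_tableau[OF \<sigma>] by blast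
  have sl: "sum_list p = n" using p by (simp add: partitions_of_def)
  let ?b = "base_tableau p"
  obtain g where g: "g permutes {1..n}" and gt: "\<And>x. x \<in> diagram p \<Longrightarrow> t x = g (?b x)"
    using tableau_transitive[OF base_tableau t] sl by metis
  have "\<sigma> (g x) = g (cycle_rep p x)" for x
  proof (cases "x \<in> {1..n}")
    case True
    define i j where "i = tableau_row p ?b x" and "j = tableau_col p ?b x"
    have ij: "(i, j) \<in> diagram p" and x: "x = ?b (i, j)"
      using tableau_pos[OF base_tableau, of x p] True sl by (auto simp: i_def j_def)
    have "(i, Suc j mod p ! i) \<in> diagram p"
      using ij by (auto simp: diagram_def)
    then show ?thesis
      using cyc[OF ij] gt ij True sl
          by (simp add: cycle_rep_def x[symmetric] i_def[symmetric] j_def[symmetric])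
  next
    case False
    then have "cycle_rep p x = x" by (simp only: cycle_rep_def sl if_False)
    then show ?thesis
      using permutes_not_in[OF g False] permutes_not_in[OF \<sigma> False] by simp
  qed
  note conj = this
  have "\<sigma> = g \<circ> cycle_rep p \<circ> inv g"
  proof
    fix x
    show "\<sigma> x = (g \<circ> cycle_rep p \<circ> inv g) x"
      using conj[of "inv g x"] permutes_bij[OF g] by (simp add: bij_is_surj surj_f_inv_f)
  qed
  then show ?thesis using p g by blast
qed

text \<open>Unknowns and equations are both indexed by partitions. A solution of the homogeneous
  system vanishes at all permutations by conjugacy, hence is trivial by independence. The right-hand
  side extends from the representatives because only the identity is conjugate to the
  identity.\<close>

lemma delta_eq_sum_specht_char:
  "\<exists>\<alpha>. \<forall>x. x permutes {1..n} \<longrightarrow>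
     (\<Sum>p\<in>partitions_of n. \<alpha> p * specht_char p x) = (if x = id then 1 else 0)"
proof -
  let ?P = "partitions_of n"
  have char: "(\<Sum>p\<in>?P. \<alpha> p * specht_char p (g \<circ> y \<circ> inv g)) = (\<Sum>p\<in>?P. \<alpha> p * specht_char p y)"
    if "g permutes {1..n}" for \<alpha> g y
    using specht_char_conj that by (intro sum.cong) (auto simp: partitions_of_def)
  have "\<exists>\<alpha>. \<forall>q\<in>?P. (\<Sum>p\<in>?P. \<alpha> p * specht_char p (cycle_rep q)) = (if cycle_rep q = id then 1 else 0)"
  proof (rule square_system_solvable[OF finite_partitions_of])
    fix \<alpha> assume 0: "\<And>q. q \<in> ?P \<Longrightarrow> (\<Sum>p\<in>?P. \<alpha> p * specht_char p (cycle_rep q)) = 0"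
    have "(\<Sum>p\<in>?P. \<alpha> p * specht_char p x) = 0" if "x permutes {1..n}" for x
      using conj_cycle_rep[OF that] char 0 by metis
    then show "\<forall>p\<in>?P. \<alpha> p = 0"
      using specht_char_independent[OF finite_partitions_of] by blast
  qed
  then obtain \<alpha> where \<alpha>: "\<And>q. q \<in> ?P \<Longrightarrow>
      (\<Sum>p\<in>?P. \<alpha> p * specht_char p (cycle_rep q)) = (if cycle_rep q = id then 1 else 0)" by blast
  have "(\<Sum>p\<in>?P. \<alpha> p * specht_char p x) = (if x = id then 1 else 0)" if x: "x permutes {1..n}" for x
  proof -
    obtain q g where q: "q \<in> ?P" and g: "g permutes {1..n}" and eq: "x = g \<circ> cycle_rep q \<circ> inv g"
      using conj_cycle_rep[OF x] by blast
    have bij: "bij g" using g by (rule permutes_bij)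
    have "cycle_rep q = id \<longleftrightarrow> x = id"
    proof
      assume "cycle_rep q = id"
      then show "x = id" using bij by (simp add: eq fun_eq_iff bij_is_surj surj_f_inv_f)
    next
      assume "x = id"
      then have "g (cycle_rep q (inv g (g y))) = g y" for y using eq by (metis id_apply o_apply)
      then show "cycle_rep q = id" using bij
          by (auto simp: fun_eq_iff bij_is_inj dest: injD[OF bij_is_inj])
    qed
    then show ?thesis using \<alpha>[OF q] char[OF g, of \<alpha> "cycle_rep q"] eq by simp
  qed
  then show ?thesis by blast
qed

section \<open>Tensor products of Specht modules\<close>

lemma cfun_zero_fun: "(0 :: 'a \<Rightarrow> complex) = (\<lambda>_. 0)"
  by (simp add: fun_eq_iff)

lemma cfun_subspaceI:
  assumes "(\<lambda>_. 0) \<in> U" "\<And>u v. u \<in> U \<Longrightarrow> v \<in> U \<Longrightarrow> (\<lambda>x. u x + v x) \<in> U"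
    and "\<And>c u. u \<in> U \<Longrightarrow> (\<lambda>x. c * u x) \<in> U"
  shows "cfun.subspace U"
  using assms by (auto simp: cfun.subspace_def cfun_zero_fun plus_fun_def)

lemma cfun_subspaceD:
  assumes "cfun.subspace U"
  shows "(\<lambda>_. 0) \<in> U" "\<And>u v. u \<in> U \<Longrightarrow> v \<in> U \<Longrightarrow> (\<lambda>x. u x + v x) \<in> U"
    and "\<And>c u. u \<in> U \<Longrightarrow> (\<lambda>x. c * u x) \<in> U"
  using assms by (auto simp: cfun.subspace_def cfun_zero_fun plus_fun_def)

lemma cfun_subspace_lincomb:
  assumes U: "cfun.subspace U" and "\<And>a. a \<in> A \<Longrightarrow> u a \<in> U"
  shows "(\<lambda>x. \<Sum>a\<in>A. c a * u a x) \<in> U"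
  using assms(2)
proof (induction A rule: infinite_finite_induct)
  case (insert a A)
  have "(\<lambda>x. c a * u a x + (\<Sum>a\<in>A. c a * u a x)) \<in> U"
    using insert by (intro cfun_subspaceD[OF U]) auto
  then show ?case using insert by simp
qed (use cfun_subspaceD(1)[OF U] in auto)

text \<open>Coefficients are attached to the index set \<open>A\<close> and not to the set of
  vectors, so coinciding vectors cause no trouble.\<close>

lemma cfun_span_image_explicit:
  assumes "finite A" "w \<in> cfun.span (f ` A)"
  shows "\<exists>c. w = (\<lambda>x. \<Sum>a\<in>A. c a * f a x)"
  using assms(2)
proof (induction rule: cfun.span_induct_alt)
  case base
  show ?case by (rule exI[of _ "\<lambda>_. 0"]) (simp add: cfun_zero_fun)
next
  case (step k y w)
  then obtain a c where a: "a \<in> A" "y = f a" and w: "w = (\<lambda>x. \<Sum>a\<in>A. c a * f a x)" by blast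
  have "(\<Sum>b\<in>A. (c(a := c a + k)) b * f b x) = (\<Sum>b\<in>A. c b * f b x + (if b =
      a then k * f a x else 0))" for x
    by (intro sum.cong) (auto simp: algebra_simps)
  then have "(\<Sum>b\<in>A. (c(a := c a + k)) b * f b x) = k * y x + w x" for x
    using assms(1) a by (simp add: sum.distrib w)
  then show ?case by (intro exI[of _ "c(a := c a + k)"]) (simp add: fun_eq_iff)
qed

lemma cfun_span_image_eq:
  assumes "finite A"
  shows "cfun.span (f ` A) = range (\<lambda>c x. \<Sum>a\<in>A. c a * f a x)"
proof (intro equalityI subsetI)
  fix w assume "w \<in> cfun.span (f ` A)"
  then show "w \<in> range (\<lambda>c x. \<Sum>a\<in>A. c a * f a x)" using cfun_span_image_explicit[OF assms] by blast
next
  fix w assume "w \<in> range (\<lambda>c x. \<Sum>a\<in>A. c a * f a x)"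
  then obtain c where "w = (\<lambda>x. \<Sum>a\<in>A. c a * f a x)" by blast
  also have "\<dots> \<in> cfun.span (f ` A)"
    by (intro cfun_subspace_lincomb cfun.subspace_span cfun.span_base imageI)
  finally show "w \<in> cfun.span (f ` A)" .
qed

text \<open>Tableaux have arbitrary values off the diagram, and the permutation relating two of them
  controls the diagram only.\<close>

lemma tableau_cong_diagram:
  assumes "\<And>x. x \<in> diagram p \<Longrightarrow> s x = t x"
  shows "tabloid p s = tabloid p t" "polytabloid p s = polytabloid p t"
proof -
  have im: "s ` A = t ` A" if "A \<subseteq> diagram p" for A using assms that by (auto intro!: image_cong)
  have tab: "tabloid p (\<pi> \<circ> s) = tabloid p (\<pi> \<circ> t)" for \<pi>
  proof
    fix i
    have "s ` {(i', j). (i', j) \<in> diagram p \<and> i' = i} = t ` {(i', j). (i', j) \<in> diagram p \<and> i' = i}"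
      by (rule im) auto
    then show "tabloid p (\<pi> \<circ> s) i = tabloid p (\<pi> \<circ> t) i"
      unfolding tabloid_def image_comp[symmetric] by (simp only:)
  qed
  from tab[of id] show "tabloid p s = tabloid p t" by simp
  have col: "s ` {(i, j'). (i, j') \<in> diagram p \<and> j' = j} = t ` {(i, j'). (i, j') \<in> diagram p \<and> j' =
      j}" for j
    by (rule im) auto
  have "column_stabilizer p s = column_stabilizer p t"
    unfolding column_stabilizer_def col ..
  then show "polytabloid p s = polytabloid p t" by (simp add: polytabloid_def tab)
qed

text \<open>Provides a finite index set: \<open>tableaux p\<close> is infinite because of the free
  values off the diagram, but its polytabloids form a single orbit of the symmetric group.\<close>

lemma specht_eq_span_orbit:
  "specht p = cfun.span ((\<lambda>\<sigma>. polytabloid p (\<sigma> \<circ> base_tableau p)) ` {\<sigma>. \<sigma> permutes {1..sum_list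
      p}})"
proof -
  have "polytabloid p ` tableaux p =
      (\<lambda>\<sigma>. polytabloid p (\<sigma> \<circ> base_tableau p)) ` {\<sigma>. \<sigma> permutes {1..sum_list p}}"
  proof (intro equalityI subsetI)
    fix e assume "e \<in> polytabloid p ` tableaux p"
    then obtain t where t: "t \<in> tableaux p" "e = polytabloid p t" by blast
    obtain \<sigma> where \<sigma>: "\<sigma> permutes {1..sum_list p}" "\<And>x. x \<in> diagram p \<Longrightarrow> t x = \<sigma> (base_tableau p x)"
      using tableau_transitive[OF base_tableau t(1)] by blast
    have "e = polytabloid p (\<sigma> \<circ> base_tableau p)"
      unfolding t(2) by (rule tableau_cong_diagram) (simp add: \<sigma>(2))
    then show "e \<in> (\<lambda>\<sigma>. polytabloid p (\<sigma> \<circ> base_tableau p)) ` {\<sigma>. \<sigma> permutes {1..sum_list p}}"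
      using \<sigma>(1) by blast
  qed (auto intro!: imageI tableaux_image base_tableau)
  then show ?thesis by (simp add: specht_def)
qed

lemma polytabloid_in_specht: "t \<in> tableaux p \<Longrightarrow> polytabloid p t \<in> specht p"
  by (simp add: specht_def cfun.span_base)

lemma specht_act_in_specht:
  assumes \<sigma>: "\<sigma> permutes {1..sum_list p}" and v: "v \<in> specht p"
  shows "specht_act \<sigma> v \<in> specht p"
proof -
  obtain c where c: "v = (\<lambda>x. \<Sum>\<tau> | \<tau> permutes {1..sum_list p}. c \<tau> * polytabloid p (\<tau> \<circ>
      base_tableau p) x)"
    using cfun_span_image_explicit[OF finite_permutations v[unfolded specht_eq_span_orbit]] by blast
  have "specht_act \<sigma> v = (\<lambda>x. \<Sum>\<tau> | \<tau> permutes {1..sum_list p}. c \<tau> * polytabloid p (\<sigma> \<circ> (\<tau> \<circ>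
      base_tableau p)) x)"
    unfolding polytabloid_image[OF \<sigma>] by (simp add: c specht_act_def)
  also have "\<dots> \<in> specht p"
    by (rule cfun_subspace_lincomb)
      (auto simp: specht_def[symmetric] intro!: polytabloid_in_specht tableaux_image \<sigma> base_tableau
        intro: cfun.subspace_span[of "polytabloid p ` tableaux p", folded specht_def])
  finally show ?thesis .
qed

lemma specht_supported:
  assumes "v \<in> specht p"
  shows "supported (tabloids p) v"
proof -
  have "cfun.subspace {v. supported (tabloids p) v}"
    by (rule cfun_subspaceI) (auto simp: supported_def)
  moreover have "polytabloid p ` tableaux p \<subseteq> {v. supported (tabloids p) v}"
    using polytabloid_supported by blast
  ultimately show ?thesis using assms cfun.span_minimal unfolding specht_def by blast
qed

text \<open>Extensional families, so that the product of symmetric groups is a finite set and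
  products of sums over the factors can be multiplied out.\<close>

definition component_perms :: "nat \<Rightarrow> (nat \<Rightarrow> nat) \<Rightarrow> (nat \<Rightarrow> nat \<Rightarrow> nat) set" where
  "component_perms l \<mu> = (\<Pi>\<^sub>E i\<in>{1..l}. {\<sigma>. \<sigma> permutes {1..\<mu> i}})"

lemma finite_component_perms: "finite (component_perms l \<mu>)"
  unfolding component_perms_def by (intro finite_PiE finite_permutations) auto

definition tableau_tensor ::
    "nat \<Rightarrow> (nat \<Rightarrow> nat list) \<Rightarrow> (nat \<Rightarrow> nat \<times> nat \<Rightarrow> nat) \<Rightarrow> (nat \<Rightarrow> nat \<Rightarrow> nat set) \<Rightarrow> complex" where
  "tableau_tensor l p t = pure_tensor l (\<lambda>i. polytabloid (p i) (t i))"

definition base_tableaux :: "(nat \<Rightarrow> nat list) \<Rightarrow> nat \<Rightarrow> nat \<times> nat \<Rightarrow> nat" where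
  "base_tableaux p i = base_tableau (p i)"

lemma multipartitions_sum_list:
  assumes "p \<in> multipartitions l \<mu>" "i \<in> {1..l}"
  shows "p i \<in> partitions_of (\<mu> i)" "sum_list (p i) = \<mu> i"
  using assms by (auto simp: multipartitions_def partitions_of_def)

lemma component_permsD: "s \<in> component_perms l \<mu> \<Longrightarrow> i \<in> {1..l} \<Longrightarrow> s i permutes {1..\<mu> i}"
  by (auto simp: component_perms_def PiE_iff)

lemma pure_tensor_cong:
  assumes "\<And>i. i \<in> {1..l} \<Longrightarrow> v i = w i"
  shows "pure_tensor l v = pure_tensor l w"
  unfolding pure_tensor_def using assms by (intro ext prod.cong) auto

lemma specht_tensor_act_comp:
  "specht_tensor_act (\<lambda>i. s i \<circ> t i) w = specht_tensor_act s (specht_tensor_act t w)"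
  by (simp add: specht_tensor_act_def tabloid_inv_act_comp)

lemma specht_tensor_act_tableau_tensor:
  assumes "p \<in> multipartitions l \<mu>" "\<And>i. i \<in> {1..l} \<Longrightarrow> s i permutes {1..\<mu> i}"
  shows "specht_tensor_act s (tableau_tensor l p t) = tableau_tensor l p (\<lambda>i. s i \<circ> t i)"
  unfolding tableau_tensor_def specht_tensor_act_pure
  using assms multipartitions_sum_list[OF assms(1)]
  by (intro pure_tensor_cong) (simp add: polytabloid_image)

text \<open>Expand every factor of a pure tensor in the orbit of its base polytabloid and multiply
  out.\<close>

lemma specht_tensor_eq_span:
  assumes p: "p \<in> multipartitions l \<mu>"
  shows "specht_tensor l p =
    cfun.span ((\<lambda>s. tableau_tensor l p (\<lambda>i. s i \<circ> base_tableaux p i)) ` component_perms l \<mu>)"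
    (is "_ = cfun.span ?E")
proof (rule antisym)
  have "?E \<subseteq> pure_tensor l ` {v. \<forall>i\<in>{1..l}. v i \<in> specht (p i)}"
    unfolding tableau_tensor_def
  proof (intro image_subsetI imageI CollectI ballI)
    fix s i assume s: "s \<in> component_perms l \<mu>" and i: "i \<in> {1..l}"
    show "polytabloid (p i) (s i \<circ> base_tableaux p i) \<in> specht (p i)"
      using component_permsD[OF s i] multipartitions_sum_list(2)[OF p i] unfolding base_tableaux_def
      by (intro polytabloid_in_specht tableaux_image base_tableau) simp
  qed
  then show "cfun.span ?E \<subseteq> specht_tensor l p"
    unfolding specht_tensor_def tensor_space_def by (rule cfun.span_mono)
  have "pure_tensor l v \<in> cfun.span ?E" if v: "\<forall>i\<in>{1..l}. v i \<in> specht (p i)" for v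
  proof -
    let ?S = "\<lambda>i. {\<sigma>. \<sigma> permutes {1..\<mu> i}}"
    have "\<forall>i\<in>{1..l}. \<exists>c. v i = (\<lambda>x. \<Sum>\<sigma>\<in>?S i. c \<sigma> * polytabloid (p i) (\<sigma> \<circ> base_tableau (p i)) x)"
    proof
      fix i assume i: "i \<in> {1..l}"
      have "v i \<in> specht (p i)" using v i by blast
      then show "\<exists>c. v i = (\<lambda>x. \<Sum>\<sigma>\<in>?S i. c \<sigma> * polytabloid (p i) (\<sigma> \<circ> base_tableau (p i)) x)"
        unfolding specht_eq_span_orbit multipartitions_sum_list(2)[OF p i]
        by (rule cfun_span_image_explicit[OF finite_permutations[OF finite_atLeastAtMost]])
    qed
    from bchoice[OF this] obtain c where c: "\<And>i. i \<in> {1..l} \<Longrightarrow>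
        v i = (\<lambda>x. \<Sum>\<sigma>\<in>?S i. c i \<sigma> * polytabloid (p i) (\<sigma> \<circ> base_tableau (p i)) x)"
      by blast
    have "pure_tensor l v = (\<lambda>x. \<Sum>s\<in>component_perms l \<mu>. (\<Prod>i\<in>{1..l}. c i (s i)) * tableau_tensor l
        p (\<lambda>i. s i \<circ> base_tableaux p i) x)"
    proof
      fix x
      have "pure_tensor l v x = (\<Prod>i\<in>{1..l}. \<Sum>\<sigma>\<in>?S i. c i \<sigma> * polytabloid (p i) (\<sigma> \<circ> base_tableau
          (p i)) (x i))"
        unfolding pure_tensor_def by (intro prod.cong refl) (simp only: c)
      also have "\<dots> = (\<Sum>s\<in>component_perms l \<mu>. \<Prod>i\<in>{1..l}. c i (s i) * polytabloid (p i) (s i \<circ>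
          base_tableau (p i)) (x i))"
        unfolding component_perms_def by (intro prod_sum_PiE finite_permutations) auto
      also have "\<dots> = (\<Sum>s\<in>component_perms l \<mu>. (\<Prod>i\<in>{1..l}. c i (s i)) * tableau_tensor l p (\<lambda>i. s i
          \<circ> base_tableaux p i) x)"
        by (simp add: prod.distrib tableau_tensor_def pure_tensor_def base_tableaux_def)
      finally show "pure_tensor l v x =
          (\<Sum>s\<in>component_perms l \<mu>. (\<Prod>i\<in>{1..l}. c i (s i)) * tableau_tensor l p (\<lambda>i. s i \<circ>
          base_tableaux p i) x)" .
    qed
    also have "\<dots> \<in> cfun.span ?E"
      by (intro cfun_subspace_lincomb cfun.subspace_span cfun.span_base imageI)
    finally show ?thesis .
  qed
  then show "specht_tensor l p \<subseteq> cfun.span ?E"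
    unfolding specht_tensor_def tensor_space_def
        by (intro cfun.span_minimal cfun.subspace_span) auto
qed

lemma subspace_specht_tensor: "cfun.subspace (specht_tensor l p)"
  by (simp add: specht_tensor_def tensor_space_def)

lemma specht_tensor_induct [consumes 1, case_names pure zero add scale]:
  assumes "w \<in> specht_tensor l p"
    and "\<And>v. (\<And>i. i \<in> {1..l} \<Longrightarrow> v i \<in> specht (p i)) \<Longrightarrow> P (pure_tensor l v)"
    and "P (\<lambda>_. 0)" and "\<And>u v. P u \<Longrightarrow> P v \<Longrightarrow> P (\<lambda>x. u x + v x)"
    and "\<And>c u. P u \<Longrightarrow> P (\<lambda>x. c * u x)"
  shows "P w"
proof -
  have "cfun.subspace {w. P w}" using assms(3-5) by (intro cfun_subspaceI) auto
  moreover have "pure_tensor l ` {v. \<forall>i\<in>{1..l}. v i \<in> specht (p i)} \<subseteq> {w. P w}"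
    using assms(2) by auto
  ultimately have "specht_tensor l p \<subseteq> {w. P w}"
    unfolding specht_tensor_def tensor_space_def by (intro cfun.span_minimal)
  then show ?thesis using assms(1) by blast
qed

text \<open>Pure tensors ignore coordinates outside \<open>{1..l}\<close>, and this passes to the
  span. Values can thus be read off at extensional families, of which only finitely many
  matter.\<close>

lemma specht_tensor_cong:
  assumes "w \<in> specht_tensor l p" "\<And>i. i \<in> {1..l} \<Longrightarrow> x i = y i"
  shows "w x = w y"
  using assms(1)
  by (induction rule: specht_tensor_induct) (auto simp: pure_tensor_def assms(2) intro!: prod.cong)

lemma specht_tensor_support:
  assumes "w \<in> specht_tensor l p" "i \<in> {1..l}" "x i \<notin> tabloids (p i)"
  shows "w x = 0"
  using assms(1)
proof (induction rule: specht_tensor_induct)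
  case (pure v)
  then have "v i (x i) = 0" using specht_supported[of "v i" "p i"] assms(2,3)
      by (simp add: supported_def)
  then show ?case unfolding pure_tensor_def using assms(2) by (intro prod_zero) auto
qed auto

lemma specht_tensor_act_cong:
  assumes "w \<in> specht_tensor l p" "\<And>i. i \<in> {1..l} \<Longrightarrow> s i = t i"
  shows "specht_tensor_act s w = specht_tensor_act t w"
  unfolding specht_tensor_act_def by (intro ext specht_tensor_cong[OF assms(1)]) (simp add:
      assms(2))

lemma specht_tensor_act_id: 
  assumes "w \<in> specht_tensor l p" "\<And>i. i \<in> {1..l} \<Longrightarrow> s i = id"
  shows "specht_tensor_act s w = w"
  unfolding specht_tensor_act_def
  by (intro ext specht_tensor_cong[OF assms(1)]) (simp add: assms(2) tabloid_inv_act_id)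

lemma specht_tensor_act_closed:
  assumes p: "p \<in> multipartitions l \<mu>" and s: "\<And>i. i \<in> {1..l} \<Longrightarrow> s i permutes {1..\<mu> i}"
    and w: "w \<in> specht_tensor l p"
  shows "specht_tensor_act s w \<in> specht_tensor l p"
  using w
proof (induction rule: specht_tensor_induct)
  case (pure v)
  then have "\<forall>i\<in>{1..l}. specht_act (s i) (v i) \<in> specht (p i)"
    using s multipartitions_sum_list[OF p] by (auto intro!: specht_act_in_specht)
  then show ?case
    unfolding specht_tensor_act_pure specht_tensor_def tensor_space_def
    by (intro cfun.span_base imageI) simp
next
  case zero
  then show ?case using cfun_subspaceD(1)[OF subspace_specht_tensor]
      by (simp add: specht_tensor_act_def)
next
  case (add u v)
  then show ?case using cfun_subspaceD(2)[OF subspace_specht_tensor]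
      by (simp add: specht_tensor_act_def)
next
  case (scale c u)
  then show ?case using cfun_subspaceD(3)[OF subspace_specht_tensor]
      by (simp add: specht_tensor_act_def)
qed

section \<open>Antisymmetrizers and forms on tensor products\<close>

definition tensor_antisym ::
    "nat \<Rightarrow> (nat \<Rightarrow> nat list) \<Rightarrow> (nat \<Rightarrow> nat \<times> nat \<Rightarrow> nat) \<Rightarrow>
     ((nat \<Rightarrow> nat \<Rightarrow> nat set) \<Rightarrow> complex) \<Rightarrow> (nat \<Rightarrow> nat \<Rightarrow> nat set) \<Rightarrow> complex" where
  "tensor_antisym l p t w = (\<lambda>x. \<Sum>s\<in>(\<Pi>\<^sub>E i\<in>{1..l}. column_stabilizer (p i) (t i)).
     (\<Prod>i\<in>{1..l}. of_int (sign (s i))) * specht_tensor_act s w x)"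

lemma tensor_antisym_pure:
  "tensor_antisym l p t (pure_tensor l v) = pure_tensor l (\<lambda>i. column_antisym (p i) (t i) (v i))"
proof
  fix x
  have "tensor_antisym l p t (pure_tensor l v) x =
      (\<Sum>s\<in>(\<Pi>\<^sub>E i\<in>{1..l}. column_stabilizer (p i) (t i)).
     (\<Prod>i\<in>{1..l}. of_int (sign (s i)) * v i (tabloid_inv_act (s i) (x i))))"
    by (simp add: tensor_antisym_def specht_tensor_act_def pure_tensor_def prod.distrib)
  also have "\<dots> = (\<Prod>i\<in>{1..l}. \<Sum>\<pi>\<in>column_stabilizer (p i) (t i). of_int (sign \<pi>) * v i
      (tabloid_inv_act \<pi> (x i)))"
    by (intro prod_sum_PiE[symmetric] finite_column_stabilizer) auto
  finally show "tensor_antisym l p t (pure_tensor l v) x =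
      pure_tensor l (\<lambda>i. column_antisym (p i) (t i) (v i)) x"
    by (simp add: pure_tensor_def column_antisym_def)
qed

lemma tensor_antisym_linear:
  "tensor_antisym l p t (\<lambda>_. 0) = (\<lambda>_. 0)"
  "tensor_antisym l p t (\<lambda>x. u x + v x) = (\<lambda>x. tensor_antisym l p t u x + tensor_antisym l p t v x)"
  "tensor_antisym l p t (\<lambda>x. c * u x) = (\<lambda>x. c * tensor_antisym l p t u x)"
  by (simp_all add: tensor_antisym_def specht_tensor_act_def sum.distrib[symmetric] algebra_simps
      sum_distrib_left)

lemma pure_tensor_scale:
  "pure_tensor l (\<lambda>i x. c i * v i x) = (\<lambda>x. (\<Prod>i\<in>{1..l}. c i) * pure_tensor l v x)"
  by (simp add: pure_tensor_def prod.distrib)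

definition tensor_form ::
    "nat \<Rightarrow> (nat \<Rightarrow> nat list) \<Rightarrow> ((nat \<Rightarrow> nat \<Rightarrow> nat set) \<Rightarrow> complex) \<Rightarrow>
     ((nat \<Rightarrow> nat \<Rightarrow> nat set) \<Rightarrow> complex) \<Rightarrow> complex" where
  "tensor_form l p u v = (\<Sum>x\<in>(\<Pi>\<^sub>E i\<in>{1..l}. tabloids (p i)). u x * v x)"

lemma tensor_form_pure:
  "tensor_form l p (pure_tensor l u) (pure_tensor l v) =
      (\<Prod>i\<in>{1..l}. tabloid_form (p i) (u i) (v i))"
proof -
  have "(\<Prod>i\<in>{1..l}. tabloid_form (p i) (u i) (v i)) =
      (\<Sum>x\<in>(\<Pi>\<^sub>E i\<in>{1..l}. tabloids (p i)). \<Prod>i\<in>{1..l}. u i (x i) * v i (x i))"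
    unfolding tabloid_form_def by (intro prod_sum_PiE finite_tabloids) auto
  then show ?thesis by (simp add: tensor_form_def pure_tensor_def prod.distrib)
qed

lemma tensor_form_linear:
  "tensor_form l p (\<lambda>_. 0) w = 0"
  "tensor_form l p (\<lambda>x. u x + v x) w = tensor_form l p u w + tensor_form l p v w"
  "tensor_form l p (\<lambda>x. c * u x) w = c * tensor_form l p u w"
  by (simp_all add: tensor_form_def sum.distrib[symmetric] algebra_simps sum_distrib_left)

text \<open>Both sides are linear in \<open>w\<close>, so pure tensors suffice; there the scalars of
  the single blocks multiply to the form of the tensors.\<close>

lemma tensor_antisym_eq:
  assumes p: "p \<in> multipartitions l \<mu>" and t: "\<And>i. i \<in> {1..l} \<Longrightarrow> t i \<in> tableaux (p i)"
    and w: "w \<in> specht_tensor l p"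
  shows "tensor_antisym l p t w =
      (\<lambda>x. tensor_form l p w (tableau_tensor l p t) * tableau_tensor l p t x)"
  using w
proof (induction rule: specht_tensor_induct)
  case (pure v)
  have "tensor_antisym l p t (pure_tensor l v) =
      pure_tensor l (\<lambda>i x. tabloid_form (p i) (v i) (polytabloid (p i) (t i)) * polytabloid (p i)
          (t i) x)"
    unfolding tensor_antisym_pure
  proof (rule pure_tensor_cong)
    fix i assume i: "i \<in> {1..l}"
    show "column_antisym (p i) (t i) (v i) =
        (\<lambda>x. tabloid_form (p i) (v i) (polytabloid (p i) (t i)) * polytabloid (p i) (t i) x)"
      using column_antisym_eq_scaled_polytabloid[OF multipartitions_sum_list(1)[OF p i] t[OF i]
          specht_supported[OF pure[OF i]]] column_antisym_tabloid_self[OF t[OF i], of "v i"]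
      by (simp add: tabloid_form_def)
  qed
  also have "\<dots> = (\<lambda>x. tensor_form l p (pure_tensor l v) (tableau_tensor l p t) * tableau_tensor l
      p t x)"
    by (simp add: pure_tensor_scale tableau_tensor_def tensor_form_pure)
  finally show ?case .
qed (simp_all add: tensor_antisym_linear tensor_form_linear algebra_simps)

text \<open>A single block of a different shape kills every pure tensor, so row weights have to be
  compared in one block only.\<close>

lemma tensor_antisym_eq_0:
  assumes p: "p \<in> multipartitions l \<mu>" and q: "q \<in> multipartitions l \<mu>"
    and t: "\<And>i. i \<in> {1..l} \<Longrightarrow> t i \<in> tableaux (p i)"
    and i: "i \<in> {1..l}" "p i \<noteq> q i" "row_weight (q i) \<le> row_weight (p i)"
    and w: "w \<in> specht_tensor l q"
  shows "tensor_antisym l p t w = (\<lambda>_. 0)"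
  using w
proof (induction rule: specht_tensor_induct)
  case (pure v)
  have "column_antisym (p i) (t i) (v i) = (\<lambda>_. 0)"
    using column_antisym_eq_0[OF multipartitions_sum_list(1)[OF p i(1)]
        multipartitions_sum_list(1)[OF q i(1)]
        t[OF i(1)] i(3,2) specht_supported[OF pure[OF i(1)]]] .
  then have "pure_tensor l (\<lambda>i. column_antisym (p i) (t i) (v i)) = (\<lambda>_. 0)"
    unfolding pure_tensor_def using i(1) by (intro ext prod_zero bexI[of _ i]) auto
  then show ?case by (simp only: tensor_antisym_pure)
qed (simp_all add: tensor_antisym_linear)

lemma tensor_form_tableau_tensor_nonzero:
  assumes "\<And>i. i \<in> {1..l} \<Longrightarrow> t i \<in> tableaux (p i)"
  shows "tensor_form l p (tableau_tensor l p t) (tableau_tensor l p t) \<noteq> 0"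
  unfolding tableau_tensor_def tensor_form_pure
  using tabloid_form_polytabloid_nonzero assms by auto

lemma orbit_tableau:
  assumes "p \<in> multipartitions l \<mu>" "s \<in> component_perms l \<mu>" "i \<in> {1..l}"
  shows "s i \<circ> base_tableaux p i \<in> tableaux (p i)"
  unfolding base_tableaux_def
  using tableaux_image[OF _ base_tableau] component_permsD[OF assms(2,3)]
      multipartitions_sum_list[OF assms(1,3)]
  by simp

text \<open>The spanning vectors are real, so the conjugate of \<open>w\<close> is again a
  combination of them, with conjugated coefficients. Hence \<open>w\<close> pairs to zero with its
  conjugate, and this pairing is the sum of its squared absolute values.\<close>

lemma tensor_form_nondegenerate:
  assumes p: "p \<in> multipartitions l \<mu>" and w: "w \<in> specht_tensor l p"
    and 0: "\<And>s. s \<in> component_perms l \<mu> \<Longrightarrow>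
      tensor_form l p w (tableau_tensor l p (\<lambda>i. s i \<circ> base_tableaux p i)) = 0"
  shows "w = (\<lambda>_. 0)"
proof -
  let ?e = "\<lambda>s. tableau_tensor l p (\<lambda>i. s i \<circ> base_tableaux p i)"
  let ?X = "\<Pi>\<^sub>E i\<in>{1..l}. tabloids (p i)"
  obtain c where c: "w = (\<lambda>x. \<Sum>s\<in>component_perms l \<mu>. c s * ?e s x)"
    using cfun_span_image_explicit[OF finite_component_perms w[unfolded specht_tensor_eq_span[OF
        p]]] by blast
  have "?e s x \<in> \<real>" for s x
    unfolding tableau_tensor_def pure_tensor_def
        by (intro prod_in_Reals Ints_imp_Reals polytabloid_Ints)
  then have cnj: "cnj (w x) = (\<Sum>s\<in>component_perms l \<mu>. cnj (c s) * ?e s x)" for x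
    unfolding c by (simp add: Reals_cnj_iff)
  have "(\<Sum>x\<in>?X. w x * cnj (w x)) = (\<Sum>x\<in>?X. \<Sum>s\<in>component_perms l \<mu>. cnj (c s) * (w x * ?e s x))"
    unfolding cnj sum_distrib_left by (simp add: mult_ac)
  also have "\<dots> = (\<Sum>s\<in>component_perms l \<mu>. cnj (c s) * tensor_form l p w (?e s))"
    by (subst sum.swap) (simp add: tensor_form_def sum_distrib_left)
  also have "\<dots> = 0" using 0 by simp
  finally have "(\<Sum>x\<in>?X. complex_of_real ((cmod (w x))\<^sup>2)) = 0" by (simp only: complex_norm_square)
  then have "of_real (\<Sum>x\<in>?X. (cmod (w x))\<^sup>2) = (0 :: complex)" by (simp only: of_real_sum)
  then have "(\<Sum>x\<in>?X. (cmod (w x))\<^sup>2) = 0" by (simp only: of_real_eq_0_iff)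
  moreover have "finite ?X" by (intro finite_PiE finite_tabloids) auto
  ultimately have X: "w x = 0" if "x \<in> ?X" for x
    using that by (simp add: sum_nonneg_eq_0_iff)
  show ?thesis
  proof
    fix x
    show "w x = 0"
    proof (cases "\<forall>i\<in>{1..l}. x i \<in> tabloids (p i)")
      case True
      then have "w (restrict x {1..l}) = 0" by (intro X) auto
      moreover have "w x = w (restrict x {1..l})" by (rule specht_tensor_cong[OF w]) simp
      ultimately show ?thesis by simp
    next
      case False
      then show ?thesis using specht_tensor_support[OF w] by blast
    qed
  qed
qed

text \<open>By nondegeneracy \<open>w\<close> pairs nontrivially with some vector of the spanning
  orbit. The antisymmetrizer of that vector sends \<open>w\<close> to a nonzero multiple of it, so
  \<open>U\<close> contains it together with its whole orbit.\<close>

lemma specht_tensor_irreducible: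
  assumes p: "p \<in> multipartitions l \<mu>" and U: "cfun.subspace U" "U \<subseteq> specht_tensor l p"
    and act: "\<And>s w. (\<And>i. i \<in> {1..l} \<Longrightarrow> s i permutes {1..\<mu> i}) \<Longrightarrow> w \<in> U \<Longrightarrow> specht_tensor_act s w \<in> U"
    and w: "w \<in> U" "w \<noteq> (\<lambda>_. 0)"
  shows "U = specht_tensor l p"
proof -
  let ?e = "\<lambda>s. tableau_tensor l p (\<lambda>i. s i \<circ> base_tableaux p i)"
  obtain r where r: "r \<in> component_perms l \<mu>" and nz: "tensor_form l p w (?e r) \<noteq> 0"
    using tensor_form_nondegenerate[OF p] w U(2) by blast
  define c where "c = tensor_form l p w (?e r)"
  have "tensor_antisym l p (\<lambda>i. r i \<circ> base_tableaux p i) w \<in> U"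
    unfolding tensor_antisym_def
  proof (intro cfun_subspace_lincomb U act w)
    fix s i assume "s \<in> (\<Pi>\<^sub>E i\<in>{1..l}. column_stabilizer (p i) (r i \<circ> base_tableaux p i))" "i \<in>
        {1..l}"
    then show "s i permutes {1..\<mu> i}"
      using column_stabilizer_permutes multipartitions_sum_list(2)[OF p]
          by (fastforce simp: PiE_iff)
  qed
  then have "(\<lambda>x. c * ?e r x) \<in> U"
    using tensor_antisym_eq[OF p _ subsetD[OF U(2) w(1)]] orbit_tableau[OF p r] by (simp add: c_def)
  then have "(\<lambda>x. inverse c * (c * ?e r x)) \<in> U" by (rule cfun_subspaceD(3)[OF U(1)])
  then have er: "?e r \<in> U" using nz by (simp add: c_def mult.assoc[symmetric])
  have "?e s \<in> U" if s: "s \<in> component_perms l \<mu>" for s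
  proof -
    have "specht_tensor_act (\<lambda>i. s i \<circ> inv (r i)) (?e r) \<in> U"
      using component_permsD[OF r] component_permsD[OF s]
      by (intro act er permutes_compose permutes_inv)
    also have "specht_tensor_act (\<lambda>i. s i \<circ> inv (r i)) (?e r) =
        tableau_tensor l p (\<lambda>i. (s i \<circ> inv (r i)) \<circ> (r i \<circ> base_tableaux p i))"
      using component_permsD[OF r] component_permsD[OF s]
      by (intro specht_tensor_act_tableau_tensor[OF p] permutes_compose permutes_inv)
    also have "\<dots> = ?e s"
      unfolding tableau_tensor_def
    proof (rule pure_tensor_cong)
      fix i assume "i \<in> {1..l}"
      then have "bij (r i)" using component_permsD[OF r] permutes_bij by blast
      then have "s i \<circ> inv (r i) \<circ> (r i \<circ> base_tableaux p i) = s i \<circ> base_tableaux p i"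
        by (simp add: fun_eq_iff bij_is_inj)
      then show "polytabloid (p i) (s i \<circ> inv (r i) \<circ> (r i \<circ> base_tableaux p i)) =
          polytabloid (p i) (s i \<circ> base_tableaux p i)" by simp
    qed
    finally show ?thesis .
  qed
  then have "specht_tensor l p \<subseteq> U"
    unfolding specht_tensor_eq_span[OF p] by (intro cfun.span_minimal U) auto
  with U(2) show ?thesis by blast
qed

lemma tableau_tensor_in_specht_tensor:
  assumes "\<And>i. i \<in> {1..l} \<Longrightarrow> t i \<in> tableaux (p i)"
  shows "tableau_tensor l p t \<in> specht_tensor l p"
  unfolding tableau_tensor_def specht_tensor_def tensor_space_def
  using assms by (intro cfun.span_base imageI) (simp add: polytabloid_in_specht)

lemma lincomb_hom:
  assumes U: "cfun.subspace U"
    and add: "\<And>u v. u \<in> U \<Longrightarrow> v \<in> U \<Longrightarrow> h (\<lambda>x. u x + v x) = (\<lambda>y. h u y + h v y)"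
    and scale: "\<And>c u. u \<in> U \<Longrightarrow> h (\<lambda>x. c * u x) = (\<lambda>y. c * h u y)"
    and "finite A" "\<And>a. a \<in> A \<Longrightarrow> u a \<in> U"
  shows "h (\<lambda>x. \<Sum>a\<in>A. c a * u a x) = (\<lambda>y. \<Sum>a\<in>A. c a * (h (u a) y :: complex))"
  using assms(4,5)
proof (induction A rule: finite_induct)
  case empty
  have "h (\<lambda>x. 0 * (0::complex)) = (\<lambda>y. 0 * h (\<lambda>_. 0) y)"
      by (rule scale[OF cfun_subspaceD(1)[OF U]])
  then show ?case by simp
next
  case (insert a A)
  have "h (\<lambda>x. c a * u a x + (\<Sum>a\<in>A. c a * u a x)) =
      (\<lambda>y. h (\<lambda>x. c a * u a x) y + h (\<lambda>x. \<Sum>a\<in>A. c a * u a x) y)"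
    using insert by (intro add cfun_subspaceD[OF U] cfun_subspace_lincomb[OF U]) auto
  also have "\<dots> = (\<lambda>y. c a * h (u a) y + (\<Sum>a\<in>A. c a * h (u a) y))"
    using insert scale[of "u a" "c a"] by simp
  finally show ?case using insert by simp
qed

text \<open>\<open>h\<close> commutes with the antisymmetrizer of the base tableaux, which
  multiplies the source vector by a nonzero scalar but annihilates the whole target.\<close>

lemma specht_tensor_hom_eq_0:
  assumes p: "p \<in> multipartitions l \<mu>" and q: "q \<in> multipartitions l \<mu>"
    and i: "i \<in> {1..l}" "p i \<noteq> q i" "row_weight (q i) \<le> row_weight (p i)"
    and h: "\<And>u. u \<in> specht_tensor l p \<Longrightarrow> h u \<in> specht_tensor l q"
    and add: "\<And>u v. u \<in> specht_tensor l p \<Longrightarrow> v \<in> specht_tensor l p \<Longrightarrow> h (\<lambda>x. u x + v x) =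
        (\<lambda>y. h u y + h v y)"
    and scale: "\<And>c u. u \<in> specht_tensor l p \<Longrightarrow> h (\<lambda>x. c * u x) = (\<lambda>y. c * h u y)"
    and act: "\<And>s w. (\<And>i. i \<in> {1..l} \<Longrightarrow> s i permutes {1..\<mu> i}) \<Longrightarrow> w \<in> specht_tensor l p \<Longrightarrow>
      h (specht_tensor_act s w) = specht_tensor_act s (h w)"
  shows "h (tableau_tensor l p (base_tableaux p)) = (\<lambda>_. 0)"
proof -
  let ?t = "base_tableaux p" and ?e = "tableau_tensor l p (base_tableaux p)"
  let ?C = "\<Pi>\<^sub>E i\<in>{1..l}. column_stabilizer (p i) (?t i)"
  have t: "?t i \<in> tableaux (p i)" for i by (simp add: base_tableaux_def base_tableau)
  have e: "?e \<in> specht_tensor l p" by (rule tableau_tensor_in_specht_tensor) (rule t)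
  have C: "s i permutes {1..\<mu> i}" if "s \<in> ?C" "i \<in> {1..l}" for s i
    using that column_stabilizer_permutes multipartitions_sum_list(2)[OF p]
        by (fastforce simp: PiE_iff)
  define c where "c = tensor_form l p ?e ?e"
  have "(\<lambda>_. 0) = tensor_antisym l p ?t (h ?e)"
    by (rule tensor_antisym_eq_0[OF p q t i h[OF e], symmetric])
  also have "\<dots> = (\<lambda>y. \<Sum>s\<in>?C. (\<Prod>i\<in>{1..l}. of_int (sign (s i))) * h (specht_tensor_act s ?e) y)"
    unfolding tensor_antisym_def
  proof (intro ext sum.cong refl)
    fix y s assume "s \<in> ?C"
    then have "h (specht_tensor_act s ?e) = specht_tensor_act s (h ?e)" using C e by (intro act)
    then show "(\<Prod>i\<in>{1..l}. of_int (sign (s i))) * specht_tensor_act s (h ?e) y =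
        (\<Prod>i\<in>{1..l}. of_int (sign (s i))) * h (specht_tensor_act s ?e) y" by simp
  qed
  also have "\<dots> = h (tensor_antisym l p ?t ?e)"
    unfolding tensor_antisym_def
    by (rule lincomb_hom[OF subspace_specht_tensor add scale, symmetric])
      (auto intro!: finite_PiE finite_column_stabilizer specht_tensor_act_closed[OF p C e])
  also have "\<dots> = h (\<lambda>x. c * ?e x)" using tensor_antisym_eq[OF p t e] by (simp add: c_def)
  also have "\<dots> = (\<lambda>y. c * h ?e y)" by (rule scale[OF e])
  finally have "c * h ?e y = 0" for y by (metis (full_types))
  moreover have "c \<noteq> 0" unfolding c_def by (rule tensor_form_tableau_tensor_nonzero) (rule t)
  ultimately show ?thesis by (simp add: fun_eq_iff)
qed

text \<open>Summing over \<open>r\<close> turns the product of matrix coefficients into a product of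
  \<open>specht_char\<close> values, one per block. With \<open>\<alpha>\<close> chosen as a product
  over the blocks, the sum over multipartitions factors as well.\<close>

lemma delta_eq_sum_tensor_coeff:
  "\<exists>\<alpha>. \<forall>s. (\<forall>i\<in>{1..l}. s i permutes {1..\<mu> i}) \<longrightarrow>
    (\<Sum>p\<in>multipartitions l \<mu>. \<Sum>r\<in>component_perms l \<mu>. \<alpha> p *
      tensor_form l p (specht_tensor_act s (tableau_tensor l p (\<lambda>i. r i \<circ> base_tableaux p i)))
        (tableau_tensor l p (\<lambda>i. r i \<circ> base_tableaux p i))) =
    (if \<forall>i\<in>{1..l}. s i = id then 1 else 0)"
proof -
  obtain A where A: "\<And>n x. x permutes {1..n} \<Longrightarrow>
     (\<Sum>p\<in>partitions_of n. A n p * specht_char p x) = (if x = id then 1 else 0)"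
    using delta_eq_sum_specht_char by metis
  define \<alpha> where "\<alpha> p = (\<Prod>i\<in>{1..l}. A (\<mu> i) (p i))" for p
  show ?thesis
  proof (intro exI[of _ \<alpha>] allI impI)
    fix s assume s: "\<forall>i\<in>{1..l}. s i permutes {1..\<mu> i}"
    let ?e = "\<lambda>p r. tableau_tensor l p (\<lambda>i. r i \<circ> base_tableaux p i)"
    have coeff: "tensor_form l p (specht_tensor_act s (?e p r)) (?e p r) =
        (\<Prod>i\<in>{1..l}. specht_coeff (p i) (r i \<circ> base_tableau (p i)) (s i))" for p r
      by (simp add: tableau_tensor_def specht_tensor_act_pure tensor_form_pure specht_coeff_def
          base_tableaux_def)
    have "(\<Sum>p\<in>multipartitions l \<mu>. \<Sum>r\<in>component_perms l \<mu>. \<alpha> p * tensor_form l p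
        (specht_tensor_act s (?e p r)) (?e p r)) =
        (\<Sum>p\<in>multipartitions l \<mu>. \<alpha> p * (\<Prod>i\<in>{1..l}. specht_char (p i) (s i)))"
    proof (rule sum.cong[OF refl])
      fix p assume p: "p \<in> multipartitions l \<mu>"
      have "(\<Prod>i\<in>{1..l}. specht_char (p i) (s i)) =
          (\<Prod>i\<in>{1..l}. \<Sum>\<sigma>\<in>{\<sigma>. \<sigma> permutes {1..\<mu> i}}. specht_coeff (p i) (\<sigma> \<circ> base_tableau (p i)) (s
              i))"
        using multipartitions_sum_list(2)[OF p] by (intro prod.cong) (auto simp: specht_char_def)
      also have "\<dots> = (\<Sum>r\<in>component_perms l \<mu>. \<Prod>i\<in>{1..l}. specht_coeff (p i) (r i \<circ> base_tableau (p
          i)) (s i))"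
        unfolding component_perms_def by (intro prod_sum_PiE finite_permutations) auto
      finally show "(\<Sum>r\<in>component_perms l \<mu>. \<alpha> p * tensor_form l p (specht_tensor_act s (?e p r))
          (?e p r)) =
          \<alpha> p * (\<Prod>i\<in>{1..l}. specht_char (p i) (s i))"
        by (simp add: coeff sum_distrib_left)
    qed
    also have "\<dots> = (\<Sum>p\<in>multipartitions l \<mu>. \<Prod>i\<in>{1..l}. A (\<mu> i) (p i) * specht_char (p i) (s i))"
      by (simp add: \<alpha>_def prod.distrib)
    also have "\<dots> = (\<Prod>i\<in>{1..l}. \<Sum>p\<in>partitions_of (\<mu> i). A (\<mu> i) p * specht_char p (s i))"
      unfolding multipartitions_def by (intro prod_sum_PiE[symmetric] finite_partitions_of) auto
    also have "\<dots> = (\<Prod>i\<in>{1..l}. if s i = id then 1 else 0)"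
      using A s by (intro prod.cong) auto
    also have "\<dots> = (if \<forall>i\<in>{1..l}. s i = id then 1 else 0)"
      by (auto intro!: prod_zero prod.neutral)
    finally show "(\<Sum>p\<in>multipartitions l \<mu>. \<Sum>r\<in>component_perms l \<mu>. \<alpha> p *
        tensor_form l p (specht_tensor_act s (?e p r)) (?e p r)) = (if \<forall>i\<in>{1..l}. s i =
            id then 1 else 0)" .
  qed
qed

section \<open>Modules over the linearized groupoid\<close>

lemma complex_field_simps [simp]:
  "carrier complex_field = UNIV" "x \<oplus>\<^bsub>complex_field\<^esub> y = x + y"
  "x \<otimes>\<^bsub>complex_field\<^esub> y = x * y" "\<zero>\<^bsub>complex_field\<^esub> = 0" "\<one>\<^bsub>complex_field\<^esub> = 1"
  by (simp_all add: ring_of_type_algebra_def)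

lemma fun_space_simps [simp]:
  "carrier (fun_space W) = W" "u \<oplus>\<^bsub>fun_space W\<^esub> v = (\<lambda>x. u x + v x)" "\<zero>\<^bsub>fun_space W\<^esub> = (\<lambda>_. 0)"
  "c \<odot>\<^bsub>fun_space W\<^esub> u = (\<lambda>x. c * u x)"
  by (simp_all add: fun_space_def fun_eq_iff)

lemma module_fun_space:
  assumes W: "cfun.subspace W"
  shows "Module.module complex_field (fun_space W)"
proof (rule moduleI)
  show "cring complex_field" ..
  show "abelian_group (fun_space W)"
  proof (rule abelian_groupI)
    show "u \<oplus>\<^bsub>fun_space W\<^esub> v \<in> carrier (fun_space W)"
      if "u \<in> carrier (fun_space W)" "v \<in> carrier (fun_space W)" for u v
      using cfun_subspaceD(2)[OF W] that by simp
    show "\<zero>\<^bsub>fun_space W\<^esub> \<in> carrier (fun_space W)" using cfun_subspaceD(1)[OF W] by simp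
    fix u assume "u \<in> carrier (fun_space W)"
    then have "u \<in> W" by simp
    then have "(\<lambda>x. (-1) * u x) \<in> W" by (rule cfun_subspaceD(3)[OF W])
    then show "\<exists>v\<in>carrier (fun_space W). v \<oplus>\<^bsub>fun_space W\<^esub> u = \<zero>\<^bsub>fun_space W\<^esub>"
      by (auto intro!: bexI[of _ "\<lambda>x. (-1) * u x"])
  qed (simp_all add: fun_eq_iff)
  show "c \<odot>\<^bsub>fun_space W\<^esub> u \<in> carrier (fun_space W)" if "u \<in> carrier (fun_space W)" for c u
    using cfun_subspaceD(3)[OF W] that by simp
qed (simp_all add: fun_eq_iff distrib_left distrib_right)

lemma finsum_fun_space:
  assumes W: "cfun.subspace W" and "finite B" "B \<subseteq> W"
  shows "(\<Oplus>\<^bsub>fun_space W\<^esub>b\<in>B. c b \<odot>\<^bsub>fun_space W\<^esub> b) = (\<lambda>x. \<Sum>b\<in>B. c b * b x)"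
proof -
  interpret V: Module.module complex_field "fun_space W" by (rule module_fun_space[OF W])
  show ?thesis
    using assms(2,3)
  proof (induction B rule: finite_induct)
    case (insert a B)
    have "(\<lambda>b. c b \<odot>\<^bsub>fun_space W\<^esub> b) \<in> B \<rightarrow> carrier (fun_space W)" "c a \<odot>\<^bsub>fun_space W\<^esub> a \<in> carrier
        (fun_space W)"
      using insert.prems cfun_subspaceD(3)[OF W] by auto
    then show ?case
      using V.finsum_insert[OF insert.hyps, of "\<lambda>b. c b \<odot>\<^bsub>fun_space W\<^esub> b"] insert by simp
  qed (simp add: V.finsum_empty)
qed

lemma fd_vspace_fun_space:
  assumes "finite B"
  shows "fd_vspace (fun_space (cfun.span B))"
  unfolding fd_vspace_def
proof (intro conjI exI[of _ B])
  show "Module.module complex_field (fun_space (cfun.span B))"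
    by (rule module_fun_space) (rule cfun.subspace_span)
  have B: "B \<subseteq> cfun.span B" by (rule cfun.span_superset)
  show "B \<subseteq> carrier (fun_space (cfun.span B))" using B by simp
  show "carrier (fun_space (cfun.span B)) =
      {(\<Oplus>\<^bsub>fun_space (cfun.span B)\<^esub>b\<in>B. c b \<odot>\<^bsub>fun_space (cfun.span B)\<^esub> b) | c. True}"
    unfolding finsum_fun_space[OF cfun.subspace_span assms B]
    using cfun_span_image_eq[OF assms, of id] by (auto simp only: fun_space_simps image_id id_apply)
qed (rule assms)

lemma submodule_fun_space_subspace:
  assumes "submodule N complex_field (fun_space W)"
  shows "cfun.subspace N" "N \<subseteq> W"
proof -
  interpret N: submodule N complex_field "fun_space W" by (rule assms)
  show "cfun.subspace N"
    using N.m_closed N.one_closed N.smult_closed by (intro cfun_subspaceI) auto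
  show "N \<subseteq> W" using N.subset by auto
qed

lemma lin_mapsD:
  assumes "h \<in> lin_maps V W"
  shows "\<And>x. x \<in> carrier V \<Longrightarrow> h x \<in> carrier W"
    and "\<And>x y. x \<in> carrier V \<Longrightarrow> y \<in> carrier V \<Longrightarrow> h (x \<oplus>\<^bsub>V\<^esub> y) = h x \<oplus>\<^bsub>W\<^esub> h y"
    and "\<And>c x. x \<in> carrier V \<Longrightarrow> h (c \<odot>\<^bsub>V\<^esub> x) = c \<odot>\<^bsub>W\<^esub> h x"
  using assms by (simp_all add: lin_maps_def Pi_iff)

lemma vspace_zero_closed:
  assumes "Module.module complex_field V"
  shows "\<zero>\<^bsub>V\<^esub> \<in> carrier V"
proof -
  interpret V: Module.module complex_field V by (rule assms)
  show "\<zero>\<^bsub>V\<^esub> \<in> carrier V" by (rule V.zero_closed)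
qed

lemma vspace_smult_zero_left:
  assumes "Module.module complex_field V" "x \<in> carrier V"
  shows "0 \<odot>\<^bsub>V\<^esub> x = \<zero>\<^bsub>V\<^esub>"
proof -
  interpret V: Module.module complex_field V by (rule assms)
  show "0 \<odot>\<^bsub>V\<^esub> x = \<zero>\<^bsub>V\<^esub>"
    using V.smult_l_null[OF assms(2)] by (simp only: complex_field_simps)
qed

lemma vspace_smult_zero_right:
  assumes "Module.module complex_field V"
  shows "c \<odot>\<^bsub>V\<^esub> \<zero>\<^bsub>V\<^esub> = \<zero>\<^bsub>V\<^esub>"
proof -
  interpret V: Module.module complex_field V by (rule assms)
  show "c \<odot>\<^bsub>V\<^esub> \<zero>\<^bsub>V\<^esub> = \<zero>\<^bsub>V\<^esub>"
    by (rule V.smult_r_null) (simp only: complex_field_simps UNIV_I)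
qed

lemma vspace_add_zero:
  assumes "Module.module complex_field V"
  shows "\<zero>\<^bsub>V\<^esub> \<oplus>\<^bsub>V\<^esub> \<zero>\<^bsub>V\<^esub> = \<zero>\<^bsub>V\<^esub>"
proof -
  interpret V: Module.module complex_field V by (rule assms)
  show "\<zero>\<^bsub>V\<^esub> \<oplus>\<^bsub>V\<^esub> \<zero>\<^bsub>V\<^esub> = \<zero>\<^bsub>V\<^esub>" by (rule V.l_zero[OF V.zero_closed])
qed

lemmas vspace_zero = vspace_zero_closed vspace_smult_zero_left vspace_smult_zero_right
    vspace_add_zero

lemma lin_maps_zero:
  assumes "Module.module complex_field V" "Module.module complex_field W" "h \<in> lin_maps V W"
  shows "h \<zero>\<^bsub>V\<^esub> = \<zero>\<^bsub>W\<^esub>"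
proof -
  note V0 = vspace_zero(1)[OF assms(1)]
  have "h \<zero>\<^bsub>V\<^esub> = h (0 \<odot>\<^bsub>V\<^esub> \<zero>\<^bsub>V\<^esub>)" by (simp only: vspace_zero(3)[OF assms(1)])
  also have "\<dots> = 0 \<odot>\<^bsub>W\<^esub> h \<zero>\<^bsub>V\<^esub>" by (rule lin_mapsD(3)[OF assms(3) V0])
  also have "\<dots> = \<zero>\<^bsub>W\<^esub>" by (rule vspace_zero(2)[OF assms(2) lin_mapsD(1)[OF assms(3) V0]])
  finally show ?thesis .
qed

text \<open>Closure under negation comes from multiplication by -1.\<close>

lemma submoduleI_complex:
  assumes V: "Module.module complex_field V" and "H \<subseteq> carrier V" and "\<zero>\<^bsub>V\<^esub> \<in> H"
    and "\<And>x y. x \<in> H \<Longrightarrow> y \<in> H \<Longrightarrow> x \<oplus>\<^bsub>V\<^esub> y \<in> H" and smult: "\<And>c x. x \<in> H \<Longrightarrow> c \<odot>\<^bsub>V\<^esub> x \<in> H"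
  shows "submodule H complex_field V"
proof -
  interpret V: Module.module complex_field V by (rule V)
  show ?thesis
  proof (rule V.submoduleI)
    fix x assume x: "x \<in> H"
    then have xV: "x \<in> carrier V" using assms(2) by blast
    have "(-1) \<odot>\<^bsub>V\<^esub> x \<oplus>\<^bsub>V\<^esub> x = ((-1) \<oplus>\<^bsub>complex_field\<^esub> 1) \<odot>\<^bsub>V\<^esub> x"
      using V.smult_l_distr[of "-1" 1 x] V.smult_one[OF xV] xV by simp
    also have "\<dots> = \<zero>\<^bsub>V\<^esub>" using vspace_zero(2)[OF V xV] by simp
    finally have "\<ominus>\<^bsub>V\<^esub> x = (-1) \<odot>\<^bsub>V\<^esub> x" using xV V.smult_closed[of "-1" x]
      by (intro V.minus_equality) auto
    then show "\<ominus>\<^bsub>V\<^esub> x \<in> H" using smult[OF x] by simp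
  qed (simp_all only: assms(2-5))
qed

lemma submodule_zero_closed:
  assumes "submodule N complex_field V"
  shows "N \<subseteq> carrier V" "\<zero>\<^bsub>V\<^esub> \<in> N"
proof -
  interpret N: submodule N complex_field V by (rule assms)
  show "N \<subseteq> carrier V" "\<zero>\<^bsub>V\<^esub> \<in> N" using N.subset N.one_closed by auto
qed

lemma cg_module_vspace:
  assumes "is_cg_module l d M" "f \<in> objs l d"
  shows "Module.module complex_field (space_at M f)"
  using bspec[OF assms(1)[unfolded is_cg_module_def, THEN conjunct1] assms(2)]
      unfolding fd_vspace_def by (rule conjunct1)

lemma cg_module_lin_maps:
  assumes "is_cg_module l d M" "f \<in> objs l d" "g \<in> objs l d" "a \<in> lin_morphs d f g"
  shows "map_at M f g a \<in> lin_maps (space_at M f) (space_at M g)"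
  using assms(1)[unfolded is_cg_module_def, THEN conjunct2, THEN conjunct1] assms(2-4) by blast

lemma cg_module_id:
  assumes "is_cg_module l d M" "f \<in> objs l d" "v \<in> carrier (space_at M f)"
  shows "map_at M f f (basis_morph id) v = v"
  using assms(1)[unfolded is_cg_module_def, THEN conjunct2, THEN conjunct2, THEN conjunct1]
      assms(2,3) by blast

lemma cg_module_comp:
  assumes "is_cg_module l d M" "f \<in> objs l d" "g \<in> objs l d" "h \<in> objs l d"
    "a \<in> lin_morphs d f g" "b \<in> lin_morphs d g h" "v \<in> carrier (space_at M f)"
  shows "map_at M f h (lin_comp d f g h b a) v = map_at M g h b (map_at M f g a v)"
  using assms(1)[unfolded is_cg_module_def, THEN conjunct2, THEN conjunct2, THEN conjunct2, THEN
      conjunct1] assms(2-7) by blast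

lemma cg_module_add_morph:
  assumes "is_cg_module l d M" "f \<in> objs l d" "g \<in> objs l d"
    "a \<in> lin_morphs d f g" "b \<in> lin_morphs d f g" "v \<in> carrier (space_at M f)"
  shows "map_at M f g (\<lambda>\<sigma>. a \<sigma> + b \<sigma>) v = map_at M f g a v \<oplus>\<^bsub>space_at M g\<^esub> map_at M f g b v"
proof -
  have "map_at M f g (a + b) v = map_at M f g a v \<oplus>\<^bsub>space_at M g\<^esub> map_at M f g b v"
    using assms(1)[unfolded is_cg_module_def, THEN conjunct2, THEN conjunct2, THEN conjunct2, THEN
        conjunct2, THEN conjunct1] assms(2-6) by blast
  then show ?thesis by (simp add: plus_fun_def)
qed

lemma cg_module_scale_morph:
  assumes "is_cg_module l d M" "f \<in> objs l d" "g \<in> objs l d"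
    "a \<in> lin_morphs d f g" "v \<in> carrier (space_at M f)"
  shows "map_at M f g (\<lambda>\<sigma>. c * a \<sigma>) v = c \<odot>\<^bsub>space_at M g\<^esub> map_at M f g a v"
  using assms(1)[unfolded is_cg_module_def, THEN conjunct2, THEN conjunct2, THEN conjunct2, THEN
      conjunct2, THEN conjunct2] assms(2-5) by blast

lemma subspace_lin_morphs: "cfun.subspace (lin_morphs d f g)"
  by (rule cfun_subspaceI) (auto simp: lin_morphs_def)

lemma cg_module_zero_morph:
  assumes M: "is_cg_module l d M" and "f \<in> objs l d" "g \<in> objs l d" "v \<in> carrier (space_at M f)"
  shows "map_at M f g (\<lambda>_. 0) v = \<zero>\<^bsub>space_at M g\<^esub>"
proof -
  have 0: "(\<lambda>_. 0) \<in> lin_morphs d f g" by (simp add: lin_morphs_def)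
  \<comment> \<open>The zero morphism is written as 0 times itself to match the scaling law.\<close>
  have "map_at M f g (\<lambda>_. 0 * 0) v = 0 \<odot>\<^bsub>space_at M g\<^esub> map_at M f g (\<lambda>_. 0) v"
    by (rule cg_module_scale_morph[OF assms(1-3) 0 assms(4)])
  then show ?thesis
    using vspace_zero(2)[OF cg_module_vspace[OF M assms(3)]]
      lin_mapsD(1)[OF cg_module_lin_maps[OF assms(1-3) 0] assms(4)] by simp
qed

lemma cg_module_zero_vec:
  assumes "is_cg_module l d M" "f \<in> objs l d" "g \<in> objs l d" "a \<in> lin_morphs d f g"
  shows "map_at M f g a \<zero>\<^bsub>space_at M f\<^esub> = \<zero>\<^bsub>space_at M g\<^esub>"
  by (rule lin_maps_zero[OF cg_module_vspace[OF assms(1,2)] cg_module_vspace[OF assms(1,3)]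
        cg_module_lin_maps[OF assms]])

lemma cg_homD:
  assumes "\<eta> \<in> cg_hom l d M N" "f \<in> objs l d"
  shows "\<eta> f \<in> lin_maps (space_at M f) (space_at N f)"
    and "\<And>g a v. g \<in> objs l d \<Longrightarrow> a \<in> lin_morphs d f g \<Longrightarrow> v \<in> carrier (space_at M f) \<Longrightarrow>
      \<eta> g (map_at M f g a v) = map_at N f g a (\<eta> f v)"
  using assms unfolding cg_hom_def by blast+

lemma cg_isomorphic_sym: "cg_isomorphic l d M N \<Longrightarrow> cg_isomorphic l d N M"
  unfolding cg_isomorphic_def by blast

lemma cg_hom_comp:
  assumes "\<eta> \<in> cg_hom l d M N" "\<theta> \<in> cg_hom l d N P"
  shows "(\<lambda>f v. \<theta> f (\<eta> f v)) \<in> cg_hom l d M P"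
proof -
  have "(\<lambda>v. \<theta> f (\<eta> f v)) \<in> lin_maps (space_at M f) (space_at P f)" if f: "f \<in> objs l d" for f
    using lin_mapsD[OF cg_homD(1)[OF assms(1) f]] lin_mapsD[OF cg_homD(1)[OF assms(2) f]]
    by (simp add: lin_maps_def)
  moreover have "\<theta> g (\<eta> g (map_at M f g a v)) = map_at P f g a (\<theta> f (\<eta> f v))"
    if "f \<in> objs l d" "g \<in> objs l d" "a \<in> lin_morphs d f g" "v \<in> carrier (space_at M f)" for f g a v
    using cg_homD(2)[OF assms(1)] cg_homD(2)[OF assms(2)] lin_mapsD(1)[OF cg_homD(1)[OF assms(1)]]
        that
    by simp
  ultimately show ?thesis by (simp add: cg_hom_def)
qed

lemma cg_isomorphic_trans:
  assumes "cg_isomorphic l d M N" "cg_isomorphic l d N P"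
  shows "cg_isomorphic l d M P"
proof -
  obtain \<eta> \<theta> where 1: "\<eta> \<in> cg_hom l d M N" "\<theta> \<in> cg_hom l d N M"
    "\<And>f v. f \<in> objs l d \<Longrightarrow> v \<in> carrier (space_at M f) \<Longrightarrow> \<theta> f (\<eta> f v) = v"
    "\<And>f v. f \<in> objs l d \<Longrightarrow> v \<in> carrier (space_at N f) \<Longrightarrow> \<eta> f (\<theta> f v) = v"
    using assms(1) unfolding cg_isomorphic_def by blast
  obtain \<eta>' \<theta>' where 2: "\<eta>' \<in> cg_hom l d N P" "\<theta>' \<in> cg_hom l d P N"
    "\<And>f v. f \<in> objs l d \<Longrightarrow> v \<in> carrier (space_at N f) \<Longrightarrow> \<theta>' f (\<eta>' f v) = v"
    "\<And>f v. f \<in> objs l d \<Longrightarrow> v \<in> carrier (space_at P f) \<Longrightarrow> \<eta>' f (\<theta>' f v) = v"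
    using assms(2) unfolding cg_isomorphic_def by blast
  have "\<eta> f v \<in> carrier (space_at N f)" if "f \<in> objs l d" "v \<in> carrier (space_at M f)" for f v
    using lin_mapsD(1)[OF cg_homD(1)[OF 1(1)]] that by blast
  moreover have "\<theta>' f v \<in> carrier (space_at N f)" if "f \<in> objs l d" "v \<in> carrier (space_at P f)"
      for f v
    using lin_mapsD(1)[OF cg_homD(1)[OF 2(2)]] that by blast
  ultimately show ?thesis
    unfolding cg_isomorphic_def
    using 1(3,4) 2(3,4)
    by (intro bexI[OF _ cg_hom_comp[OF 1(1) 2(1)]] bexI[OF _ cg_hom_comp[OF 2(2) 1(2)]]) auto
qed

text \<open>Kernel and image of \<open>\<eta>\<close>, taken object by object, are submodules. The
  nonzero value at \<open>f\<^sub>0\<close> rules out a full kernel and a zero image, so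
  \<open>\<eta>\<close> is bijective at every object, and its pointwise inverse is natural.\<close>

lemma schur:
  assumes M: "simple_cg_module l d M" and N: "simple_cg_module l d N"
    and \<eta>: "\<eta> \<in> cg_hom l d M N"
    and nz: "f\<^sub>0 \<in> objs l d" "v\<^sub>0 \<in> carrier (space_at M f\<^sub>0)" "\<eta> f\<^sub>0 v\<^sub>0 \<noteq> \<zero>\<^bsub>space_at N f\<^sub>0\<^esub>"
  shows "cg_isomorphic l d M N"
proof -
  have modM: "is_cg_module l d M" and modN: "is_cg_module l d N"
    using M N by (auto simp: simple_cg_module_def)
  note vM = cg_module_vspace[OF modM] and vN = cg_module_vspace[OF modN]
  note lin = lin_mapsD[OF cg_homD(1)[OF \<eta>]]
  define K where "K f = {v \<in> carrier (space_at M f). \<eta> f v = \<zero>\<^bsub>space_at N f\<^esub>}" for f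
  define I where "I f = \<eta> f ` carrier (space_at M f)" for f
  have "cg_submodule l d K M"
    unfolding cg_submodule_def
  proof (intro conjI ballI)
    fix f assume f: "f \<in> objs l d"
    interpret Mf: Module.module complex_field "space_at M f" by (rule vM[OF f])
    show "submodule (K f) complex_field (space_at M f)"
      using lin(2,3)[OF f] vspace_zero[OF vN[OF f]] vspace_zero(1)[OF vM[OF f]]
        lin_maps_zero[OF vM[OF f] vN[OF f] cg_homD(1)[OF \<eta> f]]
      by (intro submoduleI_complex[OF vM[OF f]]) (auto simp: K_def)
    fix g a assume g: "g \<in> objs l d" and a: "a \<in> lin_morphs d f g"
    show "map_at M f g a ` K f \<subseteq> K g"
      using cg_homD(2)[OF \<eta> f g a] cg_module_zero_vec[OF modN f g a]
        lin_mapsD(1)[OF cg_module_lin_maps[OF modM f g a]]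
      by (auto simp: K_def)
  qed
  then have "(\<forall>f\<in>objs l d. K f = {\<zero>\<^bsub>space_at M f\<^esub>}) \<or> (\<forall>f\<in>objs l d. K f = carrier (space_at M f))"
    using M by (auto simp: simple_cg_module_def)
  then have K: "K f = {\<zero>\<^bsub>space_at M f\<^esub>}" if "f \<in> objs l d" for f
    using nz that by (auto simp: K_def)
  have "cg_submodule l d I N"
    unfolding cg_submodule_def
  proof (intro conjI ballI)
    fix f assume f: "f \<in> objs l d"
    interpret Mf: Module.module complex_field "space_at M f" by (rule vM[OF f])
    show "submodule (I f) complex_field (space_at N f)"
    proof (rule submoduleI_complex[OF vN[OF f]])
      show "I f \<subseteq> carrier (space_at N f)" using lin(1)[OF f] by (auto simp: I_def)
      show "\<zero>\<^bsub>space_at N f\<^esub> \<in> I f"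
        using lin_maps_zero[OF vM[OF f] vN[OF f] cg_homD(1)[OF \<eta> f]] vspace_zero(1)[OF vM[OF f]]
        unfolding I_def by (metis image_eqI)
      fix x y assume "x \<in> I f" "y \<in> I f"
      then obtain x' y' where "x' \<in> carrier (space_at M f)" "y' \<in> carrier (space_at M f)"
          "x = \<eta> f x'" "y = \<eta> f y'" unfolding I_def by blast
      then show "x \<oplus>\<^bsub>space_at N f\<^esub> y \<in> I f"
        unfolding I_def using lin(2)[OF f, of x' y', symmetric] by simp
    next
      fix c x assume "x \<in> I f"
      then obtain x' where "x' \<in> carrier (space_at M f)" "x = \<eta> f x'" unfolding I_def by blast
      then show "c \<odot>\<^bsub>space_at N f\<^esub> x \<in> I f"
        unfolding I_def using lin(3)[OF f, of x' c, symmetric] Mf.smult_closed[of c x'] by simp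
    qed
    fix g a assume g: "g \<in> objs l d" and a: "a \<in> lin_morphs d f g"
    show "map_at N f g a ` I f \<subseteq> I g"
      using cg_homD(2)[OF \<eta> f g a, symmetric] lin_mapsD(1)[OF cg_module_lin_maps[OF modM f g a]]
      by (auto simp: I_def)
  qed
  then have "(\<forall>f\<in>objs l d. I f = {\<zero>\<^bsub>space_at N f\<^esub>}) \<or> (\<forall>f\<in>objs l d. I f = carrier (space_at N f))"
    using N by (auto simp: simple_cg_module_def)
  then have I: "\<eta> f ` carrier (space_at M f) = carrier (space_at N f)" if "f \<in> objs l d" for f
    using nz that by (auto simp: I_def)
  have inj: "inj_on (\<eta> f) (carrier (space_at M f))" if f: "f \<in> objs l d" for f
  proof (rule inj_onI)
    interpret Mf: Module.module complex_field "space_at M f" by (rule vM[OF f])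
    interpret Nf: Module.module complex_field "space_at N f" by (rule vN[OF f])
    fix x y assume x: "x \<in> carrier (space_at M f)" and y: "y \<in> carrier (space_at M f)"
        and eq: "\<eta> f x = \<eta> f y"
    have y': "(-1) \<odot>\<^bsub>space_at M f\<^esub> y \<in> carrier (space_at M f)" using Mf.smult_closed[of "-1" y] y
        by simp
    have neg: "y \<oplus>\<^bsub>space_at M f\<^esub> (-1) \<odot>\<^bsub>space_at M f\<^esub> y = \<zero>\<^bsub>space_at M f\<^esub>"
      using Mf.smult_l_distr[of 1 "-1" y] Mf.smult_one[OF y] Mf.smult_l_null[OF y] y by simp
    have "\<eta> f (x \<oplus>\<^bsub>space_at M f\<^esub> (-1) \<odot>\<^bsub>space_at M f\<^esub> y) =
        \<eta> f (y \<oplus>\<^bsub>space_at M f\<^esub> (-1) \<odot>\<^bsub>space_at M f\<^esub> y)"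
      using lin(2)[OF f x y'] lin(2)[OF f y y'] eq by simp
    also have "\<dots> = \<zero>\<^bsub>space_at N f\<^esub>"
      using lin_maps_zero[OF vM[OF f] vN[OF f] cg_homD(1)[OF \<eta> f]] by (simp only: neg)
    finally have "x \<oplus>\<^bsub>space_at M f\<^esub> (-1) \<odot>\<^bsub>space_at M f\<^esub> y \<in> K f"
      using x y' by (simp add: K_def)
    then have "x \<oplus>\<^bsub>space_at M f\<^esub> (-1) \<odot>\<^bsub>space_at M f\<^esub> y = y \<oplus>\<^bsub>space_at M f\<^esub> (-1) \<odot>\<^bsub>space_at M f\<^esub> y"
      using K[OF f] neg by simp
    then show "x = y" using x y y' by (simp add: Mf.add.r_cancel)
  qed
  define \<theta> where "\<theta> f = inv_into (carrier (space_at M f)) (\<eta> f)" for f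
  have \<theta>1: "\<theta> f (\<eta> f v) = v" if "f \<in> objs l d" "v \<in> carrier (space_at M f)" for f v
    using inv_into_f_f[OF inj[OF that(1)] that(2)] by (simp add: \<theta>_def)
  have \<theta>2: "\<eta> f (\<theta> f w) = w" and \<theta>c: "\<theta> f w \<in> carrier (space_at M f)"
    if "f \<in> objs l d" "w \<in> carrier (space_at N f)" for f w
    using f_inv_into_f[of w "\<eta> f"] inv_into_into[of w "\<eta> f"] I[OF that(1)] that(2)
        by (auto simp: \<theta>_def)
  have "\<theta> \<in> cg_hom l d N M"
    unfolding cg_hom_def
  proof (intro CollectI conjI ballI)
    fix f assume f: "f \<in> objs l d"
    interpret Mf: Module.module complex_field "space_at M f" by (rule vM[OF f])
    show "\<theta> f \<in> lin_maps (space_at N f) (space_at M f)"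
      unfolding lin_maps_def
    proof (intro CollectI conjI ballI allI Pi_I)
      fix x y assume x: "x \<in> carrier (space_at N f)" and y: "y \<in> carrier (space_at N f)"
      have "x \<oplus>\<^bsub>space_at N f\<^esub> y = \<eta> f (\<theta> f x \<oplus>\<^bsub>space_at M f\<^esub> \<theta> f y)"
        using lin(2)[OF f \<theta>c[OF f x] \<theta>c[OF f y]] \<theta>2[OF f] x y by simp
      then show "\<theta> f (x \<oplus>\<^bsub>space_at N f\<^esub> y) = \<theta> f x \<oplus>\<^bsub>space_at M f\<^esub> \<theta> f y"
        using \<theta>1[OF f] \<theta>c[OF f x] \<theta>c[OF f y] by simp
    next
      fix c x assume x: "x \<in> carrier (space_at N f)"
      have "c \<odot>\<^bsub>space_at N f\<^esub> x = \<eta> f (c \<odot>\<^bsub>space_at M f\<^esub> \<theta> f x)"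
        using lin(3)[OF f \<theta>c[OF f x]] \<theta>2[OF f] x by simp
      then show "\<theta> f (c \<odot>\<^bsub>space_at N f\<^esub> x) = c \<odot>\<^bsub>space_at M f\<^esub> \<theta> f x"
        using \<theta>1[OF f] \<theta>c[OF f x] Mf.smult_closed[of c "\<theta> f x"] by simp
    qed (use \<theta>c[OF f] in blast)
    fix g a w assume g: "g \<in> objs l d" and a: "a \<in> lin_morphs d f g"
        and w: "w \<in> carrier (space_at N f)"
    have "map_at N f g a w = \<eta> g (map_at M f g a (\<theta> f w))"
      using cg_homD(2)[OF \<eta> f g a \<theta>c[OF f w]] \<theta>2[OF f w] by simp
    then show "\<theta> g (map_at N f g a w) = map_at M f g a (\<theta> f w)"
      using \<theta>1[OF g] lin_mapsD(1)[OF cg_module_lin_maps[OF modM f g a]] \<theta>c[OF f w] by simp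
  qed
  then show ?thesis
    unfolding cg_isomorphic_def using \<eta> \<theta>1 \<theta>2 by blast
qed

section \<open>The groupoid\<close>

lemma id_in_morphs: "id \<in> morphs d f f"
  by (simp add: morphs_def permutes_id)

lemma morphs_comp:
  assumes "\<sigma> \<in> morphs d f g" "\<tau> \<in> morphs d g h"
  shows "\<tau> \<circ> \<sigma> \<in> morphs d f h"
proof -
  have "\<sigma> k \<in> {1..d}" if "k \<in> {1..d}" for k
    using assms(1) that permutes_in_image[of \<sigma> "{1..d}" k] unfolding morphs_def by blast
  then show ?thesis using assms by (simp add: morphs_def permutes_compose)
qed

lemma morphs_inv:
  assumes "\<sigma> \<in> morphs d f g"
  shows "inv \<sigma> \<in> morphs d g f"
proof -
  have \<sigma>: "\<sigma> permutes {1..d}" using assms by (simp add: morphs_def)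
  have "f (inv \<sigma> k) = g k" if "k \<in> {1..d}" for k
  proof -
    have "inv \<sigma> k \<in> {1..d}" using permutes_in_image[OF permutes_inv[OF \<sigma>]] that by blast
    then have "g (\<sigma> (inv \<sigma> k)) = f (inv \<sigma> k)" using assms unfolding morphs_def by blast
    then show ?thesis using permutes_inverses(1)[OF \<sigma>] by simp
  qed
  then show ?thesis using permutes_inv[OF \<sigma>] by (simp add: morphs_def)
qed

lemma morphs_bij: "\<sigma> \<in> morphs d f g \<Longrightarrow> bij \<sigma>"
  by (auto simp: morphs_def intro: permutes_bij)

lemma finite_morphs: "finite (morphs d f g)"
  by (rule finite_subset[OF _ finite_permutations[of "{1..d}"]]) (auto simp: morphs_def)

lemma inv_comp_cancel:
  assumes "bij \<sigma>"
  shows "inv \<sigma> \<circ> \<sigma> = id" "\<sigma> \<circ> inv \<sigma> = id" "inv \<sigma> \<circ> (\<sigma> \<circ> \<tau>) = \<tau>" "\<sigma> \<circ> (inv \<sigma> \<circ> \<tau>) = \<tau>"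
  using assms by (simp_all add: fun_eq_iff bij_is_inj bij_is_surj surj_f_inv_f)

lemma morphs_fiber_bij:
  assumes "\<sigma> \<in> morphs d f g"
  shows "bij_betw \<sigma> {k \<in> {1..d}. f k = i} {k \<in> {1..d}. g k = i}"
proof -
  have \<sigma>: "\<sigma> permutes {1..d}" using assms by (simp add: morphs_def)
  show ?thesis
  proof (rule bij_betwI[where g = "inv \<sigma>"])
    have "\<sigma> k \<in> {1..d}" "inv \<sigma> k \<in> {1..d}" if "k \<in> {1..d}" for k
      using permutes_in_image[OF \<sigma>] permutes_in_image[OF permutes_inv[OF \<sigma>]] that by blast+
    then show "\<sigma> \<in> {k \<in> {1..d}. f k = i} \<rightarrow> {k \<in> {1..d}. g k = i}"
        "inv \<sigma> \<in> {k \<in> {1..d}. g k = i} \<rightarrow> {k \<in> {1..d}. f k = i}"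
      using assms morphs_inv[OF assms] unfolding morphs_def by blast+
  qed (use permutes_inverses[OF \<sigma>] in auto)
qed

lemma type_of_obj_eq_if_morph:
  assumes "\<sigma> \<in> morphs d f g"
  shows "type_of_obj l d f = type_of_obj l d g"
  unfolding type_of_obj_def using bij_betw_same_card[OF morphs_fiber_bij[OF assms]] by (simp only:)

lemma type_of_obj_in_weights:
  assumes "f \<in> objs l d"
  shows "type_of_obj l d f \<in> weights l d"
proof -
  have "(\<Union>i\<in>{1..l}. {k \<in> {1..d}. f k = i}) = {1..d}"
    using assms by (fastforce simp: objs_def)
  moreover have "card (\<Union>i\<in>{1..l}. {k \<in> {1..d}. f k = i}) = (\<Sum>i\<in>{1..l}. card {k \<in> {1..d}. f k = i})"
    by (rule card_UN_disjoint) auto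
  ultimately have "(\<Sum>i\<in>{1..l}. card {k \<in> {1..d}. f k = i}) = d" by simp
  moreover have "(\<Sum>i\<in>{1..l}. type_of_obj l d f i) = (\<Sum>i\<in>{1..l}. card {k \<in> {1..d}. f k = i})"
    by (rule sum.cong) (simp_all add: type_of_obj_def)
  ultimately show ?thesis by (simp add: weights_def type_of_obj_def)
qed

section \<open>Order-preserving morphisms between objects of the same type\<close>

text \<open>The image of \<open>x\<close> has as many smaller elements in \<open>B\<close> as
  \<open>x\<close> has in \<open>A\<close>, and this number determines an element of
  \<open>B\<close>.\<close>

lemma strict_mono_bij_unique:
  fixes h h' :: "nat \<Rightarrow> nat"
  assumes "finite A" "bij_betw h A B" "bij_betw h' A B" "strict_mono_on A h" "strict_mono_on A h'"
      "x \<in> A"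
  shows "h x = h' x"
proof -
  have card: "card {y \<in> B. y < k x} = card {y \<in> A. y < x}" if k: "bij_betw k A B"
      and km: "strict_mono_on A k" for k
  proof -
    have "k ` {y \<in> A. y < x} = {y \<in> B. y < k x}"
    proof (intro equalityI subsetI)
      fix z assume z: "z \<in> {y \<in> B. y < k x}"
      then obtain y where y: "y \<in> A" "z = k y" using k by (auto simp: bij_betw_def)
      have "y < x"
      proof (rule ccontr)
        assume "\<not> y < x"
        then have "x = y \<or> k x < k y" using strict_mono_onD[OF km assms(6) y(1)] by linarith
        then show False using z y(2) by auto
      qed
      then show "z \<in> k ` {y \<in> A. y < x}" using y by blast
    next
      fix z assume "z \<in> k ` {y \<in> A. y < x}"
      then show "z \<in> {y \<in> B. y < k x}"
        using strict_mono_onD[OF km _ assms(6)] k by (auto simp: bij_betw_def)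
    qed
    moreover have "inj_on k {y \<in> A. y < x}"
      using bij_betw_imp_inj_on[OF k] by (rule inj_on_subset) auto
    then have "card (k ` {y \<in> A. y < x}) = card {y \<in> A. y < x}" by (rule card_image)
    ultimately show ?thesis by (simp only:)
  qed
  have finB: "finite B" using assms(1,2) bij_betw_finite by blast
  have in_B: "h x \<in> B" "h' x \<in> B" using assms(2,3,6) by (auto simp: bij_betw_def)
  have less: "card {z \<in> B. z < y} < card {z \<in> B. z < y'}" if "y < y'" "y \<in> B" for y y'
    by (rule psubset_card_mono) (use that finB in auto)
  show ?thesis
    using less[of "h x" "h' x"] less[of "h' x" "h x"] in_B card[OF assms(2,4)] card[OF assms(3,5)]
    by (cases "h x" "h' x" rule: linorder_cases) auto
qed

text \<open>The clause that singles out \<open>sigma_morph\<close> among the morphisms with given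
  source and target.\<close>

definition fiber_monotone :: "nat \<Rightarrow> (nat \<Rightarrow> nat) \<Rightarrow> (nat \<Rightarrow> nat) \<Rightarrow> bool" where
  "fiber_monotone d f \<sigma> \<longleftrightarrow> (\<forall>i\<in>{1..d}. \<forall>j\<in>{1..d}. i < j \<and> f i = f j \<longrightarrow> \<sigma> i < \<sigma> j)"

lemma fiber_monotone_unique:
  assumes "\<sigma> \<in> morphs d f g" "\<tau> \<in> morphs d f g" "fiber_monotone d f \<sigma>" "fiber_monotone d f \<tau>"
  shows "\<sigma> = \<tau>"
proof
  fix k
  show "\<sigma> k = \<tau> k"
  proof (cases "k \<in> {1..d}")
    case True
    let ?A = "{j \<in> {1..d}. f j = f k}"
    have "strict_mono_on ?A \<rho>" if "fiber_monotone d f \<rho>" for \<rho>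
      using that by (intro strict_mono_onI) (auto simp: fiber_monotone_def)
    then show ?thesis
      using True assms
      by (intro strict_mono_bij_unique[OF _ morphs_fiber_bij[OF assms(1)] morphs_fiber_bij[OF
          assms(2)]]) auto
  next
    case False
    have "\<sigma> permutes {1..d}" "\<tau> permutes {1..d}" using assms by (simp_all add: morphs_def)
    then show ?thesis using False permutes_not_in by metis
  qed
qed

lemma strict_mono_bij_exists:
  fixes A B :: "nat set"
  assumes "finite A" "finite B" "card A = card B"
  shows "\<exists>h. bij_betw h A B \<and> strict_mono_on A h"
proof -
  obtain a where a: "bij_betw a {..<card A} A" "strict_mono_on {..<card A} a"
    using ex_bij_betw_strict_mono_card[OF assms(1)] .
  obtain b where b: "bij_betw b {..<card B} B" "strict_mono_on {..<card B} b"
    using ex_bij_betw_strict_mono_card[OF assms(2)] .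
  let ?a' = "inv_into {..<card A} a"
  have a': "bij_betw ?a' A {..<card A}" using a(1) by (rule bij_betw_inv_into)
  have "strict_mono_on A (b \<circ> ?a')"
  proof (rule strict_mono_onI)
    fix x y assume x: "x \<in> A" and y: "y \<in> A" and "x < y"
    have in_range: "?a' x \<in> {..<card A}" "?a' y \<in> {..<card A}" using bij_betw_apply[OF a'] x y
        by blast+
    have inv: "a (?a' x) = x" "a (?a' y) = y" using bij_betw_inv_into_right[OF a(1)] x y by blast+
    have "?a' x < ?a' y"
    proof (rule ccontr)
      assume "\<not> ?a' x < ?a' y"
      then consider "?a' y < ?a' x" | "?a' x = ?a' y" by linarith
      then show False
      proof cases
        case 1
        then have "a (?a' y) < a (?a' x)" using strict_mono_onD[OF a(2)] in_range by blast
        then show False using inv \<open>x < y\<close> by simp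
      next
        case 2
        then have "a (?a' x) = a (?a' y)" by (rule arg_cong)
        then show False using inv \<open>x < y\<close> by simp
      qed
    qed
    then have "b (?a' x) < b (?a' y)"
      using in_range assms(3) by (intro strict_mono_onD[OF b(2)]) auto
    then show "(b \<circ> ?a') x < (b \<circ> ?a') y" by (simp only: o_apply)
  qed
  moreover have "bij_betw (b \<circ> ?a') A B"
    using a' b(1) unfolding assms(3) by (rule bij_betw_trans)
  ultimately show ?thesis by blast
qed

text \<open>Equal types mean equally large fibres; the increasing bijections between corresponding
  fibres are glued together.\<close>

lemma fiber_monotone_exists:
  assumes f: "f \<in> objs l d" and g: "g \<in> objs l d" and type: "type_of_obj l d f = type_of_obj l d g"
  shows "\<exists>\<sigma>\<in>morphs d f g. fiber_monotone d f \<sigma>"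
proof -
  let ?A = "\<lambda>i. {k \<in> {1..d}. f k = i}" and ?B = "\<lambda>i. {k \<in> {1..d}. g k = i}"
  have ex: "\<exists>h. bij_betw h (?A i) (?B i) \<and> strict_mono_on (?A i) h" if i: "i \<in> {1..l}" for i
  proof -
    have "card (?A i) = card (?B i)"
      using fun_cong[OF type, of i] i by (simp add: type_of_obj_def)
    then show ?thesis by (intro strict_mono_bij_exists) auto
  qed
  define h where "h i = (SOME h. bij_betw h (?A i) (?B i) \<and> strict_mono_on (?A i) h)" for i
  have h: "bij_betw (h i) (?A i) (?B i)" "strict_mono_on (?A i) (h i)" if "i \<in> {1..l}" for i
    using someI_ex[OF ex[OF that]] by (simp_all add: h_def)
  have fl: "f k \<in> {1..l}" and gl: "g k \<in> {1..l}" if "k \<in> {1..d}" for k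
    using f g that by (auto simp: objs_def)
  define \<sigma> where "\<sigma> k = (if k \<in> {1..d} then h (f k) k else k)" for k
  have \<sigma>B: "\<sigma> k \<in> ?B (f k)" if k: "k \<in> {1..d}" for k
    using bij_betw_apply[OF h(1)[OF fl[OF k]], of k] k by (simp add: \<sigma>_def)
  have "inj_on \<sigma> {1..d}"
  proof (rule inj_onI)
    fix j k assume jk: "j \<in> {1..d}" "k \<in> {1..d}" "\<sigma> j = \<sigma> k"
    then have fjk: "f j = f k" using \<sigma>B[OF jk(1)] \<sigma>B[OF jk(2)] by simp
    have "h (f k) j = h (f k) k" using jk fjk by (simp only: \<sigma>_def if_True)
    then show "j = k"
      by (rule inj_onD[OF bij_betw_imp_inj_on[OF h(1)[OF fl[OF jk(2)]]]]) (use jk fjk in auto)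
  qed
  moreover have "\<sigma> ` {1..d} \<subseteq> {1..d}" using \<sigma>B by blast
  ultimately have "bij_betw \<sigma> {1..d} {1..d}" by (intro bij_betw_imageI endo_inj_surj) auto
  then have "\<sigma> permutes {1..d}" by (rule bij_imp_permutes) (simp only: \<sigma>_def if_False)
  then have "\<sigma> \<in> morphs d f g" using \<sigma>B by (simp add: morphs_def)
  moreover have "fiber_monotone d f \<sigma>"
    unfolding fiber_monotone_def
  proof (intro ballI impI)
    fix i j assume ij: "i \<in> {1..d}" "j \<in> {1..d}" "i < j \<and> f i = f j"
    have "h (f i) i < h (f i) j"
      by (rule strict_mono_onD[OF h(2)[OF fl[OF ij(1)]]]) (use ij in auto)
    then show "\<sigma> i < \<sigma> j" using ij by (simp only: \<sigma>_def if_True)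
  qed
  ultimately show ?thesis by blast
qed

lemma sigma_morph:
  assumes "f \<in> objs l d" "g \<in> objs l d" "type_of_obj l d f = type_of_obj l d g"
  shows "sigma_morph d f g \<in> morphs d f g" "fiber_monotone d f (sigma_morph d f g)"
proof -
  obtain \<sigma> where \<sigma>: "\<sigma> \<in> morphs d f g" "fiber_monotone d f \<sigma>"
      using fiber_monotone_exists[OF assms] by blast
  have "sigma_morph d f g = \<sigma>"
    unfolding sigma_morph_def fiber_monotone_def[symmetric]
    using \<sigma> fiber_monotone_unique by (intro the_equality) blast+
  with \<sigma> show "sigma_morph d f g \<in> morphs d f g" "fiber_monotone d f (sigma_morph d f g)"
      by simp_all
qed

lemma sigma_morph_eqI:
  assumes "\<sigma> \<in> morphs d f g" "fiber_monotone d f \<sigma>"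
  shows "sigma_morph d f g = \<sigma>"
  unfolding sigma_morph_def fiber_monotone_def[symmetric]
  using assms fiber_monotone_unique by (intro the_equality) blast+

lemma sigma_morph_self: "sigma_morph d f f = id"
  by (rule sigma_morph_eqI) (auto simp: id_in_morphs fiber_monotone_def)

text \<open>The inverse again preserves order on fibres, and a morphism with this property is
  unique.\<close>

lemma sigma_morph_inverse:
  assumes "f \<in> objs l d" "g \<in> objs l d" "type_of_obj l d f = type_of_obj l d g"
  shows "sigma_morph d g f = inv (sigma_morph d f g)"
proof (rule sigma_morph_eqI)
  let ?\<sigma> = "sigma_morph d f g"
  note \<sigma> = sigma_morph[OF assms]
  show inv: "inv ?\<sigma> \<in> morphs d g f" using \<sigma>(1) by (rule morphs_inv)
  note bij = morphs_bij[OF \<sigma>(1)]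
  have inv_in: "inv ?\<sigma> k \<in> {1..d}" "f (inv ?\<sigma> k) = g k" if "k \<in> {1..d}" for k
    using inv that permutes_in_image[of "inv ?\<sigma>" "{1..d}" k] unfolding morphs_def by blast+
  show "fiber_monotone d g (inv ?\<sigma>)"
    unfolding fiber_monotone_def
  proof (intro ballI impI)
    fix i j assume i: "i \<in> {1..d}" and j: "j \<in> {1..d}" and ij: "i < j \<and> g i = g j"
    have s: "?\<sigma> (inv ?\<sigma> k) = k" for k using bij by (simp add: bij_is_surj surj_f_inv_f)
    show "inv ?\<sigma> i < inv ?\<sigma> j"
    proof (rule ccontr)
      assume "\<not> inv ?\<sigma> i < inv ?\<sigma> j"
      then have "inv ?\<sigma> j < inv ?\<sigma> i \<or> inv ?\<sigma> j = inv ?\<sigma> i" by linarith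
      moreover have "?\<sigma> (inv ?\<sigma> j) < ?\<sigma> (inv ?\<sigma> i)" if "inv ?\<sigma> j < inv ?\<sigma> i"
        using \<sigma>(2) inv_in[OF i] inv_in[OF j] that ij unfolding fiber_monotone_def by metis
      ultimately show False using s[of i] s[of j] ij by (metis less_asym less_irrefl)
    qed
  qed
qed

section \<open>Standard objects and their blocks\<close>

text \<open>The offset subtracted in \<open>block_component\<close>: for \<open>i \<ge> 1\<close>,
  block \<open>i\<close> consists of the integers greater than \<open>block_start \<mu> i\<close>
  and at most \<open>block_start \<mu> (Suc i)\<close>.\<close>

definition block_start :: "(nat \<Rightarrow> nat) \<Rightarrow> nat \<Rightarrow> nat" where
  "block_start \<mu> i = (\<Sum>j\<in>{1..<i}. \<mu> j)"

lemma block_start_Suc: "i \<ge> 1 \<Longrightarrow> block_start \<mu> (Suc i) = block_start \<mu> i + \<mu> i"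
  by (simp add: block_start_def)

lemma block_start_mono: "i \<le> j \<Longrightarrow> block_start \<mu> i \<le> block_start \<mu> j"
  unfolding block_start_def by (intro sum_mono2) auto

lemma block_start_1: "block_start \<mu> (Suc 0) = 0"
  by (simp add: block_start_def)

lemma block_start_end: "\<mu> \<in> weights l d \<Longrightarrow> block_start \<mu> (Suc l) = d"
  by (simp add: block_start_def weights_def atLeastLessThanSuc_atLeastAtMost)

text \<open>Monotonicity makes the points of value at most \<open>i\<close> an initial segment of
  \<open>{1..d}\<close>, whose size is fixed by the type. All values of \<open>f\<close> are thereby
  determined, which gives the uniqueness of the standard object.\<close>

lemma monotone_obj_le_iff:
  assumes f: "f \<in> objs l d" and type: "type_of_obj l d f = \<mu>" and mono: "mono_on {1..d} f"
    and k: "k \<in> {1..d}" and i: "i \<le> l"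
  shows "f k \<le> i \<longleftrightarrow> k \<le> block_start \<mu> (Suc i)"
proof -
  let ?X = "{j \<in> {1..d}. f j \<le> i}"
  have "?X = (\<Union>i'\<in>{1..i}. {j \<in> {1..d}. f j = i'})" using f by (fastforce simp: objs_def)
  moreover have "card (\<Union>i'\<in>{1..i}. {j \<in> {1..d}. f j = i'}) = (\<Sum>i'\<in>{1..i}. card {j \<in> {1..d}. f j =
      i'})"
    by (rule card_UN_disjoint) auto
  moreover have "\<dots> = (\<Sum>i'\<in>{1..i}. \<mu> i')"
    using i by (intro sum.cong) (auto simp: type[symmetric] type_of_obj_def)
  ultimately have card: "card ?X = block_start \<mu> (Suc i)"
    by (simp add: block_start_def atLeastLessThanSuc_atLeastAtMost)
  have down: "{1..j} \<subseteq> ?X" if "j \<in> ?X" for j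
  proof
    fix j' assume "j' \<in> {1..j}"
    then show "j' \<in> ?X" using that mono_onD[OF mono, of j' j] by auto
  qed
  show ?thesis
  proof
    assume "f k \<le> i"
    then have "{1..k} \<subseteq> ?X" using down k by blast
    then have "card {1..k} \<le> card ?X" by (rule card_mono[rotated]) simp
    then show "k \<le> block_start \<mu> (Suc i)" using card by simp
  next
    assume le: "k \<le> block_start \<mu> (Suc i)"
    show "f k \<le> i"
    proof (rule ccontr)
      assume "\<not> f k \<le> i"
      have "?X \<subseteq> {1..<k}"
      proof
        fix j assume j: "j \<in> ?X"
        have "\<not> k \<le> j"
        proof
          assume "k \<le> j"
          then have "k \<in> ?X" using down[OF j] k by auto
          then show False using \<open>\<not> f k \<le> i\<close> by simp
        qed
        then show "j \<in> {1..<k}" using j by simp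
      qed
      then have "card ?X \<le> card {1..<k}" by (rule card_mono[rotated]) simp
      then have "card ?X \<le> k - 1" by simp
      moreover have "k \<ge> 1" using k by simp
      ultimately show False using card le by linarith
    qed
  qed
qed

lemma monotone_obj_unique:
  assumes "f \<in> objs l d" "type_of_obj l d f = \<mu>" "mono_on {1..d} f"
    and "g \<in> objs l d" "type_of_obj l d g = \<mu>" "mono_on {1..d} g"
  shows "f = g"
proof (rule PiE_ext)
  show "f \<in> {1..d} \<rightarrow>\<^sub>E {1..l}" "g \<in> {1..d} \<rightarrow>\<^sub>E {1..l}" using assms by (simp_all add: objs_def)
  fix k assume k: "k \<in> {1..d}"
  then have "f k \<le> l" "g k \<le> l" using assms by (auto simp: objs_def)
  then have "f k \<le> g k" "g k \<le> f k"
    using monotone_obj_le_iff[OF assms(1-3) k] monotone_obj_le_iff[OF assms(4-6) k] by blast+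
  then show "f k = g k" by simp
qed

lemma monotone_obj_exists:
  assumes \<mu>: "\<mu> \<in> weights l d"
  shows "\<exists>f. f \<in> objs l d \<and> type_of_obj l d f = \<mu> \<and> mono_on {1..d} f"
proof -
  \<comment> \<open>The number of the block containing \<open>k\<close>; taking the least index
    skips empty blocks.\<close>
  define F where "F k = (LEAST i. k \<le> block_start \<mu> (Suc i))" for k
  define f where "f = restrict F {1..d}"
  have ex: "k \<le> block_start \<mu> (Suc l)" if "k \<in> {1..d}" for k
    using that block_start_end[OF \<mu>] by simp
  have le: "F k \<le> i \<longleftrightarrow> k \<le> block_start \<mu> (Suc i)" if k: "k \<in> {1..d}" for k i
  proof
    assume "F k \<le> i"
    then have "block_start \<mu> (Suc (F k)) \<le> block_start \<mu> (Suc i)" by (intro block_start_mono) simp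
    moreover have "k \<le> block_start \<mu> (Suc (F k))"
      unfolding F_def by (rule LeastI[of "\<lambda>i. k \<le> block_start \<mu> (Suc i)", OF ex[OF k]])
    ultimately show "k \<le> block_start \<mu> (Suc i)" by simp
  qed (simp add: F_def Least_le)
  have Fl: "F k \<in> {1..l}" if k: "k \<in> {1..d}" for k
  proof -
    have "F k \<le> l" using le[OF k] ex[OF k] by blast
    moreover have "\<not> F k \<le> 0" using le[OF k, of 0] k by (simp add: block_start_1)
    ultimately show ?thesis by simp
  qed
  then have obj: "f \<in> objs l d" by (auto simp: f_def objs_def)
  have mono: "mono_on {1..d} f"
  proof (rule mono_onI)
    fix j k assume jk: "j \<in> {1..d}" "k \<in> {1..d}" "j \<le> k"
    have "k \<le> block_start \<mu> (Suc (F k))" using le[OF jk(2), of "F k"] by simp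
    then have "F j \<le> F k" using le[OF jk(1), of "F k"] jk(3) by simp
    then show "f j \<le> f k" using jk by (simp add: f_def)
  qed
  have "type_of_obj l d f = \<mu>"
  proof (rule PiE_ext)
    show "type_of_obj l d f \<in> {1..l} \<rightarrow>\<^sub>E UNIV" "\<mu> \<in> {1..l} \<rightarrow>\<^sub>E UNIV"
      using \<mu> by (auto simp: type_of_obj_def weights_def)
    fix i assume i: "i \<in> {1..l}"
    then obtain i' where i': "i = Suc i'" by (cases i) auto
    have end_le: "block_start \<mu> (Suc i) \<le> d"
      using block_start_mono[of "Suc i" "Suc l" \<mu>] i block_start_end[OF \<mu>] by simp
    have "{k \<in> {1..d}. f k = i} = {block_start \<mu> i<..block_start \<mu> (Suc i)}"
    proof (intro Set.set_eqI)
      fix k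
      have "k \<in> {k \<in> {1..d}. f k = i} \<longleftrightarrow> k \<in> {1..d} \<and> F k \<le> i \<and> \<not> F k \<le> i'"
        by (auto simp: f_def i')
      also have "\<dots> \<longleftrightarrow> k \<in> {1..d} \<and> k \<le> block_start \<mu> (Suc i) \<and> \<not> k \<le> block_start \<mu> i"
        using le[of k i] le[of k i'] i' by blast
      also have "\<dots> \<longleftrightarrow> k \<in> {block_start \<mu> i<..block_start \<mu> (Suc i)}"
        using end_le by auto
      finally show "k \<in> {k \<in> {1..d}. f k = i} \<longleftrightarrow> k \<in> {block_start \<mu> i<..block_start \<mu> (Suc i)}" .
    qed
    then show "type_of_obj l d f i = \<mu> i"
      using i block_start_Suc[of i \<mu>] by (simp add: type_of_obj_def)
  qed
  with obj mono show ?thesis by blast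
qed

lemma std_obj:
  assumes "\<mu> \<in> weights l d"
  shows "std_obj l d \<mu> \<in> objs l d" "type_of_obj l d (std_obj l d \<mu>) =
      \<mu>" "mono_on {1..d} (std_obj l d \<mu>)"
proof -
  have "\<exists>!f. f \<in> objs l d \<and> type_of_obj l d f = \<mu> \<and> mono_on {1..d} f"
    using monotone_obj_exists[OF assms] monotone_obj_unique by (metis (no_types, lifting))
  from theI'[OF this] show "std_obj l d \<mu> \<in> objs l d" "type_of_obj l d (std_obj l d \<mu>) = \<mu>"
      "mono_on {1..d} (std_obj l d \<mu>)"
    unfolding std_obj_def by blast+
qed

lemma std_obj_eq_iff:
  assumes \<mu>: "\<mu> \<in> weights l d" and i: "i \<in> {1..l}"
  shows "k \<in> {1..d} \<and> std_obj l d \<mu> k = i \<longleftrightarrow> block_start \<mu> i < k \<and> k \<le> block_start \<mu> i + \<mu> i"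
proof -
  obtain i' where i': "i = Suc i'" using i by (cases i) auto
  have le: "std_obj l d \<mu> k \<le> j \<longleftrightarrow> k \<le> block_start \<mu> (Suc j)" if "k \<in> {1..d}" "j \<le> l" for j
    using monotone_obj_le_iff[OF std_obj[OF \<mu>] that] .
  have "block_start \<mu> (Suc i) \<le> d"
    using block_start_mono[of "Suc i" "Suc l" \<mu>] i block_start_end[OF \<mu>] by simp
  moreover have "block_start \<mu> (Suc i) = block_start \<mu> i + \<mu> i" using i
      by (intro block_start_Suc) simp
  moreover have "std_obj l d \<mu> k = i \<longleftrightarrow> std_obj l d \<mu> k \<le> i \<and> \<not> std_obj l d \<mu> k \<le> i'"
    using i' by auto
  ultimately show ?thesis using le[of i] le[of i'] i i' by auto
qed

lemma block_position:
  assumes \<mu>: "\<mu> \<in> weights l d" and k: "k \<in> {1..d}"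
  defines "i \<equiv> std_obj l d \<mu> k"
  shows "i \<in> {1..l}" "k - block_start \<mu> i \<in> {1..\<mu> i}" "block_start \<mu> i + (k - block_start \<mu> i) = k"
proof -
  show i: "i \<in> {1..l}" using std_obj(1)[OF \<mu>] k by (auto simp: objs_def i_def)
  have "block_start \<mu> i < k \<and> k \<le> block_start \<mu> i + \<mu> i"
    using std_obj_eq_iff[OF \<mu> i, of k] k by (simp add: i_def)
  then show "k - block_start \<mu> i \<in> {1..\<mu> i}" "block_start \<mu> i + (k - block_start \<mu> i) = k" by auto
qed

lemma block_element:
  assumes "\<mu> \<in> weights l d" "i \<in> {1..l}" "k \<in> {1..\<mu> i}"
  shows "block_start \<mu> i + k \<in> {1..d}" "std_obj l d \<mu> (block_start \<mu> i + k) = i"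
proof -
  have "block_start \<mu> i + k \<in> {1..d} \<and> std_obj l d \<mu> (block_start \<mu> i + k) = i"
    unfolding std_obj_eq_iff[OF assms(1,2)] using assms(3) by auto
  then show "block_start \<mu> i + k \<in> {1..d}" "std_obj l d \<mu> (block_start \<mu> i + k) = i" by auto
qed

section \<open>Automorphisms of the standard object as a product of symmetric groups\<close>

lemma block_component_apply:
  "k \<in> {1..\<mu> i} \<Longrightarrow> block_component \<mu> \<sigma> i k = \<sigma> (block_start \<mu> i + k) - block_start \<mu> i"
  "k \<notin> {1..\<mu> i} \<Longrightarrow> block_component \<mu> \<sigma> i k = k"
  by (simp_all only: block_component_def block_start_def if_True if_False)

text \<open>An automorphism preserves the fibres of the standard object, which are the blocks; hence
  the subtraction in \<open>block_component\<close> never truncates.\<close>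

lemma std_aut_block:
  assumes \<mu>: "\<mu> \<in> weights l d" and \<sigma>: "\<sigma> \<in> morphs d (std_obj l d \<mu>) (std_obj l d \<mu>)"
    and i: "i \<in> {1..l}" and k: "k \<in> {1..\<mu> i}"
  shows "block_component \<mu> \<sigma> i k \<in> {1..\<mu> i}"
    and "\<sigma> (block_start \<mu> i + k) = block_start \<mu> i + block_component \<mu> \<sigma> i k"
proof -
  note el = block_element[OF \<mu> i k]
  have "\<sigma> (block_start \<mu> i + k) \<in> {1..d} \<and> std_obj l d \<mu> (\<sigma> (block_start \<mu> i + k)) = i"
  proof
    have "\<sigma> permutes {1..d}" using \<sigma> by (simp add: morphs_def)
    then show "\<sigma> (block_start \<mu> i + k) \<in> {1..d}" using el(1) permutes_in_image by metis
    have "std_obj l d \<mu> (\<sigma> (block_start \<mu> i + k)) = std_obj l d \<mu> (block_start \<mu> i + k)"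
      using \<sigma> el(1) unfolding morphs_def by blast
    then show "std_obj l d \<mu> (\<sigma> (block_start \<mu> i + k)) = i" using el(2) by simp
  qed
  then have "block_start \<mu> i < \<sigma> (block_start \<mu> i + k) \<and> \<sigma> (block_start \<mu> i + k) \<le> block_start \<mu> i
      + \<mu> i"
    unfolding std_obj_eq_iff[OF \<mu> i] .
  then show "block_component \<mu> \<sigma> i k \<in> {1..\<mu> i}"
    and "\<sigma> (block_start \<mu> i + k) = block_start \<mu> i + block_component \<mu> \<sigma> i k"
    by (auto simp: block_component_apply(1)[of k \<mu> i, OF k])
qed

lemma block_component_comp:
  assumes \<mu>: "\<mu> \<in> weights l d" and \<sigma>: "\<sigma> \<in> morphs d (std_obj l d \<mu>) (std_obj l d \<mu>)"
    and \<tau>: "\<tau> \<in> morphs d (std_obj l d \<mu>) (std_obj l d \<mu>)" and i: "i \<in> {1..l}"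
  shows "block_component \<mu> (\<sigma> \<circ> \<tau>) i = block_component \<mu> \<sigma> i \<circ> block_component \<mu> \<tau> i"
proof
  fix k
  show "block_component \<mu> (\<sigma> \<circ> \<tau>) i k = (block_component \<mu> \<sigma> i \<circ> block_component \<mu> \<tau> i) k"
  proof (cases "k \<in> {1..\<mu> i}")
    case True
    have "\<sigma> (\<tau> (block_start \<mu> i + k)) =
        block_start \<mu> i + block_component \<mu> \<sigma> i (block_component \<mu> \<tau> i k)"
      using std_aut_block(2)[OF \<mu> \<sigma> i std_aut_block(1)[OF \<mu> \<tau> i True]]
      by (simp only: std_aut_block(2)[OF \<mu> \<tau> i True])
    then show ?thesis
      by (simp only: block_component_apply(1)[of k \<mu> i "\<sigma> \<circ> \<tau>", OF True] o_apply diff_add_inverse)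
  next
    case False
    show ?thesis by (simp only: block_component_apply(2)[of k \<mu> i, OF False] o_apply)
  qed
qed

lemma block_component_id: "block_component \<mu> id i = id"
  by (rule ext) (simp add: block_component_def)

lemma block_component_permutes:
  assumes \<mu>: "\<mu> \<in> weights l d" and \<sigma>: "\<sigma> \<in> morphs d (std_obj l d \<mu>) (std_obj l d \<mu>)"
      and i: "i \<in> {1..l}"
  shows "block_component \<mu> \<sigma> i permutes {1..\<mu> i}"
proof (rule bij_imp_permutes)
  have inv: "inv \<sigma> \<in> morphs d (std_obj l d \<mu>) (std_obj l d \<mu>)" using \<sigma> by (rule morphs_inv)
  note cancel = inv_comp_cancel(1,2)[OF morphs_bij[OF \<sigma>]]
  have comp: "block_component \<mu> (inv \<sigma>) i (block_component \<mu> \<sigma> i k) = k"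
      "block_component \<mu> \<sigma> i (block_component \<mu> (inv \<sigma>) i k) = k" for k
    using fun_cong[OF block_component_comp[OF \<mu> inv \<sigma> i], of k]
      fun_cong[OF block_component_comp[OF \<mu> \<sigma> inv i], of k]
    by (simp_all add: cancel block_component_id)
  show "bij_betw (block_component \<mu> \<sigma> i) {1..\<mu> i} {1..\<mu> i}"
    using std_aut_block(1)[OF \<mu> \<sigma> i] std_aut_block(1)[OF \<mu> inv i] comp
    by (intro bij_betwI[where g = "block_component \<mu> (inv \<sigma>) i"]) auto
qed (rule block_component_apply(2))

text \<open>Injectivity of the identification with the product of symmetric groups: the blocks cover
  \<open>{1..d}\<close>, and a morphism fixes everything else.\<close>

lemma block_component_eq_id:
  assumes \<mu>: "\<mu> \<in> weights l d" and \<sigma>: "\<sigma> \<in> morphs d (std_obj l d \<mu>) (std_obj l d \<mu>)"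
    and id: "\<And>i. i \<in> {1..l} \<Longrightarrow> block_component \<mu> \<sigma> i = id"
  shows "\<sigma> = id"
proof
  fix k
  show "\<sigma> k = id k"
  proof (cases "k \<in> {1..d}")
    case True
    note pos = block_position[OF \<mu> True]
    show ?thesis using std_aut_block(2)[OF \<mu> \<sigma> pos(1,2)] id[OF pos(1)] pos(3) by simp
  next
    case False
    have "\<sigma> permutes {1..d}" using \<sigma> by (simp add: morphs_def)
    then show ?thesis using False permutes_not_in by fastforce
  qed
qed

text \<open>Surjectivity of the identification: each component acts on its own block, shifted by the
  offset of the block.\<close>

lemma block_component_surj:
  assumes \<mu>: "\<mu> \<in> weights l d" and s: "\<And>i. i \<in> {1..l} \<Longrightarrow> s i permutes {1..\<mu> i}"
  shows "\<exists>\<sigma>\<in>morphs d (std_obj l d \<mu>) (std_obj l d \<mu>). \<forall>i\<in>{1..l}. block_component \<mu> \<sigma> i = s i"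
proof -
  let ?f = "std_obj l d \<mu>"
  define \<sigma> where "\<sigma> k = (if k \<in> {1..d} then block_start \<mu> (?f k) + s (?f k) (k - block_start \<mu> (?f
      k)) else k)" for k
  have blk: "\<sigma> (block_start \<mu> i + k) = block_start \<mu> i + s i k" if "i \<in> {1..l}" "k \<in> {1..\<mu> i}"
      for i k
    using block_element[OF \<mu> that] by (simp add: \<sigma>_def)
  have sin: "s i k \<in> {1..\<mu> i}" if "i \<in> {1..l}" "k \<in> {1..\<mu> i}" for i k
    using permutes_in_image[OF s[OF that(1)]] that(2) by blast
  have \<sigma>in: "\<sigma> k \<in> {1..d} \<and> ?f (\<sigma> k) = ?f k" if k: "k \<in> {1..d}" for k
  proof -
    note pos = block_position[OF \<mu> k]
    have "\<sigma> k = block_start \<mu> (?f k) + s (?f k) (k - block_start \<mu> (?f k))" using k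
        by (simp add: \<sigma>_def)
    then show ?thesis using block_element[OF \<mu> pos(1) sin[OF pos(1,2)]] by simp
  qed
  have "inj_on \<sigma> {1..d}"
  proof (rule inj_onI)
    fix j k assume jk: "j \<in> {1..d}" "k \<in> {1..d}" "\<sigma> j = \<sigma> k"
    then have f: "?f j = ?f k" using \<sigma>in by metis
    note pj = block_position[OF \<mu> jk(1)] and pk = block_position[OF \<mu> jk(2)]
    have "s (?f k) (j - block_start \<mu> (?f k)) = s (?f k) (k - block_start \<mu> (?f k))"
      using jk f by (simp add: \<sigma>_def)
    then have "j - block_start \<mu> (?f k) = k - block_start \<mu> (?f k)"
      using permutes_inj[OF s[OF pk(1)]] by (simp add: inj_eq)
    then have "block_start \<mu> (?f j) + (j - block_start \<mu> (?f j)) =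
        block_start \<mu> (?f k) + (k - block_start \<mu> (?f k))"
      by (simp only: f)
    then show "j = k" by (simp only: pj(3) pk(3))
  qed
  moreover have "\<sigma> ` {1..d} \<subseteq> {1..d}" using \<sigma>in by blast
  ultimately have "bij_betw \<sigma> {1..d} {1..d}" by (intro bij_betw_imageI endo_inj_surj) auto
  then have "\<sigma> permutes {1..d}" by (rule bij_imp_permutes) (simp only: \<sigma>_def if_False)
  then have "\<sigma> \<in> morphs d ?f ?f" using \<sigma>in by (simp add: morphs_def)
  moreover have "block_component \<mu> \<sigma> i = s i" if i: "i \<in> {1..l}" for i
  proof
    fix k
    show "block_component \<mu> \<sigma> i k = s i k"
    proof (cases "k \<in> {1..\<mu> i}")
      case True
      show ?thesis by (simp only: block_component_apply(1)[of k \<mu> i, OF True] blk[OF i True]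
          diff_add_inverse)
    next
      case False
      show ?thesis using permutes_not_in[OF s[OF i] False]
          by (simp only: block_component_apply(2)[of k \<mu> i, OF False])
    qed
  qed
  ultimately show ?thesis by blast
qed

section \<open>Composition in the linearized groupoid\<close>

text \<open>Evaluates the linear extension of a function \<open>F\<close> of morphisms on a
  composite; \<open>F\<close> will be the action on a vector, evaluated at a point.\<close>

lemma sum_lin_comp:
  "(\<Sum>\<tau>\<in>morphs d f h. lin_comp d f g h b a \<tau> * F \<tau>) =
    (\<Sum>\<rho>\<in>morphs d g h. \<Sum>\<sigma>\<in>morphs d f g. b \<rho> * a \<sigma> * F (\<rho> \<circ> \<sigma>))"
proof -
  have "(\<Sum>\<tau>\<in>morphs d f h. lin_comp d f g h b a \<tau> * F \<tau>) =
      (\<Sum>\<tau>\<in>morphs d f h. \<Sum>\<rho>\<in>morphs d g h. \<Sum>\<sigma>\<in>morphs d f g. b \<rho> * a \<sigma> * basis_morph (\<rho> \<circ> \<sigma>) \<tau> * F \<tau>)"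
    unfolding lin_comp_def sum_fun_apply sum_distrib_right ..
  also have "\<dots> = (\<Sum>\<rho>\<in>morphs d g h. \<Sum>\<sigma>\<in>morphs d f g. \<Sum>\<tau>\<in>morphs d f h. b \<rho> * a \<sigma> * basis_morph (\<rho> \<circ>
      \<sigma>) \<tau> * F \<tau>)"
    by (subst sum.swap, rule sum.cong[OF refl], rule sum.swap)
  also have "\<dots> = (\<Sum>\<rho>\<in>morphs d g h. \<Sum>\<sigma>\<in>morphs d f g. b \<rho> * a \<sigma> * F (\<rho> \<circ> \<sigma>))"
  proof (intro sum.cong refl)
    fix \<rho> \<sigma> assume "\<rho> \<in> morphs d g h" "\<sigma> \<in> morphs d f g"
    then have mem: "\<rho> \<circ> \<sigma> \<in> morphs d f h" by (intro morphs_comp)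
    have "(\<Sum>\<tau>\<in>morphs d f h. b \<rho> * a \<sigma> * basis_morph (\<rho> \<circ> \<sigma>) \<tau> * F \<tau>) =
        (\<Sum>\<tau>\<in>morphs d f h. if \<tau> = \<rho> \<circ> \<sigma> then b \<rho> * a \<sigma> * F (\<rho> \<circ> \<sigma>) else 0)"
      by (intro sum.cong) (auto simp: basis_morph_def)
    then show "(\<Sum>\<tau>\<in>morphs d f h. b \<rho> * a \<sigma> * basis_morph (\<rho> \<circ> \<sigma>) \<tau> * F \<tau>) = b \<rho> * a \<sigma> * F (\<rho> \<circ> \<sigma>)"
      using mem finite_morphs by simp
  qed
  finally show ?thesis .
qed

lemma basis_morph_in_lin_morphs: "\<sigma> \<in> morphs d f g \<Longrightarrow> basis_morph \<sigma> \<in> lin_morphs d f g"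
  by (auto simp: lin_morphs_def basis_morph_def)

lemma sum_basis_morph:
  assumes "\<sigma> \<in> morphs d f g"
  shows "(\<Sum>\<pi>\<in>morphs d f g. basis_morph \<sigma> \<pi> * F \<pi>) = F \<sigma>"
proof -
  have "(\<Sum>\<pi>\<in>morphs d f g. basis_morph \<sigma> \<pi> * F \<pi>) = (\<Sum>\<pi>\<in>morphs d f g. if \<pi> = \<sigma> then F \<sigma> else 0)"
    by (intro sum.cong) (auto simp: basis_morph_def)
  then show ?thesis using assms finite_morphs by simp
qed

lemma lin_comp_in_lin_morphs: "lin_comp d f g h b a \<in> lin_morphs d f h"
  unfolding lin_morphs_def lin_comp_def sum_fun_apply
proof (intro CollectI allI impI sum.neutral ballI)
  fix \<tau> \<rho> \<sigma> assume "\<tau> \<notin> morphs d f h" "\<rho> \<in> morphs d g h" "\<sigma> \<in> morphs d f g"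
  then have "\<tau> \<noteq> \<rho> \<circ> \<sigma>" using morphs_comp by blast
  then show "b \<rho> * a \<sigma> * basis_morph (\<rho> \<circ> \<sigma>) \<tau> = 0" by (simp add: basis_morph_def)
qed

text \<open>In a groupoid a factorization of \<open>\<tau>\<close> is determined by its left factor
  \<open>\<rho>\<close>.\<close>

lemma lin_comp_apply:
  assumes \<tau>: "\<tau> \<in> morphs d f h"
  shows "lin_comp d f g h b a \<tau> = (\<Sum>\<rho>\<in>morphs d g h. b \<rho> * a (inv \<rho> \<circ> \<tau>))"
  unfolding lin_comp_def sum_fun_apply
proof (intro sum.cong refl)
  fix \<rho> assume \<rho>: "\<rho> \<in> morphs d g h"
  then have mem: "inv \<rho> \<circ> \<tau> \<in> morphs d f g" using \<tau> by (intro morphs_comp[OF \<tau>] morphs_inv)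
  have "\<tau> = \<rho> \<circ> \<sigma> \<longleftrightarrow> \<sigma> = inv \<rho> \<circ> \<tau>" for \<sigma>
    using inv_comp_cancel(3,4)[OF morphs_bij[OF \<rho>]] by metis
  then have "(\<Sum>\<sigma>\<in>morphs d f g. b \<rho> * a \<sigma> * basis_morph (\<rho> \<circ> \<sigma>) \<tau>) =
      (\<Sum>\<sigma>\<in>morphs d f g. if \<sigma> = inv \<rho> \<circ> \<tau> then b \<rho> * a (inv \<rho> \<circ> \<tau>) else 0)"
    by (intro sum.cong) (auto simp: basis_morph_def)
  then show "(\<Sum>\<sigma>\<in>morphs d f g. b \<rho> * a \<sigma> * basis_morph (\<rho> \<circ> \<sigma>) \<tau>) = b \<rho> * a (inv \<rho> \<circ> \<tau>)"
    using mem finite_morphs by simp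
qed

section \<open>The modules attached to multipartitions\<close>

text \<open>The retraction of the groupoid of objects of type \<open>\<mu>\<close> onto the
  automorphism group of its standard object. It is functorial because the two
  \<open>sigma_morph\<close> between an object and the standard object are mutually inverse.\<close>

definition normalize_morph ::
    "nat \<Rightarrow> nat \<Rightarrow> (nat \<Rightarrow> nat) \<Rightarrow> (nat \<Rightarrow> nat) \<Rightarrow> (nat \<Rightarrow> nat) \<Rightarrow> (nat \<Rightarrow> nat) \<Rightarrow> nat \<Rightarrow> nat" where
  "normalize_morph l d \<mu> f g \<pi> = sigma_morph d g (std_obj l d \<mu>) \<circ> \<pi> \<circ> sigma_morph d (std_obj l d
      \<mu>) f"

lemma L_morph_eq:
  "L_morph l d \<mu> f g \<pi> v = specht_tensor_act (block_component \<mu> (normalize_morph l d \<mu> f g \<pi>)) v"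
  by (simp only: L_morph_def normalize_morph_def)

lemma sigma_to_std:
  assumes "\<mu> \<in> weights l d" "f \<in> objs l d" "type_of_obj l d f = \<mu>"
  shows "sigma_morph d f (std_obj l d \<mu>) \<in> morphs d f (std_obj l d \<mu>)"
    and "sigma_morph d (std_obj l d \<mu>) f \<in> morphs d (std_obj l d \<mu>) f"
    and "sigma_morph d f (std_obj l d \<mu>) = inv (sigma_morph d (std_obj l d \<mu>) f)"
  using sigma_morph(1)[OF assms(2) std_obj(1)[OF assms(1)]] sigma_morph(1)[OF std_obj(1)[OF
      assms(1)] assms(2)]
    sigma_morph_inverse[OF std_obj(1)[OF assms(1)] assms(2)] std_obj(2)[OF assms(1)] assms(3)
  by simp_all

lemma normalize_morph_in:
  assumes "\<mu> \<in> weights l d" "f \<in> objs l d" "type_of_obj l d f =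
      \<mu>" "g \<in> objs l d" "type_of_obj l d g = \<mu>"
    and "\<pi> \<in> morphs d f g"
  shows "normalize_morph l d \<mu> f g \<pi> \<in> morphs d (std_obj l d \<mu>) (std_obj l d \<mu>)"
  unfolding normalize_morph_def
  using sigma_to_std[OF assms(1-3)] sigma_to_std[OF assms(1,4,5)] assms(6)
      by (blast intro: morphs_comp)

lemma normalize_morph_comp:
  assumes "\<mu> \<in> weights l d" "g \<in> objs l d" "type_of_obj l d g = \<mu>"
  shows "normalize_morph l d \<mu> f h (\<rho> \<circ> \<sigma>) =
      normalize_morph l d \<mu> g h \<rho> \<circ> normalize_morph l d \<mu> f g \<sigma>"
proof -
  let ?s = "sigma_morph d (std_obj l d \<mu>) g"
  have bij: "bij ?s" by (rule morphs_bij[OF sigma_to_std(2)[OF assms]])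
  have "?s (sigma_morph d g (std_obj l d \<mu>) x) = x" for x
    unfolding sigma_to_std(3)[OF assms] using bij by (simp add: bij_is_surj surj_f_inv_f)
  then show ?thesis by (simp add: normalize_morph_def fun_eq_iff)
qed

lemma normalize_morph_id:
  assumes "\<mu> \<in> weights l d" "f \<in> objs l d" "type_of_obj l d f = \<mu>"
  shows "normalize_morph l d \<mu> f f id = id"
  unfolding normalize_morph_def sigma_to_std(3)[OF assms]
  using inv_comp_cancel(1)[OF morphs_bij[OF sigma_to_std(2)[OF assms]]] by (simp only: comp_id)

lemma normalize_morph_std: "normalize_morph l d \<mu> (std_obj l d \<mu>) (std_obj l d \<mu>) \<sigma> = \<sigma>"
  by (simp add: normalize_morph_def sigma_morph_self)

lemma L_morph_closed:
  assumes "\<mu> \<in> weights l d" "p \<in> multipartitions l \<mu>" "f \<in> objs l d" "type_of_obj l d f = \<mu>"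
    and "g \<in> objs l d" "type_of_obj l d g = \<mu>" "\<pi> \<in> morphs d f g" "v \<in> specht_tensor l p"
  shows "L_morph l d \<mu> f g \<pi> v \<in> specht_tensor l p"
  unfolding L_morph_eq
  by (rule specht_tensor_act_closed[OF assms(2) _ assms(8)])
    (rule block_component_permutes[OF assms(1) normalize_morph_in[OF assms(1,3-7)]])

lemma L_morph_comp:
  assumes \<mu>: "\<mu> \<in> weights l d" and p: "p \<in> multipartitions l \<mu>"
    and f: "f \<in> objs l d" "type_of_obj l d f = \<mu>" and g: "g \<in> objs l d" "type_of_obj l d g = \<mu>"
    and h: "h \<in> objs l d" "type_of_obj l d h = \<mu>"
    and \<sigma>: "\<sigma> \<in> morphs d f g" and \<rho>: "\<rho> \<in> morphs d g h" and v: "v \<in> specht_tensor l p"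
  shows "L_morph l d \<mu> f h (\<rho> \<circ> \<sigma>) v = L_morph l d \<mu> g h \<rho> (L_morph l d \<mu> f g \<sigma> v)"
proof -
  let ?\<rho> = "normalize_morph l d \<mu> g h \<rho>" and ?\<sigma> = "normalize_morph l d \<mu> f g \<sigma>"
  have "specht_tensor_act (block_component \<mu> (?\<rho> \<circ> ?\<sigma>)) v =
      specht_tensor_act (\<lambda>i. block_component \<mu> ?\<rho> i \<circ> block_component \<mu> ?\<sigma> i) v"
    using block_component_comp[OF \<mu> normalize_morph_in[OF \<mu> g h \<rho>] normalize_morph_in[OF \<mu> f g \<sigma>]]
    by (intro specht_tensor_act_cong[OF v])
  then show ?thesis
    by (simp only: L_morph_eq normalize_morph_comp[OF \<mu> g] specht_tensor_act_comp)
qed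

lemma L_morph_linear:
  "L_morph l d \<mu> f g \<pi> (\<lambda>x. u x + v x) = (\<lambda>x. L_morph l d \<mu> f g \<pi> u x + L_morph l d \<mu> f g \<pi> v x)"
  "L_morph l d \<mu> f g \<pi> (\<lambda>x. c * u x) = (\<lambda>x. c * L_morph l d \<mu> f g \<pi> u x)"
  "L_morph l d \<mu> f g \<pi> (\<lambda>x. \<Sum>a\<in>A. c' a * w a x) = (\<lambda>x. \<Sum>a\<in>A. c' a * L_morph l d \<mu> f g \<pi> (w a) x)"
  by (simp_all add: L_morph_def specht_tensor_act_def)

lemma L_module_space:
  "type_of_obj l d f = \<mu> \<Longrightarrow> space_at (L_module l d \<mu> p) f = fun_space (specht_tensor l p)"
  "type_of_obj l d f \<noteq> \<mu> \<Longrightarrow> space_at (L_module l d \<mu> p) f = fun_space {\<lambda>_. 0}"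
  by (simp_all add: L_module_def L_space_def cfun_zero_fun)

lemma L_module_map:
  "type_of_obj l d f = \<mu> \<Longrightarrow> type_of_obj l d g = \<mu> \<Longrightarrow>
    map_at (L_module l d \<mu> p) f g a v = (\<lambda>x. \<Sum>\<pi>\<in>morphs d f g. a \<pi> * L_morph l d \<mu> f g \<pi> v x)"
  "type_of_obj l d f \<noteq> \<mu> \<or> type_of_obj l d g \<noteq> \<mu> \<Longrightarrow> map_at (L_module l d \<mu> p) f g a v = (\<lambda>_. 0)"
  by (auto simp: L_module_def fun_eq_iff sum_fun_apply)

lemma L_module_basis_morph:
  assumes "type_of_obj l d f = \<mu>" "type_of_obj l d g = \<mu>" "\<sigma> \<in> morphs d f g"
  shows "map_at (L_module l d \<mu> p) f g (basis_morph \<sigma>) v = L_morph l d \<mu> f g \<sigma> v"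
  unfolding L_module_map(1)[OF assms(1,2)] by (rule ext) (rule sum_basis_morph[OF assms(3)])

lemma morphs_empty_if_types_differ:
  "type_of_obj l d f \<noteq> type_of_obj l d g \<Longrightarrow> morphs d f g = {}"
  using type_of_obj_eq_if_morph by blast

lemma L_module_zero_mem:
  "(\<lambda>_. 0) \<in> carrier (space_at (L_module l d \<mu> p) f)"
  using cfun_subspaceD(1)[OF subspace_specht_tensor, of l p]
  by (cases "type_of_obj l d f = \<mu>") (simp_all add: L_module_space)

lemma L_module_add_smult:
  "u \<oplus>\<^bsub>space_at (L_module l d \<mu> p) f\<^esub> v = (\<lambda>x. u x + v x)"
  "c \<odot>\<^bsub>space_at (L_module l d \<mu> p) f\<^esub> u = (\<lambda>x. c * u x)"
  "\<zero>\<^bsub>space_at (L_module l d \<mu> p) f\<^esub> = (\<lambda>_. 0)"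
  by (cases "type_of_obj l d f = \<mu>", simp_all only: L_module_space fun_space_simps
      not_False_eq_True)+

lemma L_module_map_closed:
  assumes \<mu>: "\<mu> \<in> weights l d" and p: "p \<in> multipartitions l \<mu>" and f: "f \<in> objs l d"
      and g: "g \<in> objs l d"
    and v: "v \<in> carrier (space_at (L_module l d \<mu> p) f)"
  shows "map_at (L_module l d \<mu> p) f g a v \<in> carrier (space_at (L_module l d \<mu> p) g)"
proof (cases "type_of_obj l d f = \<mu> \<and> type_of_obj l d g = \<mu>")
  case True
  then have "v \<in> specht_tensor l p" using v by (simp add: L_module_space)
  then have "(\<lambda>x. \<Sum>\<pi>\<in>morphs d f g. a \<pi> * L_morph l d \<mu> f g \<pi> v x) \<in> specht_tensor l p"
    using L_morph_closed[OF \<mu> p f _ g] True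
        by (intro cfun_subspace_lincomb subspace_specht_tensor) blast
  then show ?thesis using True by (simp add: L_module_space L_module_map)
next
  case False
  then have "map_at (L_module l d \<mu> p) f g a v = (\<lambda>_. 0)" by (intro L_module_map(2)) blast
  then show ?thesis by (simp only: L_module_zero_mem)
qed

lemma fd_vspace_specht_tensor:
  assumes "p \<in> multipartitions l \<mu>"
  shows "fd_vspace (fun_space (specht_tensor l p))"
  unfolding specht_tensor_eq_span[OF assms]
  by (rule fd_vspace_fun_space) (rule finite_imageI[OF finite_component_perms])

lemma fd_vspace_zero: "fd_vspace (fun_space {\<lambda>_. 0})"
proof -
  have span: "{\<lambda>_::'a. 0} = cfun.span {}" by (simp add: cfun.span_empty cfun_zero_fun)
  show ?thesis unfolding span by (rule fd_vspace_fun_space) (rule finite.emptyI)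
qed

lemma is_cg_module_L:
  assumes \<mu>: "\<mu> \<in> weights l d" and p: "p \<in> multipartitions l \<mu>"
  shows "is_cg_module l d (L_module l d \<mu> p)"
  unfolding is_cg_module_def
proof (intro conjI ballI allI)
  let ?L = "L_module l d \<mu> p"
  fix f assume f: "f \<in> objs l d"
  show "fd_vspace (space_at ?L f)"
    by (cases "type_of_obj l d f = \<mu>")
      (simp_all only: L_module_space fd_vspace_specht_tensor[OF p] fd_vspace_zero not_False_eq_True)
  show "map_at ?L f f (basis_morph id) v = v" if v: "v \<in> carrier (space_at ?L f)" for v
  proof (cases "type_of_obj l d f = \<mu>")
    case True
    then have "v \<in> specht_tensor l p" using v by (simp add: L_module_space)
    then have "specht_tensor_act (block_component \<mu> id) v = v"
      by (rule specht_tensor_act_id) (rule block_component_id)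
    then show ?thesis
      by (simp only: L_module_basis_morph[OF True True id_in_morphs] L_morph_eq
          normalize_morph_id[OF \<mu> f True])
  next
    case False
    then have "v = (\<lambda>_. 0)" using v by (simp add: L_module_space)
    then show ?thesis using False by (simp add: L_module_map(2))
  qed
  fix g assume g: "g \<in> objs l d"
  show "map_at ?L f g a \<in> lin_maps (space_at ?L f) (space_at ?L g)" for a
    unfolding lin_maps_def L_module_add_smult
  proof (intro CollectI conjI ballI allI Pi_I)
    fix u v
    show "map_at ?L f g a u \<in> carrier (space_at ?L g)" if "u \<in> carrier (space_at ?L f)"
      by (rule L_module_map_closed[OF \<mu> p f g that])
    show "map_at ?L f g a (\<lambda>x. u x + v x) = (\<lambda>x. map_at ?L f g a u x + map_at ?L f g a v x)"
      by (cases "type_of_obj l d f = \<mu> \<and> type_of_obj l d g = \<mu>")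
        (auto simp: L_module_map L_morph_linear(1) distrib_left sum.distrib)
    show "map_at ?L f g a (\<lambda>x. c * u x) = (\<lambda>x. c * map_at ?L f g a u x)" for c
      by (cases "type_of_obj l d f = \<mu> \<and> type_of_obj l d g = \<mu>")
        (auto simp: L_module_map L_morph_linear(2) sum_distrib_left mult_ac)
  qed
  show "map_at ?L f g (a + b) v = map_at ?L f g a v \<oplus>\<^bsub>space_at ?L g\<^esub> map_at ?L f g b v" for a b v
    unfolding L_module_add_smult
    by (cases "type_of_obj l d f = \<mu> \<and> type_of_obj l d g = \<mu>")
      (auto simp: L_module_map distrib_right sum.distrib)
  show "map_at ?L f g (\<lambda>\<sigma>. c * a \<sigma>) v = c \<odot>\<^bsub>space_at ?L g\<^esub> map_at ?L f g a v" for c a v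
    unfolding L_module_add_smult
    by (cases "type_of_obj l d f = \<mu> \<and> type_of_obj l d g = \<mu>")
      (auto simp: L_module_map sum_distrib_left mult_ac)
  fix h a b v assume h: "h \<in> objs l d" and v: "v \<in> carrier (space_at ?L f)"
  show "map_at ?L f h (lin_comp d f g h b a) v = map_at ?L g h b (map_at ?L f g a v)"
  proof (cases "type_of_obj l d f = \<mu> \<and> type_of_obj l d h = \<mu>")
    case True
    then have tf: "type_of_obj l d f = \<mu>" and th: "type_of_obj l d h = \<mu>" by auto
    have v': "v \<in> specht_tensor l p" using v tf by (simp add: L_module_space)
    have eq: "map_at ?L f h (lin_comp d f g h b a) v =
        (\<lambda>x. \<Sum>\<rho>\<in>morphs d g h. \<Sum>\<sigma>\<in>morphs d f g. b \<rho> * a \<sigma> * L_morph l d \<mu> f h (\<rho> \<circ> \<sigma>) v x)"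
      unfolding L_module_map(1)[OF tf th] sum_lin_comp ..
    show ?thesis
    proof (cases "type_of_obj l d g = \<mu>")
      case tg: True
      have "(\<lambda>x. \<Sum>\<rho>\<in>morphs d g h. \<Sum>\<sigma>\<in>morphs d f g. b \<rho> * a \<sigma> * L_morph l d \<mu> f h (\<rho> \<circ> \<sigma>) v x) =
          (\<lambda>x. \<Sum>\<rho>\<in>morphs d g h. b \<rho> * (\<Sum>\<sigma>\<in>morphs d f g. a \<sigma> * L_morph l d \<mu> g h \<rho> (L_morph l d \<mu> f
              g \<sigma> v) x))"
        unfolding sum_distrib_left mult.assoc
        using L_morph_comp[OF \<mu> p f tf g tg h th _ _ v'] by (intro ext sum.cong refl) simp
      then show ?thesis
        unfolding eq by (simp only: L_module_map(1)[OF tf tg] L_module_map(1)[OF tg th]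
            L_morph_linear(3))
    next
      case False
      \<comment> \<open>An intermediate object of another type receives no morphism from
        \<open>f\<close>, so the double sum is empty.\<close>
      then have "morphs d f g = {}" using morphs_empty_if_types_differ tf by metis
      then show ?thesis unfolding eq using False by (simp add: L_module_map(2))
    qed
  next
    case False
    have zero: "map_at ?L g h b (\<lambda>_. 0) = (\<lambda>_. 0)"
    proof -
      have "L_morph l d \<mu> g h \<pi> (\<lambda>_. 0) = (\<lambda>_. 0)" for \<pi>
          by (simp add: L_morph_def specht_tensor_act_def)
      then show ?thesis
        by (cases "type_of_obj l d g = \<mu> \<and> type_of_obj l d h = \<mu>") (auto simp: L_module_map)
    qed
    have lhs: "map_at ?L f h (lin_comp d f g h b a) v = (\<lambda>_. 0)" using False
        by (intro L_module_map(2)) blast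
    show ?thesis
    proof (cases "type_of_obj l d f = \<mu>")
      case True
      then have "map_at ?L g h b w = (\<lambda>_. 0)" for w using False by (intro L_module_map(2)) blast
      then show ?thesis by (simp only: lhs)
    next
      case f_False: False
      then have "map_at ?L f g a v = (\<lambda>_. 0)" by (intro L_module_map(2)) blast
      then show ?thesis by (simp only: lhs zero)
    qed
  qed
qed

definition base_vector :: "nat \<Rightarrow> (nat \<Rightarrow> nat list) \<Rightarrow> (nat \<Rightarrow> nat \<Rightarrow> nat set) \<Rightarrow> complex" where
  "base_vector l p = tableau_tensor l p (base_tableaux p)"

lemma base_vector_mem: "base_vector l p \<in> specht_tensor l p"
  unfolding base_vector_def by (rule tableau_tensor_in_specht_tensor) (simp add: base_tableaux_def
      base_tableau)

lemma base_vector_nonzero: "base_vector l p \<noteq> (\<lambda>_. 0)"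
proof
  assume "base_vector l p = (\<lambda>_. 0)"
  then have "tensor_form l p (base_vector l p) (base_vector l p) = 0" by (simp add: tensor_form_def)
  then show False
    using tensor_form_tableau_tensor_nonzero[of l "base_tableaux p" p]
    by (simp add: base_vector_def base_tableaux_def base_tableau)
qed

text \<open>Irreducibility of the Specht tensor space settles the standard object. The morphisms
  \<open>sigma_morph\<close> to and from it act as the identity of that space, so a submodule has
  literally the same value at all objects of type \<open>\<mu>\<close>.\<close>

lemma simple_L_module:
  assumes \<mu>: "\<mu> \<in> weights l d" and p: "p \<in> multipartitions l \<mu>"
  shows "simple_cg_module l d (L_module l d \<mu> p)"
  unfolding simple_cg_module_def
proof (intro conjI allI impI)
  let ?L = "L_module l d \<mu> p" and ?f = "std_obj l d \<mu>"
  note f0 = std_obj(1,2)[OF \<mu>]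
  show "is_cg_module l d ?L" by (rule is_cg_module_L[OF \<mu> p])
  show "\<exists>f\<in>objs l d. carrier (space_at ?L f) \<noteq> {\<zero>\<^bsub>space_at ?L f\<^esub>}"
  proof (rule bexI[OF _ f0(1)])
    show "carrier (space_at ?L ?f) \<noteq> {\<zero>\<^bsub>space_at ?L ?f\<^esub>}"
      using base_vector_mem[of l p] base_vector_nonzero[of l p]
          unfolding L_module_space(1)[OF f0(2)] by auto
  qed
  fix N assume N: "cg_submodule l d N ?L"
  have sub: "submodule (N f) complex_field (space_at ?L f)" if "f \<in> objs l d" for f
    using N that unfolding cg_submodule_def by blast
  have stable: "map_at ?L f g a w \<in> N g"
    if "f \<in> objs l d" "g \<in> objs l d" "a \<in> lin_morphs d f g" "w \<in> N f" for f g a w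
    using N that unfolding cg_submodule_def by blast
  have U: "cfun.subspace (N ?f)" "N ?f \<subseteq> specht_tensor l p"
    using submodule_fun_space_subspace[of "N ?f" "specht_tensor l p"] sub[OF f0(1)]
    by (simp_all only: L_module_space(1)[OF f0(2)])
  have act: "specht_tensor_act s w \<in> N ?f"
    if s: "\<And>i. i \<in> {1..l} \<Longrightarrow> s i permutes {1..\<mu> i}" and w: "w \<in> N ?f" for s w
  proof -
    \<comment> \<open>Every family of block permutations is realized by an automorphism, so
      stability under morphisms is stability under the whole product group.\<close>
    obtain \<sigma> where \<sigma>: "\<sigma> \<in> morphs d ?f ?f" "\<And>i. i \<in> {1..l} \<Longrightarrow> block_component \<mu> \<sigma> i = s i"
      using block_component_surj[OF \<mu> s] by blast
    have "map_at ?L ?f ?f (basis_morph \<sigma>) w \<in> N ?f"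
      by (rule stable[OF f0(1) f0(1) basis_morph_in_lin_morphs[OF \<sigma>(1)] w])
    also have "map_at ?L ?f ?f (basis_morph \<sigma>) w = specht_tensor_act (block_component \<mu> \<sigma>) w"
      by (simp only: L_module_basis_morph[OF f0(2) f0(2) \<sigma>(1)] L_morph_eq normalize_morph_std)
    also have "\<dots> = specht_tensor_act s w"
      by (rule specht_tensor_act_cong) (use w U(2) \<sigma>(2) in blast)+
    finally show ?thesis .
  qed
  have U_cases: "N ?f = {\<lambda>_. 0} \<or> N ?f = specht_tensor l p"
  proof (cases "\<exists>w\<in>N ?f. w \<noteq> (\<lambda>_. 0)")
    case True
    then obtain w where "w \<in> N ?f" "w \<noteq> (\<lambda>_. 0)" by blast
    then show ?thesis using specht_tensor_irreducible[OF p U act] by blast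
  next
    case False
    then show ?thesis using cfun_subspaceD(1)[OF U(1)] by blast
  qed
  have transport: "w \<in> N g" if fg: "f \<in> objs l d" "type_of_obj l d f =
      \<mu>" "g \<in> objs l d" "type_of_obj l d g = \<mu>"
      and \<pi>: "\<pi> \<in> morphs d f g" "normalize_morph l d \<mu> f g \<pi> = id" and w: "w \<in> N f" for f g \<pi> w
  proof -
    have "w \<in> specht_tensor l p"
      using submodule_zero_closed(1)[OF sub[OF fg(1)]] w by (auto simp: L_module_space(1)[OF fg(2)])
    then have "specht_tensor_act (block_component \<mu> id) w = w"
      by (rule specht_tensor_act_id) (rule block_component_id)
    then have "map_at ?L f g (basis_morph \<pi>) w = w"
      by (simp only: L_module_basis_morph[OF fg(2,4) \<pi>(1)] L_morph_eq \<pi>(2))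
    then show ?thesis using stable[OF fg(1,3) basis_morph_in_lin_morphs[OF \<pi>(1)] w] by simp
  qed
  have N_eq: "N f = N ?f" if f: "f \<in> objs l d" "type_of_obj l d f = \<mu>" for f
  proof -
    note \<sigma> = sigma_to_std[OF \<mu> f]
    note bij = morphs_bij[OF \<sigma>(2)]
    have "normalize_morph l d \<mu> f ?f (sigma_morph d f ?f) =
        id" "normalize_morph l d \<mu> ?f f (sigma_morph d ?f f) = id"
      unfolding normalize_morph_def sigma_morph_self \<sigma>(3) comp_id id_comp
      by (rule inv_comp_cancel(1)[OF bij])+
    then show ?thesis
      using transport[OF f f0 \<sigma>(1)] transport[OF f0 f \<sigma>(2)] by blast
  qed
  have N_zero: "N f = {\<lambda>_. 0} \<and> carrier (space_at ?L f) = {\<lambda>_. 0}"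
    if f: "f \<in> objs l d" "type_of_obj l d f \<noteq> \<mu>" for f
    using submodule_zero_closed[OF sub[OF f(1)]] unfolding L_module_add_smult
    by (auto simp: L_module_space(2)[OF f(2)])
  from U_cases
  show "(\<forall>f\<in>objs l d. N f = {\<zero>\<^bsub>space_at ?L f\<^esub>}) \<or> (\<forall>f\<in>objs l d. N f = carrier (space_at ?L f))"
  proof
    assume "N ?f = {\<lambda>_. 0}"
    then have "N f = {\<lambda>_. 0}" if "f \<in> objs l d" for f
      using N_eq[OF that] N_zero[OF that] by (cases "type_of_obj l d f = \<mu>") simp_all
    then show ?thesis by (simp add: L_module_add_smult(3))
  next
    assume full: "N ?f = specht_tensor l p"
    have "N f = carrier (space_at ?L f)" if "f \<in> objs l d" for f
    proof (cases "type_of_obj l d f = \<mu>")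
      case True
      then show ?thesis using N_eq[OF that True] full by (simp add: L_module_space(1)[OF True])
    next
      case False
      then show ?thesis using N_zero[OF that False] by simp
    qed
    then show ?thesis by blast
  qed
qed

section \<open>Uniqueness\<close>

lemma L_module_hom_base_vector:
  assumes \<mu>: "\<mu> \<in> weights l d" and p: "p \<in> multipartitions l \<mu>" and q: "q \<in> multipartitions l \<mu>"
    and i: "i \<in> {1..l}" "p i \<noteq> q i" "row_weight (q i) \<le> row_weight (p i)"
    and \<eta>: "\<eta> \<in> cg_hom l d (L_module l d \<mu> p) (L_module l d \<mu> q)"
  shows "\<eta> (std_obj l d \<mu>) (base_vector l p) = (\<lambda>_. 0)"
  unfolding base_vector_def
proof (rule specht_tensor_hom_eq_0[OF p q i])
  let ?f = "std_obj l d \<mu>" and ?L = "L_module l d \<mu> p" and ?M = "L_module l d \<mu> q"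
  note f0 = std_obj(1,2)[OF \<mu>]
  have lin: "\<eta> ?f \<in> lin_maps (fun_space (specht_tensor l p)) (fun_space (specht_tensor l q))"
    using cg_homD(1)[OF \<eta> f0(1)] by (simp only: L_module_space(1)[OF f0(2)])
  show "\<eta> ?f u \<in> specht_tensor l q" if "u \<in> specht_tensor l p" for u
    using lin_mapsD(1)[OF lin, of u] that by simp
  show "\<eta> ?f (\<lambda>x. u x + v x) = (\<lambda>y. \<eta> ?f u y + \<eta> ?f v y)"
    if "u \<in> specht_tensor l p" "v \<in> specht_tensor l p" for u v
    using lin_mapsD(2)[OF lin, of u v] that by simp
  show "\<eta> ?f (\<lambda>x. c * u x) = (\<lambda>y. c * \<eta> ?f u y)" if "u \<in> specht_tensor l p" for c u
    using lin_mapsD(3)[OF lin, of u c] that by simp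
  fix s w assume s: "\<And>i. i \<in> {1..l} \<Longrightarrow> s i permutes {1..\<mu> i}" and w: "w \<in> specht_tensor l p"
  obtain \<sigma> where \<sigma>: "\<sigma> \<in> morphs d ?f ?f" "\<And>i. i \<in> {1..l} \<Longrightarrow> block_component \<mu> \<sigma> i = s i"
    using block_component_surj[OF \<mu> s] by blast
  have act: "map_at (L_module l d \<mu> r) ?f ?f (basis_morph \<sigma>) u = specht_tensor_act s u"
    if "u \<in> specht_tensor l r" for r u
    unfolding L_module_basis_morph[OF f0(2) f0(2) \<sigma>(1)] L_morph_eq normalize_morph_std
    by (rule specht_tensor_act_cong[OF that \<sigma>(2)])
  have "\<eta> ?f (map_at ?L ?f ?f (basis_morph \<sigma>) w) = map_at ?M ?f ?f (basis_morph \<sigma>) (\<eta> ?f w)"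
    using w by (intro cg_homD(2)[OF \<eta> f0(1) f0(1) basis_morph_in_lin_morphs[OF \<sigma>(1)]])
      (simp add: L_module_space(1)[OF f0(2)])
  moreover have "\<eta> ?f w \<in> specht_tensor l q" using lin_mapsD(1)[OF lin, of w] w by simp
  ultimately show "\<eta> ?f (specht_tensor_act s w) = specht_tensor_act s (\<eta> ?f w)"
    using act[OF w] act[of "\<eta> ?f w" q] by simp
qed

text \<open>The test vector for refuting isomorphisms: its image cannot vanish, since the inverse
  recovers a nonzero vector from it.\<close>

lemma L_module_iso_base_vector:
  assumes \<mu>: "\<mu> \<in> weights l d" and p: "p \<in> multipartitions l \<mu>" and N: "is_cg_module l d N"
    and iso: "cg_isomorphic l d (L_module l d \<mu> p) N"
  obtains \<eta> where "\<eta> \<in> cg_hom l d (L_module l d \<mu> p) N"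
    and "\<eta> (std_obj l d \<mu>) (base_vector l p) \<in> carrier (space_at N (std_obj l d \<mu>))"
    and "\<eta> (std_obj l d \<mu>) (base_vector l p) \<noteq> \<zero>\<^bsub>space_at N (std_obj l d \<mu>)\<^esub>"
proof -
  let ?L = "L_module l d \<mu> p" and ?f = "std_obj l d \<mu>" and ?e = "base_vector l p"
  note f0 = std_obj(1,2)[OF \<mu>]
  obtain \<eta> \<theta> where \<eta>: "\<eta> \<in> cg_hom l d ?L N" "\<theta> \<in> cg_hom l d N ?L"
    "\<And>f v. f \<in> objs l d \<Longrightarrow> v \<in> carrier (space_at ?L f) \<Longrightarrow> \<theta> f (\<eta> f v) = v"
    using iso unfolding cg_isomorphic_def by blast
  have e: "?e \<in> carrier (space_at ?L ?f)"
    using base_vector_mem by (simp add: L_module_space(1)[OF f0(2)])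
  show thesis
  proof (rule that[OF \<eta>(1) lin_mapsD(1)[OF cg_homD(1)[OF \<eta>(1) f0(1)] e]], rule notI)
    assume "\<eta> ?f ?e = \<zero>\<^bsub>space_at N ?f\<^esub>"
    then have "?e = \<theta> ?f \<zero>\<^bsub>space_at N ?f\<^esub>" using \<eta>(3)[OF f0(1) e] by simp
    also have "\<dots> = \<zero>\<^bsub>space_at ?L ?f\<^esub>"
      by (rule lin_maps_zero[OF cg_module_vspace[OF N f0(1)]
            cg_module_vspace[OF is_cg_module_L[OF \<mu> p] f0(1)] cg_homD(1)[OF \<eta>(2) f0(1)]])
    finally show False using base_vector_nonzero by (simp only: L_module_add_smult)
  qed
qed

text \<open>For different types, the second module vanishes at the standard object of the first. For
  equal types, in a block where the shapes differ one of the two row weights is the larger or they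
  tie, and the isomorphism is used in the direction in which homomorphisms kill the base
  vector.\<close>

lemma L_module_iso_unique:
  assumes \<mu>: "\<mu> \<in> weights l d" and p: "p \<in> multipartitions l \<mu>"
    and \<nu>: "\<nu> \<in> weights l d" and q: "q \<in> multipartitions l \<nu>"
    and iso: "cg_isomorphic l d (L_module l d \<mu> p) (L_module l d \<nu> q)"
  shows "\<mu> = \<nu> \<and> p = q"
proof -
  note f0 = std_obj(1,2)[OF \<mu>]
  have same: "\<mu> = \<nu>"
  proof (rule ccontr)
    assume "\<mu> \<noteq> \<nu>"
    then have type: "type_of_obj l d (std_obj l d \<mu>) \<noteq> \<nu>" using f0(2) by simp
    show False
      by (rule L_module_iso_base_vector[OF \<mu> p is_cg_module_L[OF \<nu> q] iso])
        (simp add: L_module_space(2)[OF type])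
  qed
  have no_iso: False
    if r: "r \<in> multipartitions l \<mu>" and r': "r' \<in> multipartitions l \<mu>"
      and i: "i \<in> {1..l}" "r i \<noteq> r' i" "row_weight (r' i) \<le> row_weight (r i)"
      and iso: "cg_isomorphic l d (L_module l d \<mu> r) (L_module l d \<mu> r')" for r r' i
    by (rule L_module_iso_base_vector[OF \<mu> r is_cg_module_L[OF \<mu> r'] iso])
      (simp add: L_module_hom_base_vector[OF \<mu> r r' i] L_module_add_smult)
  have q': "q \<in> multipartitions l \<mu>" using q same by simp
  have iso': "cg_isomorphic l d (L_module l d \<mu> p) (L_module l d \<mu> q)" using iso same by simp
  have "p i = q i" if i: "i \<in> {1..l}" for i
    using no_iso[OF p q' i _ _ iso'] no_iso[OF q' p i _ _ cg_isomorphic_sym[OF iso']]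
    by (metis linorder_linear)
  then have "p = q"
    using p q' unfolding multipartitions_def by (intro PiE_ext) auto
  with same show ?thesis by blast
qed

section \<open>Existence\<close>

text \<open>For a vector \<open>v\<close> of a module \<open>M\<close> in the standard object, sending \<open>u\<close> to the sum over all
  \<open>\<kappa>\<close> of \<open>\<langle>\<kappa>\<^sup>-\<^sup>1 u, e\<rangle> \<kappa> v\<close> is a homomorphism from the Specht module to \<open>M\<close>. At an arbitrary object
  the sum runs over the morphisms from the standard object; its coefficients are the following.\<close>

definition avg_coeff ::
    "nat \<Rightarrow> nat \<Rightarrow> (nat \<Rightarrow> nat) \<Rightarrow> (nat \<Rightarrow> nat list) \<Rightarrow> ((nat \<Rightarrow> nat \<Rightarrow> nat set) \<Rightarrow> complex) \<Rightarrow>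
     (nat \<Rightarrow> nat) \<Rightarrow> ((nat \<Rightarrow> nat \<Rightarrow> nat set) \<Rightarrow> complex) \<Rightarrow> (nat \<Rightarrow> nat) \<Rightarrow> complex" where
  "avg_coeff l d \<mu> p e f u \<kappa> = (if \<kappa> \<in> morphs d (std_obj l d \<mu>) f
     then tensor_form l p (specht_tensor_act (block_component \<mu> (inv \<kappa> \<circ> sigma_morph d (std_obj l
         d \<mu>) f)) u) e
     else 0)"

lemma avg_coeff_in_lin_morphs: "avg_coeff l d \<mu> p e f u \<in> lin_morphs d (std_obj l d \<mu>) f"
  by (simp add: lin_morphs_def avg_coeff_def)

lemma avg_coeff_linear:
  "avg_coeff l d \<mu> p e f (\<lambda>x. u x + v x) =
      (\<lambda>\<kappa>. avg_coeff l d \<mu> p e f u \<kappa> + avg_coeff l d \<mu> p e f v \<kappa>)"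
  "avg_coeff l d \<mu> p e f (\<lambda>x. c * u x) = (\<lambda>\<kappa>. c * avg_coeff l d \<mu> p e f u \<kappa>)"
  by (auto simp: avg_coeff_def specht_tensor_act_def tensor_form_linear)

lemma tensor_form_sum_left:
  "tensor_form l p (\<lambda>x. \<Sum>a\<in>A. c a * u a x) v = (\<Sum>a\<in>A. c a * tensor_form l p (u a) v)"
proof -
  let ?X = "\<Pi>\<^sub>E i\<in>{1..l}. tabloids (p i)"
  have "tensor_form l p (\<lambda>x. \<Sum>a\<in>A. c a * u a x) v = (\<Sum>x\<in>?X. \<Sum>a\<in>A. c a * u a x * v x)"
    by (simp add: tensor_form_def sum_distrib_right)
  also have "\<dots> = (\<Sum>a\<in>A. \<Sum>x\<in>?X. c a * u a x * v x)" by (rule sum.swap)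
  finally show ?thesis by (simp add: tensor_form_def sum_distrib_left mult.assoc)
qed

text \<open>At \<open>\<tau>\<close>, both sides are the sum over \<open>\<pi>\<close> of
  \<open>a \<pi>\<close> times the coefficient of \<open>u\<close> at
  \<open>inv \<pi> \<circ> \<tau>\<close>.\<close>

lemma avg_coeff_natural:
  assumes \<mu>: "\<mu> \<in> weights l d"
    and f: "f \<in> objs l d" "type_of_obj l d f = \<mu>" and g: "g \<in> objs l d" "type_of_obj l d g = \<mu>"
    and u: "u \<in> specht_tensor l p"
  shows "avg_coeff l d \<mu> p e g (map_at (L_module l d \<mu> p) f g a u) =
    lin_comp d (std_obj l d \<mu>) f g a (avg_coeff l d \<mu> p e f u)"
proof
  let ?f = "std_obj l d \<mu>"
  fix \<tau>
  show "avg_coeff l d \<mu> p e g (map_at (L_module l d \<mu> p) f g a u) \<tau> =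
      lin_comp d ?f f g a (avg_coeff l d \<mu> p e f u) \<tau>"
  proof (cases "\<tau> \<in> morphs d ?f g")
    case True
    let ?k = "inv \<tau> \<circ> sigma_morph d ?f g"
    have k: "?k \<in> morphs d ?f ?f"
      using sigma_to_std(2)[OF \<mu> g] morphs_inv[OF True] by (rule morphs_comp)
    have term_eq: "specht_tensor_act (block_component \<mu> ?k) (L_morph l d \<mu> f g \<pi> u) =
        specht_tensor_act (block_component \<mu> (inv (inv \<pi> \<circ> \<tau>) \<circ> sigma_morph d ?f f)) u"
      if \<pi>: "\<pi> \<in> morphs d f g" for \<pi>
    proof -
      let ?n = "normalize_morph l d \<mu> f g \<pi>"
      \<comment> \<open>The two \<open>sigma_morph\<close> at \<open>g\<close> cancel, so the
        normalization at \<open>g\<close> leaves no trace.\<close>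
      have "?k \<circ> ?n = inv \<tau> \<circ> (sigma_morph d ?f g \<circ> sigma_morph d g ?f) \<circ> \<pi> \<circ> sigma_morph d ?f f"
        by (simp only: normalize_morph_def o_assoc)
      also have "\<dots> = inv \<tau> \<circ> \<pi> \<circ> sigma_morph d ?f f"
        by (simp only: sigma_to_std(3)[OF \<mu> g] inv_comp_cancel(2)[OF morphs_bij[OF
            sigma_to_std(2)[OF \<mu> g]]] comp_id)
      also have "inv \<tau> \<circ> \<pi> = inv (inv \<pi> \<circ> \<tau>)"
        using o_inv_distrib[OF bij_imp_bij_inv[OF morphs_bij[OF \<pi>]] morphs_bij[OF True]]
        by (simp only: inv_inv_eq[OF morphs_bij[OF \<pi>]])
      finally have kn: "?k \<circ> ?n = inv (inv \<pi> \<circ> \<tau>) \<circ> sigma_morph d ?f f" .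
      have "specht_tensor_act (block_component \<mu> (?k \<circ> ?n)) u =
          specht_tensor_act (\<lambda>i. block_component \<mu> ?k i \<circ> block_component \<mu> ?n i) u"
        using block_component_comp[OF \<mu> k normalize_morph_in[OF \<mu> f g \<pi>]]
            by (intro specht_tensor_act_cong[OF u])
      then show ?thesis by (simp only: L_morph_eq kn specht_tensor_act_comp)
    qed
    have act_sum: "specht_tensor_act (block_component \<mu> ?k) (\<lambda>x. \<Sum>\<pi>\<in>morphs d f g. a \<pi> * L_morph l
        d \<mu> f g \<pi> u x) =
        (\<lambda>x. \<Sum>\<pi>\<in>morphs d f g. a \<pi> * specht_tensor_act (block_component \<mu> ?k) (L_morph l d \<mu> f g \<pi>
            u) x)"
      by (simp add: specht_tensor_act_def)
    have "avg_coeff l d \<mu> p e g (map_at (L_module l d \<mu> p) f g a u) \<tau> =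
        (\<Sum>\<pi>\<in>morphs d f g. a \<pi> * tensor_form l p (specht_tensor_act (block_component \<mu> ?k) (L_morph
            l d \<mu> f g \<pi> u)) e)"
      using True by (simp only: avg_coeff_def if_True L_module_map(1)[OF f(2) g(2)] act_sum
          tensor_form_sum_left)
    also have "\<dots> = (\<Sum>\<pi>\<in>morphs d f g. a \<pi> * avg_coeff l d \<mu> p e f u (inv \<pi> \<circ> \<tau>))"
    proof (rule sum.cong[OF refl])
      fix \<pi> assume \<pi>: "\<pi> \<in> morphs d f g"
      have "inv \<pi> \<circ> \<tau> \<in> morphs d ?f f" by (rule morphs_comp[OF True morphs_inv[OF \<pi>]])
      then show "a \<pi> * tensor_form l p (specht_tensor_act (block_component \<mu> ?k) (L_morph l d \<mu> f
          g \<pi> u)) e =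
          a \<pi> * avg_coeff l d \<mu> p e f u (inv \<pi> \<circ> \<tau>)"
        by (simp only: avg_coeff_def if_True term_eq[OF \<pi>])
    qed
    also have "\<dots> = lin_comp d ?f f g a (avg_coeff l d \<mu> p e f u) \<tau>"
        by (rule lin_comp_apply[OF True, symmetric])
    finally show ?thesis .
  next
    case False
    then show ?thesis using lin_comp_in_lin_morphs[of d ?f f g]
        by (simp add: avg_coeff_def lin_morphs_def)
  qed
qed

text \<open>Between objects of type \<open>\<mu>\<close>, naturality is
  \<open>avg_coeff_natural\<close> followed by the composition law of \<open>M\<close>. If one of
  the two objects has another type, both sides vanish.\<close>

lemma avg_hom:
  assumes M: "is_cg_module l d M" and \<mu>: "\<mu> \<in> weights l d" and p: "p \<in> multipartitions l \<mu>"
    and v: "v \<in> carrier (space_at M (std_obj l d \<mu>))"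
  shows "(\<lambda>f u. if type_of_obj l d f = \<mu> then map_at M (std_obj l d \<mu>) f (avg_coeff l d \<mu> p e f u) v
      else \<zero>\<^bsub>space_at M f\<^esub>) \<in> cg_hom l d (L_module l d \<mu> p) M" (is "?\<eta> \<in> _")
  unfolding cg_hom_def
proof (intro CollectI conjI ballI)
  let ?f = "std_obj l d \<mu>" and ?L = "L_module l d \<mu> p"
  note f0 = std_obj(1,2)[OF \<mu>]
  fix f assume f: "f \<in> objs l d"
  note Vf = vspace_zero[OF cg_module_vspace[OF M f]]
  show "?\<eta> f \<in> lin_maps (space_at ?L f) (space_at M f)"
  proof (cases "type_of_obj l d f = \<mu>")
    case True
    show ?thesis
      unfolding lin_maps_def L_module_add_smult if_P[OF True]
    proof (intro CollectI conjI ballI allI Pi_I)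
      fix u w c
      let ?c = "avg_coeff l d \<mu> p e f"
      show "map_at M ?f f (?c u) v \<in> carrier (space_at M f)"
        by (rule lin_mapsD(1)[OF cg_module_lin_maps[OF M f0(1) f avg_coeff_in_lin_morphs] v])
      show "map_at M ?f f (?c (\<lambda>x. u x + w x)) v =
          map_at M ?f f (?c u) v \<oplus>\<^bsub>space_at M f\<^esub> map_at M ?f f (?c w) v"
        unfolding avg_coeff_linear
        by (rule cg_module_add_morph[OF M f0(1) f avg_coeff_in_lin_morphs avg_coeff_in_lin_morphs
            v])
      show "map_at M ?f f (?c (\<lambda>x. c * u x)) v = c \<odot>\<^bsub>space_at M f\<^esub> map_at M ?f f (?c u) v"
        unfolding avg_coeff_linear
        by (rule cg_module_scale_morph[OF M f0(1) f avg_coeff_in_lin_morphs v])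
    qed
  next
    case False
    show ?thesis
      unfolding lin_maps_def if_not_P[OF False]
      by (intro CollectI conjI ballI allI Pi_I) (simp_all only: Vf)
  qed
  fix g a u assume g: "g \<in> objs l d" and a: "a \<in> lin_morphs d f g"
      and u: "u \<in> carrier (space_at ?L f)"
  note Vg = vspace_zero[OF cg_module_vspace[OF M g]]
  show "?\<eta> g (map_at ?L f g a u) = map_at M f g a (?\<eta> f u)"
  proof (cases "type_of_obj l d f = \<mu>")
    case tf: True
    have u': "u \<in> specht_tensor l p" using u by (simp add: L_module_space(1)[OF tf])
    show ?thesis
    proof (cases "type_of_obj l d g = \<mu>")
      case tg: True
      show ?thesis
        unfolding if_P[OF tf] if_P[OF tg] avg_coeff_natural[OF \<mu> f tf g tg u']
        by (rule cg_module_comp[OF M f0(1) f g avg_coeff_in_lin_morphs a v])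
    next
      case tg: False
      then have "morphs d f g = {}" using morphs_empty_if_types_differ tf by metis
      then have "a = (\<lambda>_. 0)" using a by (auto simp: lin_morphs_def)
      moreover have "map_at M ?f f (avg_coeff l d \<mu> p e f u) v \<in> carrier (space_at M f)"
        by (rule lin_mapsD(1)[OF cg_module_lin_maps[OF M f0(1) f avg_coeff_in_lin_morphs] v])
      ultimately show ?thesis
        unfolding if_P[OF tf] if_not_P[OF tg] using cg_module_zero_morph[OF M f g] by simp
    qed
  next
    case tf: False
    have "map_at ?L f g a u = (\<lambda>_. 0)" using tf by (intro L_module_map(2)) blast
    moreover have "avg_coeff l d \<mu> p e g (\<lambda>_. 0) = (\<lambda>_. 0)"
      by (simp add: avg_coeff_def fun_eq_iff specht_tensor_act_def tensor_form_linear)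
    moreover have "map_at M f g a \<zero>\<^bsub>space_at M f\<^esub> = \<zero>\<^bsub>space_at M g\<^esub>"
      by (rule cg_module_zero_vec[OF M f g a])
    ultimately show ?thesis
      unfolding if_not_P[OF tf] using cg_module_zero_morph[OF M f0(1) g v] by simp
  qed
qed

text \<open>With \<open>e\<close> running over the spanning orbits of all multipartitions, a
  combination of the coefficient functions \<open>avg_coeff\<close> is the identity morphism, by
  \<open>delta_eq_sum_tensor_coeff\<close>. If all of them annihilated \<open>v\<close>, so would
  the identity.\<close>

lemma exists_nonzero_avg:
  assumes M: "is_cg_module l d M" and \<mu>: "\<mu> \<in> weights l d"
    and v: "v \<in> carrier (space_at M (std_obj l d \<mu>))" "v \<noteq> \<zero>\<^bsub>space_at M (std_obj l d \<mu>)\<^esub>"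
  shows "\<exists>p\<in>multipartitions l \<mu>. \<exists>e\<in>specht_tensor l p.
    map_at M (std_obj l d \<mu>) (std_obj l d \<mu>) (avg_coeff l d \<mu> p e (std_obj l d \<mu>) e) v \<noteq>
        \<zero>\<^bsub>space_at M (std_obj l d \<mu>)\<^esub>"
proof (rule ccontr)
  let ?f = "std_obj l d \<mu>"
  assume "\<not> ?thesis"
  then have 0: "map_at M ?f ?f (avg_coeff l d \<mu> p e ?f e) v = \<zero>\<^bsub>space_at M ?f\<^esub>"
    if "p \<in> multipartitions l \<mu>" "e \<in> specht_tensor l p" for p e using that by blast
  note f0 = std_obj(1)[OF \<mu>]
  note V = vspace_zero[OF cg_module_vspace[OF M f0]]
  \<comment> \<open>The annihilator of \<open>v\<close>; being a subspace, it is closed under the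
    combination that yields the identity morphism.\<close>
  define Z where "Z = {a \<in> lin_morphs d ?f ?f. map_at M ?f ?f a v = \<zero>\<^bsub>space_at M ?f\<^esub>}"
  have Z: "cfun.subspace Z"
  proof (rule cfun_subspaceI)
    show "(\<lambda>_. 0) \<in> Z"
      using cg_module_zero_morph[OF M f0 f0 v(1)] by (simp add: Z_def lin_morphs_def)
    show "(\<lambda>x. a x + b x) \<in> Z" if "a \<in> Z" "b \<in> Z" for a b
      using cg_module_add_morph[OF M f0 f0 _ _ v(1), of a b] that V(4)
        cfun_subspaceD(2)[OF subspace_lin_morphs, of a d ?f ?f b] by (simp add: Z_def)
    show "(\<lambda>x. c * a x) \<in> Z" if "a \<in> Z" for c a
      using cg_module_scale_morph[OF M f0 f0 _ v(1), of a c] that V(3)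
        cfun_subspaceD(3)[OF subspace_lin_morphs, of a d ?f ?f c] by (simp add: Z_def)
  qed
  let ?e = "\<lambda>p r. tableau_tensor l p (\<lambda>i. r i \<circ> base_tableaux p i)"
  obtain \<alpha> where \<alpha>: "\<And>s. (\<forall>i\<in>{1..l}. s i permutes {1..\<mu> i}) \<Longrightarrow>
    (\<Sum>p\<in>multipartitions l \<mu>. \<Sum>r\<in>component_perms l \<mu>. \<alpha> p * tensor_form l p (specht_tensor_act s
        (?e p r)) (?e p r)) =
    (if \<forall>i\<in>{1..l}. s i = id then 1 else 0)"
    using delta_eq_sum_tensor_coeff[of l \<mu>] by blast
  \<comment> \<open>The factor 1 brings the outer sum into the form of
    \<open>cfun_subspace_lincomb\<close>.\<close>
  have "(\<lambda>\<kappa>. \<Sum>p\<in>multipartitions l \<mu>. 1 * (\<Sum>r\<in>component_perms l \<mu>. \<alpha> p * avg_coeff l d \<mu> p (?e p r)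
      ?f (?e p r) \<kappa>)) \<in> Z"
  proof (intro cfun_subspace_lincomb[OF Z])
    fix p r assume p: "p \<in> multipartitions l \<mu>" and r: "r \<in> component_perms l \<mu>"
    have "?e p r \<in> specht_tensor l p"
        by (rule tableau_tensor_in_specht_tensor) (rule orbit_tableau[OF p r])
    then show "avg_coeff l d \<mu> p (?e p r) ?f (?e p r) \<in> Z"
      using 0[OF p] avg_coeff_in_lin_morphs by (simp add: Z_def)
  qed
  also have "(\<lambda>\<kappa>. \<Sum>p\<in>multipartitions l \<mu>. 1 * (\<Sum>r\<in>component_perms l \<mu>. \<alpha> p * avg_coeff l d \<mu> p (?e
      p r) ?f (?e p r) \<kappa>)) =
      basis_morph id"
  proof
    fix \<kappa>
    show "(\<Sum>p\<in>multipartitions l \<mu>. 1 * (\<Sum>r\<in>component_perms l \<mu>. \<alpha> p * avg_coeff l d \<mu> p (?e p r)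
        ?f (?e p r) \<kappa>)) =
        basis_morph id \<kappa>"
    proof (cases "\<kappa> \<in> morphs d ?f ?f")
      case True
      have inv: "inv \<kappa> \<in> morphs d ?f ?f" using True by (rule morphs_inv)
      have coeff: "avg_coeff l d \<mu> p e ?f u \<kappa> =
          tensor_form l p (specht_tensor_act (block_component \<mu> (inv \<kappa>)) u) e" for p e u
        using True by (simp only: avg_coeff_def if_True sigma_morph_self comp_id)
      \<comment> \<open>The coefficient at \<open>\<kappa>\<close> involves
        \<open>inv \<kappa>\<close>, but the indicator of the identity does not notice the
        inversion.\<close>
      have "(\<forall>i\<in>{1..l}. block_component \<mu> (inv \<kappa>) i = id) \<longleftrightarrow> \<kappa> = id"
      proof
        assume "\<forall>i\<in>{1..l}. block_component \<mu> (inv \<kappa>) i = id"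
        then have "inv \<kappa> = id" using block_component_eq_id[OF \<mu> inv] by blast
        then have "inv (inv \<kappa>) = inv id" by (rule arg_cong)
        then show "\<kappa> = id" by (simp only: inv_inv_eq[OF morphs_bij[OF True]] inv_id)
      qed (simp only: inv_id block_component_id, blast)
      then show ?thesis
        using \<alpha>[of "block_component \<mu> (inv \<kappa>)"] block_component_permutes[OF \<mu> inv]
        by (simp add: coeff basis_morph_def)
    next
      case False
      then have "\<kappa> \<noteq> id" using id_in_morphs by blast
      then show ?thesis using False by (simp add: avg_coeff_def basis_morph_def)
    qed
  qed
  finally have "map_at M ?f ?f (basis_morph id) v = \<zero>\<^bsub>space_at M ?f\<^esub>" by (simp add: Z_def)
  then show False using cg_module_id[OF M f0 v(1)] v(2) by simp
qed

text \<open>A nonzero vector at any object is carried by an invertible morphism to the standard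
  object of the same type and stays nonzero there. A nonvanishing average then gives a nonzero
  homomorphism from some simple \<open>L_module\<close>.\<close>

lemma simple_iso_L_module:
  assumes M: "simple_cg_module l d M"
  shows "\<exists>\<mu>\<in>weights l d. \<exists>p\<in>multipartitions l \<mu>. cg_isomorphic l d M (L_module l d \<mu> p)"
proof -
  have mod: "is_cg_module l d M" using M by (simp add: simple_cg_module_def)
  obtain f where f: "f \<in> objs l d" "carrier (space_at M f) \<noteq> {\<zero>\<^bsub>space_at M f\<^esub>}"
    using M unfolding simple_cg_module_def by blast
  then obtain w where w: "w \<in> carrier (space_at M f)" "w \<noteq> \<zero>\<^bsub>space_at M f\<^esub>"
    using vspace_zero(1)[OF cg_module_vspace[OF mod f(1)]] by blast
  define \<mu> where "\<mu> = type_of_obj l d f"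
  have \<mu>: "\<mu> \<in> weights l d" unfolding \<mu>_def by (rule type_of_obj_in_weights[OF f(1)])
  let ?f = "std_obj l d \<mu>"
  note f0 = std_obj(1,2)[OF \<mu>]
  note \<sigma> = sigma_to_std[OF \<mu> f(1) \<mu>_def[symmetric]]
  let ?a = "basis_morph (sigma_morph d f ?f)" and ?b = "basis_morph (sigma_morph d ?f f)"
  note ab = basis_morph_in_lin_morphs[OF \<sigma>(1)] basis_morph_in_lin_morphs[OF \<sigma>(2)]
  define v where "v = map_at M f ?f ?a w"
  have v: "v \<in> carrier (space_at M ?f)"
    unfolding v_def by (rule lin_mapsD(1)[OF cg_module_lin_maps[OF mod f(1) f0(1) ab(1)] w(1)])
  have comp: "lin_comp d f ?f f ?b ?a = basis_morph id"
  proof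
    fix \<tau>
    have inv: "sigma_morph d ?f f \<circ> sigma_morph d f ?f = id"
      unfolding \<sigma>(3) by (rule inv_comp_cancel(2)[OF morphs_bij[OF \<sigma>(2)]])
    have "lin_comp d f ?f f ?b ?a \<tau> =
        (\<Sum>\<rho>\<in>morphs d ?f f. ?b \<rho> * (\<Sum>\<sigma>'\<in>morphs d f ?f. ?a \<sigma>' * basis_morph (\<rho> \<circ> \<sigma>') \<tau>))"
      unfolding lin_comp_def sum_fun_apply sum_distrib_left mult.assoc ..
    also have "\<dots> = basis_morph id \<tau>"
      unfolding sum_basis_morph[OF \<sigma>(1)] sum_basis_morph[OF \<sigma>(2)] inv ..
    finally show "lin_comp d f ?f f ?b ?a \<tau> = basis_morph id \<tau>" .
  qed
  have "v \<noteq> \<zero>\<^bsub>space_at M ?f\<^esub>"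
  proof
    assume "v = \<zero>\<^bsub>space_at M ?f\<^esub>"
    then have "map_at M ?f f ?b v = \<zero>\<^bsub>space_at M f\<^esub>"
      using cg_module_zero_vec[OF mod f0(1) f(1) ab(2)] by simp
    moreover have "map_at M ?f f ?b v = w"
      unfolding v_def cg_module_comp[OF mod f(1) f0(1) f(1) ab w(1), symmetric] comp
      by (rule cg_module_id[OF mod f(1) w(1)])
    ultimately show False using w(2) by simp
  qed
  then obtain p e where p: "p \<in> multipartitions l \<mu>" and e: "e \<in> specht_tensor l p"
    and nz: "map_at M ?f ?f (avg_coeff l d \<mu> p e ?f e) v \<noteq> \<zero>\<^bsub>space_at M ?f\<^esub>"
    using exists_nonzero_avg[OF mod \<mu> v] by blast
  \<comment> \<open>The vector \<open>e\<close> serves twice: as the argument of the homomorphism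
    and as the vector with which the averages are paired.\<close>
  have "cg_isomorphic l d (L_module l d \<mu> p) M"
    by (rule schur[OF simple_L_module[OF \<mu> p] M avg_hom[OF mod \<mu> p v, of e] f0(1)])
      (use e nz f0(2) in \<open>simp_all add: L_module_space(1)[OF f0(2)]\<close>)
  then show ?thesis using \<mu> p cg_isomorphic_sym by blast
qed

text \<open>The cross-section is expressed through index pairs: existence of the pair says that the
  class of \<open>M\<close> is represented, uniqueness that no two indices represent it. The type of
  the vectors of \<open>M\<close> is arbitrary and may differ from that of the modules
  \<open>L_module\<close>.\<close>

theorem proposition3:
  fixes l d :: nat
  assumes "l > 0"
  shows "(\<forall>\<mu>\<in>weights l d. \<forall>p\<in>multipartitions l \<mu>. simple_cg_module l d (L_module l d \<mu> p)) \<and>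
    (\<forall>M :: 'v cg_module. simple_cg_module l d M \<longrightarrow>
       (\<exists>!x. x \<in> (SIGMA \<mu>:weights l d. multipartitions l \<mu>) \<and>
             cg_isomorphic l d M (L_module l d (fst x) (snd x))))"
proof (intro conjI ballI allI impI)
  fix M :: "'v cg_module" assume M: "simple_cg_module l d M"
  obtain \<mu> p where \<mu>: "\<mu> \<in> weights l d" and p: "p \<in> multipartitions l \<mu>"
    and iso: "cg_isomorphic l d M (L_module l d \<mu> p)"
    using simple_iso_L_module[OF M] by blast
  show "\<exists>!x. x \<in> (SIGMA \<mu>:weights l d. multipartitions l \<mu>) \<and>
      cg_isomorphic l d M (L_module l d (fst x) (snd x))"
  proof (rule ex1I[of _ "(\<mu>, p)"])
    show "(\<mu>, p) \<in> (SIGMA \<mu>:weights l d. multipartitions l \<mu>) \<and>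
        cg_isomorphic l d M (L_module l d (fst (\<mu>, p)) (snd (\<mu>, p)))"
      using \<mu> p iso by simp
    fix x assume x: "x \<in> (SIGMA \<mu>:weights l d. multipartitions l \<mu>) \<and>
        cg_isomorphic l d M (L_module l d (fst x) (snd x))"
    obtain \<nu> q where xq: "x = (\<nu>, q)" by (cases x)
    have \<nu>: "\<nu> \<in> weights l d" and q: "q \<in> multipartitions l \<nu>"
      and iso': "cg_isomorphic l d M (L_module l d \<nu> q)" using x xq by auto
    have "cg_isomorphic l d (L_module l d \<nu> q) (L_module l d \<mu> p)"
      by (rule cg_isomorphic_trans[OF cg_isomorphic_sym[OF iso'] iso])
    then have "\<nu> = \<mu> \<and> q = p" by (rule L_module_iso_unique[OF \<nu> q \<mu> p])
    then show "x = (\<mu>, p)" by (simp add: xq)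
  qed
qed (rule simple_L_module)

end
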